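(* Let $(Y_t)_{t\in\mathbb{Z}}$ be a strongly stationary and ergodic $\mathcal{Y}$-valued process, let $Q$ be a family of probabilistic kernels on $\mathcal{X}$ parametrized by $y\in\mathcal{Y}$, and let $X$ be a process in the environment $Y$ with kernels $Q$ (see context). Assume the following. (i) (Drift) There are a measurable $V:\mathcal{X}\to\mathbb{R}_+$, a non-decreasing sequence $A_n\in\mathfrak{A}$, $n\in\mathbb{N}$, with $A_0\neq\emptyset$ and $\mathcal{Y}=\bigcup_{n}A_n$, a non-increasing $\lambda:\mathbb{N}\to(0,1/3]$ and a non-decreasing $K:\mathbb{N}\to[1,\infty)$ such that, with $\Vert y\Vert:=\min\{n:\ y\in A_n\}$, for all $x\in\mathcal{X}$, $y\in\mathcal{Y}$, $$\int_{\mathcal{X}}V(z)\,Q(y,x,dz)\le(1-\lambda(\Vert y\Vert))V(x)+K(\Vert y\Vert).$$ (ii) (Minorization) With $C(R):=\{x\in\mathcal{X}:V(x)\le R\}$ and $R(n):=8K(n)/\lambda(n)$, there are a non-increasing $\alpha:\mathbb{N}\to(0,1/3]$ and probability measures $\nu_n$ on $\mathfrak{B}$, $n\in\mathbb{N}$, such that for all $y\in\mathcal{Y}$, $x\in C(R(\Vert y\Vert))$ and $A\in\mathfrak{B}$, $$Q(y,x,A)\ge\alpha(\Vert y\Vert)\,\nu_{\Vert y\Vert}(A).$$ (iii) (Maximal process) There are a non-decreasing $g:\mathbb{N}\to\mathbb{N}$ and a non-increasing $\ell:\mathbb{N}\to[0,1]$ such that $P(\max_{1\le i\le t}\Vert Y_i\Vert\ge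 g(t))\le\ell(t)$ for all $t\ge1$. (iv) $E[V^2(X_0)+V^2(X_1)]<\infty$. (v) $r_1(0)+r_2(0)<\infty$, where $$r_1(0):=\sum_{k=0}^\infty\frac{K(g(k))}{\alpha(g(k))}e^{-k\alpha(g(k))\lambda(g(k))/2},\qquad r_2(0):=\sum_{k=0}^\infty\frac{K(g(k+1))}{\alpha^2(g(k+1))\lambda(g(k+1))}\sqrt{\ell(k)}.$$ (vi) For some $0<\delta\le1/2$, $$\left(\frac{K(g(t))}{\lambda(g(t))}\right)^{2\delta}\frac{\pi(t)}{t}\to0\quad(t\to\infty),\qquad\text{where }\pi(t):=\frac{|\ln(\lambda(g(t)))|}{\alpha(g(t))\lambda(g(t))}.$$ Let $\phi:\mathcal{X}\to\mathbb{R}$ be measurable with $|\phi(z)|\le c(1+V^\delta(z))$, $z\in\mathcal{X}$, for some constant $c$. Then $$\frac{\phi(X_1)+\dots+\phi(X_t)}{t}\to\int_{\mathcal{X}}\phi(z)\,\mu_*(dz),\quad t\to\infty,$$ in $L^p$ for each $1\le p<1/\delta$, where $\mu_*$ is the probability on $\mathcal{X}$ which is the limit of $\mathrm{Law}(X_t)$ as $t\to\infty$ in $(1+V)$-weighted total variation.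
   Context: $\mathbb{N}=\{0,1,2,\dots\}$, $\mathbb{R}_+=[0,\infty)$. $\mathcal{Y}$ and $\mathcal{X}$ are Polish spaces with Borel sigma-fields $\mathfrak{A}$ and $\mathfrak{B}$ respectively. All random variables live on a probability space $(\Omega,\mathcal{F},P)$ (enlarged if necessary). A family of probabilistic kernels parametrized by $y\in\mathcal{Y}$ is a map $Q:\mathcal{Y}\times\mathcal{X}\times\mathfrak{B}\to[0,1]$ such that $Q(\cdot,\cdot,A)$ is $\mathfrak{A}\otimes\mathfrak{B}$-measurable for each $A\in\mathfrak{B}$ and $Q(y,x,\cdot)$ is a probability on $\mathfrak{B}$ for all $y,x$. A process $X$ in the environment $Y$ with kernels $Q$ is an $\mathcal{X}$-valued process $(X_t)_{t\in\mathbb{N}}$ such that for all $t\ge0$ and $A\in\mathfrak{B}$, $$P(X_{t+1}\in A\mid\mathcal{F}_t)=Q(Y_t,X_t,A)\quad P\text{-a.s.},\qquad \mathcal{F}_t:=\sigma(Y_j,\ j\in\mathbb{Z};\ X_j,\ 0\le j\le t).$$ The $(1+V)$-weighted total variation distance is $\rho_1(\nu_1,\nu_2):=\int_{\mathcal{X}}(1+V(x))\,|\nu_1-\nu_2|(dx)$. The existence of the limit $\mu_*$ of $\mathrm{Law}(X_t)$ in $\rho_1$, and its independence of $X_0$ (among initial values satisfying (iv)), is a separate theorem under hypotheses (i)-(v) (for which $R(n)=4K(n)/\lambda(n)$ in (ii) suffices). *)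

theory Defs
  imports "HOL-Probability.Probability"
begin

text \<open>Processes indexed by \<int>; the path space carries the product sigma-field
  \<^term>\<open>Pi\<^sub>M (UNIV :: int set) (\<lambda>_. borel)\<close>.\<close>

definition path_law :: "'w measure \<Rightarrow> (int \<Rightarrow> 'w \<Rightarrow> 'y::topological_space) \<Rightarrow> (int \<Rightarrow> 'y) measure"
  where "path_law M Y = distr M (Pi\<^sub>M UNIV (\<lambda>_. borel)) (\<lambda>w i. Y i w)"

definition strongly_stationary :: "'w measure \<Rightarrow> (int \<Rightarrow> 'w \<Rightarrow> 'y::topological_space) \<Rightarrow> bool"
  where "strongly_stationary M Y \<longleftrightarrow>
    (\<forall>i. Y i \<in> borel_measurable M) \<and> (\<forall>s. path_law M (\<lambda>i. Y (i + s)) = path_law M Y)"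

definition ergodic_process :: "'w measure \<Rightarrow> (int \<Rightarrow> 'w \<Rightarrow> 'y::topological_space) \<Rightarrow> bool"
  where "ergodic_process M Y \<longleftrightarrow>
    (\<forall>A \<in> sets (Pi\<^sub>M UNIV (\<lambda>_. borel)).
       (\<lambda>y i. y (i + 1)) -` A = A \<longrightarrow> measure (path_law M Y) A \<in> {0, 1})"

definition history ::
  "'w measure \<Rightarrow> (int \<Rightarrow> 'w \<Rightarrow> 'y::topological_space) \<Rightarrow> (nat \<Rightarrow> 'w \<Rightarrow> 'x::topological_space)
     \<Rightarrow> nat \<Rightarrow> 'w measure"
  where "history M Y X t = sigma (space M)
    ({Y j -` B \<inter> space M | j B. B \<in> sets borel} \<union>
     {X j -` B \<inter> space M | j B. j \<le> t \<and> B \<in> sets borel})"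

definition kernel_family :: "('y::topological_space \<Rightarrow> 'x::topological_space \<Rightarrow> 'x measure) \<Rightarrow> bool"
  where "kernel_family Q \<longleftrightarrow> (\<lambda>(y, x). Q y x) \<in> borel \<Otimes>\<^sub>M borel \<rightarrow>\<^sub>M prob_algebra borel"

definition process_in_environment ::
  "'w measure \<Rightarrow> (int \<Rightarrow> 'w \<Rightarrow> 'y::topological_space) \<Rightarrow> ('y \<Rightarrow> 'x::topological_space \<Rightarrow> 'x measure)
     \<Rightarrow> (nat \<Rightarrow> 'w \<Rightarrow> 'x) \<Rightarrow> bool"
  where "process_in_environment M Y Q X \<longleftrightarrow>
    (\<forall>t. X t \<in> borel_measurable M) \<and>
    (\<forall>t. \<forall>B \<in> sets borel. AE w in M.
       real_cond_exp M (history M Y X t) (indicator (X (Suc t) -` B \<inter> space M)) w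
         = measure (Q (Y (int t) w) (X t w)) B)"

definition level :: "(nat \<Rightarrow> 'y set) \<Rightarrow> 'y \<Rightarrow> nat"
  where "level A y = (LEAST n. y \<in> A n)"

text \<open>The total variation measure |M - N| of the signed measure M - N, for finite measures
  M and N on the same sigma-field.\<close>

definition tv_measure :: "'a measure \<Rightarrow> 'a measure \<Rightarrow> 'a measure"
  where "tv_measure M N = measure_of (space M) (sets M)
    (\<lambda>A. SUP P \<in> {P. finite P \<and> disjoint P \<and> P \<subseteq> sets M \<and> \<Union>P = A}.
       \<Sum>B\<in>P. ennreal \<bar>measure M B - measure N B\<bar>)"

text \<open>Since \<^const>\<open>measure_of\<close> yields the null measure for a set function that is not
  countably additive, we check that \<^const>\<open>tv_measure\<close> takes the intended values.\<close>

lemma emeasure_tv_measure: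
  assumes "finite_measure M" "finite_measure N" and sets_eq: "sets N = sets M" and A: "A \<in> sets M"
  shows "emeasure (tv_measure M N) A =
    (SUP P \<in> {P. finite P \<and> disjoint P \<and> P \<subseteq> sets M \<and> \<Union>P = A}.
       \<Sum>B\<in>P. ennreal \<bar>measure M B - measure N B\<bar>)"
proof -
  interpret M: finite_measure M by fact
  interpret N: finite_measure N by fact
  obtain Y where Y[measurable]: "Y \<in> sets M"
    and Y1: "\<And>X. X \<in> sets M \<Longrightarrow> X \<subseteq> Y \<Longrightarrow> emeasure N X \<le> emeasure M X"
    and Y2: "\<And>X. X \<in> sets M \<Longrightarrow> X \<inter> Y = {} \<Longrightarrow> emeasure M X \<le> emeasure N X"
    using finite_unsigned_Hahn_decomposition[OF assms(1,2) sets_eq] by blast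
  have Y1': "measure N (X \<inter> Y) \<le> measure M (X \<inter> Y)" if "X \<in> sets M" for X
    using Y1[of "X \<inter> Y"] that by (simp add: M.emeasure_eq_measure N.emeasure_eq_measure)
  have Y2': "measure M (X - Y) \<le> measure N (X - Y)" if "X \<in> sets M" for X
    using Y2[of "X - Y"] that by (auto simp: M.emeasure_eq_measure N.emeasure_eq_measure)
  define m where "m X = (measure M (X \<inter> Y) - measure N (X \<inter> Y))
      + (measure N (X - Y) - measure M (X - Y))" for X
  have m_nonneg: "0 \<le> m X" if "X \<in> sets M" for X
    using Y1'[OF that] Y2'[OF that] by (simp add: m_def)
  have m_sums: "(\<lambda>i. m (F i)) sums m (\<Union>i. F i)"
    if F: "range F \<subseteq> sets M" "disjoint_family F" for F :: "nat \<Rightarrow> 'a set"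
  proof -
    have 1: "(\<Union>i. F i) \<inter> Y = (\<Union>i. F i \<inter> Y)" "(\<Union>i. F i) - Y = (\<Union>i. F i - Y)" by auto
    have 2: "disjoint_family (\<lambda>i. F i \<inter> Y)" "disjoint_family (\<lambda>i. F i - Y)"
      using F(2) by (auto simp: disjoint_family_on_def)
    have 3: "range (\<lambda>i. F i \<inter> Y) \<subseteq> sets M" "range (\<lambda>i. F i - Y) \<subseteq> sets M"
      using F(1) by auto
    show ?thesis
      unfolding m_def 1
      by (intro sums_add sums_diff M.finite_measure_UNION N.finite_measure_UNION 2)
        (use 3 sets_eq in auto)
  qed
  have m_sum: "(\<Sum>B\<in>P. m B) = m (\<Union>P)" if "finite P" "disjoint P" "P \<subseteq> sets M" for P
    using that
  proof (induction P rule: finite_induct)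
    case empty
    then show ?case by (simp add: m_def)
  next
    case (insert B P)
    have d: "B \<inter> \<Union>P = {}" and dP: "disjoint P" and s: "B \<in> sets M" "\<Union>P \<in> sets M"
      using insert by (auto simp: disjoint_def intro!: sets.finite_Union)
    have e: "(B \<union> \<Union>P) \<inter> Y = (B \<inter> Y) \<union> (\<Union>P \<inter> Y)" "(B \<union> \<Union>P) - Y = (B - Y) \<union> (\<Union>P - Y)"
      by auto
    have "m (B \<union> \<Union>P) = m B + m (\<Union>P)"
      unfolding m_def e
      by (subst M.finite_measure_Union N.finite_measure_Union; use s d sets_eq in auto)+
    then show ?case using insert dP by simp
  qed
  have le: "\<bar>measure M B - measure N B\<bar> \<le> m B" if "B \<in> sets M" for B
  proof -
    have e: "B = (B \<inter> Y) \<union> (B - Y)" by auto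
    have "measure M B = measure M (B \<inter> Y) + measure M (B - Y)"
      by (subst e, rule M.finite_measure_Union) (use that in auto)
    moreover have "measure N B = measure N (B \<inter> Y) + measure N (B - Y)"
      by (subst e, rule N.finite_measure_Union) (use that sets_eq in auto)
    ultimately show ?thesis using Y1'[OF that] Y2'[OF that] by (simp add: m_def)
  qed
  let ?S = "\<lambda>A. SUP P \<in> {P. finite P \<and> disjoint P \<and> P \<subseteq> sets M \<and> \<Union>P = A}.
       \<Sum>B\<in>P. ennreal \<bar>measure M B - measure N B\<bar>"
  have S_eq: "?S X = ennreal (m X)" if X: "X \<in> sets M" for X
  proof (rule antisym)
    show "?S X \<le> ennreal (m X)"
    proof (rule SUP_least)
      fix P assume "P \<in> {P. finite P \<and> disjoint P \<and> P \<subseteq> sets M \<and> \<Union>P = X}"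
      then have P: "finite P" "disjoint P" "P \<subseteq> sets M" "\<Union>P = X" by auto
      have "(\<Sum>B\<in>P. ennreal \<bar>measure M B - measure N B\<bar>) \<le> (\<Sum>B\<in>P. ennreal (m B))"
        using P le by (intro sum_mono ennreal_leI) auto
      also have "\<dots> = ennreal (\<Sum>B\<in>P. m B)"
        using P m_nonneg by (intro sum_ennreal) auto
      finally show "(\<Sum>B\<in>P. ennreal \<bar>measure M B - measure N B\<bar>) \<le> ennreal (m X)"
        using m_sum[OF P(1-3)] P(4) by simp
    qed
    let ?P = "{X \<inter> Y, X - Y}"
    have "ennreal (m X) = (\<Sum>B\<in>?P. ennreal \<bar>measure M B - measure N B\<bar>)"
    proof (cases "X \<inter> Y = X - Y")
      case True
      then have "X = {}" by auto
      then show ?thesis by (simp add: m_def)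
    next
      case False
      then show ?thesis
        using Y1'[OF X] Y2'[OF X] by (simp add: m_def flip: ennreal_plus)
    qed
    also have "\<dots> \<le> ?S X"
      using X by (intro SUP_upper) (auto simp: disjoint_def)
    finally show "ennreal (m X) \<le> ?S X" .
  qed
  have ca: "countably_additive (sets M) ?S"
  proof (rule countably_additiveI)
    fix F :: "nat \<Rightarrow> 'a set"
    assume F: "range F \<subseteq> sets M" "disjoint_family F" "\<Union> (range F) \<in> sets M"
    have "(\<Sum>i. ?S (F i)) = (\<Sum>i. ennreal (m (F i)))"
      using F(1) by (intro suminf_cong S_eq) auto
    also have "\<dots> = ennreal (m (\<Union> (range F)))"
      using F(1) m_nonneg m_sums[OF F(1,2)]
      by (intro suminf_ennreal_eq) auto
    also have "\<dots> = ?S (\<Union> (range F))"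
      using S_eq[OF F(3)] by simp
    finally show "(\<Sum>i. ?S (F i)) = ?S (\<Union> (range F))" .
  qed
  have pos: "positive (sets M) ?S"
    unfolding positive_def by (subst S_eq) (auto simp: m_def)
  have sets_tv: "sets (tv_measure M N) = sets M"
    by (simp add: tv_measure_def)
  show ?thesis
    by (rule emeasure_measure_of[OF tv_measure_def])
      (use ca pos A sets.space_closed[of M] in \<open>simp_all only: sets_tv\<close>)
qed

text \<open>The (1 + V)-weighted total variation distance.\<close>

definition rho1 :: "('x \<Rightarrow> real) \<Rightarrow> 'x measure \<Rightarrow> 'x measure \<Rightarrow> ennreal"
  where "rho1 V \<nu>\<^sub>1 \<nu>\<^sub>2 = (\<integral>\<^sup>+ x. ennreal (1 + V x) \<partial>tv_measure \<nu>\<^sub>1 \<nu>\<^sub>2)"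

definition tendsto_Lp :: "'w measure \<Rightarrow> real \<Rightarrow> (nat \<Rightarrow> 'w \<Rightarrow> real) \<Rightarrow> real \<Rightarrow> bool"
  where "tendsto_Lp M p f a \<longleftrightarrow> ((\<lambda>t. \<integral>\<^sup>+ w. ennreal (\<bar>f t w - a\<bar> powr p) \<partial>M) \<longlonglongrightarrow> 0)"

end

theory Submission
  imports Defs
begin

text \<open>The argument is quenched. For a fixed environment path the stationary series
  \<open>W(y) = \<Sum>\<^sub>j K(y\<^sub>-\<^sub>1\<^sub>-\<^sub>j) \<Prod>\<^sub>i\<^sub><\<^sub>j (1 - \<lambda>(y\<^sub>-\<^sub>1\<^sub>-\<^sub>i))\<close>
  solves the drift recursion with equality and is integrable by the hypotheses on the maximal
  process. If \<open>W > 2K/\<lambda>\<close> held almost surely, \<open>W\<close> would decrease strictly along the shift, against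
  stationarity; hence for some level \<open>m\<close> the set of paths at level \<open>m\<close> with \<open>W \<le> 2K(m)/\<lambda>(m)\<close> has
  positive probability and is visited infinitely often by ergodicity. At each visit the
  minorization at the single level \<open>m\<close> contracts weighted oscillations, measured relative to \<open>W\<close>, by a
  factor depending only on \<open>m\<close>. Together with uniform integrability of \<open>V(X\<^sub>t)\<close> this makes two
  chains in the same environment merge in mean, uniformly over the starting time, which yields the
  limit law. It also makes \<open>\<phi>(X\<^sub>t)\<close> asymptotically uncorrelated after subtracting a function of the
  environment, whose averages converge by the ergodic theorem. Boundedness in \<open>L\<^sup>1\<^sup>/\<^sup>\<delta>\<close> then
  upgrades convergence in probability to \<open>L\<^sup>p\<close>.\<close>

text \<open>Since \<open>lam\<close> and \<open>alpha\<close> may tend to 0 along the levels, no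
  contraction rate holds at every time. Progress is booked only at visits to one level, so nothing
  may be lost in between. This is why oscillations are bounded by
  \<open>a + b * (V x + V x')\<close> with two parameters: a kernel at level n turns (a, b) into (a
  + 2bK(n), b(1 - \<lambda>(n))), while W becomes (1 - \<lambda>(n))W + K(n) under the shift, so a +
  2bW is preserved exactly, however bad the level. The minorization removes \<alpha>a from a and
  adds \<alpha>a/R to b, where R = 8K/\<lambda>; when W is at most 2K/\<lambda>, one has 4W <= R,
  and at most half of the gain is returned. The price is a factor W at the final time, and no moment
  of the product of W and V is available. On exceptional environments an additive bound is used
  instead. There V(X_t) is replaced, given the environment, by V(X_0) plus W at time t; each of
  these two terms has a law independent of t, whence the uniformity over starting times.\<close>

section \<open>Birkhoff averages of bounded functions\<close>

text \<open>Garsia's proof of the maximal ergodic inequality: \<open>m n\<close> is the maximum of the first \<open>n\<close> orbit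
  sums and 0, and on \<open>{m (n + 1) > 0}\<close> one has \<open>f = m (n + 1) - m n \<circ> T\<close>.\<close>

lemma (in prob_space) integral_pos_part_orbit_max:
  fixes f :: "'a \<Rightarrow> real" and m :: "nat \<Rightarrow> 'a \<Rightarrow> real"
  assumes T[measurable]: "T \<in> M \<rightarrow>\<^sub>M M" and inv: "distr M M T = M" and f: "integrable M f"
    and m0: "\<And>y. m 0 y = 0" and mS: "\<And>n y. m (Suc n) y = max 0 (f y + m n (T y))"
  shows "integrable M (m n)" "0 \<le> (\<integral>y. indicator {y. 0 < m n y} y * f y \<partial>M)"
proof -
  have T_int: "integrable M (\<lambda>y. h (T y))" "(\<integral>y. h (T y) \<partial>M) = (\<integral>y. h y \<partial>M)"
    if "integrable M h" for h :: "'a \<Rightarrow> real"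
  proof -
    have [measurable]: "h \<in> borel_measurable M" using that by auto
    show "integrable M (\<lambda>y. h (T y))"
      using that integrable_distr_eq[OF T, of h] inv by simp
    show "(\<integral>y. h (T y) \<partial>M) = (\<integral>y. h y \<partial>M)"
      using integral_distr[OF T, of h] inv by simp
  qed
  have int: "integrable M (m n)" for n
  proof (induction n)
    case 0 then show ?case by (simp add: m0 cong: Bochner_Integration.integrable_cong)
  next
    case (Suc n)
    then show ?case using T_int(1)[OF Suc] f by (simp add: mS cong: Bochner_Integration.integrable_cong)
  qed
  then show "integrable M (m n)" .
  have nn: "0 \<le> m n y" for n y by (cases n) (auto simp: m0 mS)
  have step: "m n y \<le> m (Suc n) y" for n y
  proof (induction n arbitrary: y)
    case 0 then show ?case by (simp add: m0 nn)
  next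
    case (Suc n) show ?case using Suc[of "T y"] by (simp add: mS[of n] mS[of "Suc n"])
  qed
  show "0 \<le> (\<integral>y. indicator {y. 0 < m n y} y * f y \<partial>M)"
  proof (cases n)
    case 0 then show ?thesis by (simp add: m0)
  next
    case (Suc k)
    have [measurable]: "m n \<in> borel_measurable M" for n using int[of n] by auto
    have "0 \<le> (\<integral>y. m n y \<partial>M) - (\<integral>y. m k (T y) \<partial>M)"
      using integral_mono[OF int[of k] int[of n]] step[of k] T_int(2)[OF int[of k]] Suc by simp
    also have "\<dots> = (\<integral>y. m n y - m k (T y) \<partial>M)"
      using int T_int(1)[OF int[of k]] by simp
    also have "\<dots> \<le> (\<integral>y. indicator {y. 0 < m n y} y * f y \<partial>M)"
    proof (rule integral_mono)
      show "integrable M (\<lambda>y. m n y - m k (T y))"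
        using int T_int(1)[OF int[of k]] by simp
      have "{y \<in> space M. 0 < m n y} \<in> sets M" by measurable
      then have "integrable M (\<lambda>y. indicator {y \<in> space M. 0 < m n y} y * f y)"
        using integrable_real_mult_indicator[of "{y \<in> space M. 0 < m n y}" M f] f by (simp add: mult.commute)
      then show "integrable M (\<lambda>y. indicator {y. 0 < m n y} y * f y)"
        by (rule Bochner_Integration.integrable_cong[THEN iffD1, rotated -1]) (auto simp: indicator_def)
      show "m n y - m k (T y) \<le> indicator {y. 0 < m n y} y * f y" for y
        using nn[of k "T y"] mS[of k y] Suc nn[of n y] by (auto simp: indicator_def)
    qed
    finally show ?thesis .
  qed
qed

text \<open>The maximum \<open>m N\<close> dominates every orbit sum of length at most
  \<open>N\<close>, so the sets \<open>{y. 0 < m N y}\<close> exhaust almost all of the space. The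
  maximal inequality on them passes to the limit by dominated convergence with majorant
  \<open>\<bar>f\<bar>\<close>.\<close>

lemma (in prob_space) integral_nonneg_if_orbit_sum_pos:
  fixes f :: "'a \<Rightarrow> real"
  assumes T[measurable]: "T \<in> M \<rightarrow>\<^sub>M M" and inv: "distr M M T = M" and f: "integrable M f"
    and pos: "AE y in M. \<exists>n. 0 < (\<Sum>i<n. f ((T ^^ i) y))"
  shows "0 \<le> (\<integral>y. f y \<partial>M)"
proof -
  define m where "m = rec_nat (\<lambda>_. 0) (\<lambda>n h y. max 0 (f y + h (T y)))"
  have m0: "m 0 y = 0" and mS: "m (Suc n) y = max 0 (f y + m n (T y))" for n y
    by (auto simp: m_def)
  note mm = integral_pos_part_orbit_max[OF T inv f, of m, OF m0 mS]
  have [measurable]: "m n \<in> borel_measurable M" for n using mm(1)[of n] by auto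
  have [measurable]: "f \<in> borel_measurable M" using f by auto
  have le: "(\<Sum>i<n. f ((T ^^ i) y)) \<le> m N y" if "n \<le> N" for n N y
    using that
  proof (induction N arbitrary: n y)
    case 0 then show ?case by (simp add: m0)
  next
    case (Suc N)
    show ?case
    proof (cases n)
      case 0 then show ?thesis by (simp add: mS)
    next
      case (Suc k)
      have "(\<Sum>i<n. f ((T ^^ i) y)) = f y + (\<Sum>i<k. f ((T ^^ i) (T y)))"
        unfolding Suc by (subst sum.lessThan_Suc_shift) (simp add: funpow_swap1)
      also have "\<dots> \<le> f y + m N (T y)" using Suc.IH[of k "T y"] Suc Suc.prems by simp
      finally show ?thesis by (simp add: mS)
    qed
  qed
  have "(\<lambda>n. \<integral>y. indicator {y. 0 < m n y} y * f y \<partial>M) \<longlonglongrightarrow> (\<integral>y. f y \<partial>M)"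
  proof (rule integral_dominated_convergence[where w="\<lambda>y. \<bar>f y\<bar>"])
    show "f \<in> borel_measurable M" by measurable
    show "(\<lambda>y. indicator {y. 0 < m n y} y * f y) \<in> borel_measurable M" for n
      by (simp add: indicator_def cong: if_cong)
    show "integrable M (\<lambda>y. \<bar>f y\<bar>)" using f by simp
    show "AE y in M. (\<lambda>n. indicator {y. 0 < m n y} y * f y) \<longlonglongrightarrow> f y"
      using pos
    proof eventually_elim
      case (elim y)
      then obtain n where n: "0 < (\<Sum>i<n. f ((T ^^ i) y))" by blast
      have "eventually (\<lambda>N. indicator {y. 0 < m N y} y * f y = f y) sequentially"
        using eventually_ge_at_top[of n]
      proof eventually_elim
        case (elim N) then show ?case using n le[of n N y] by simp
      qed
      then show ?case by (rule tendsto_eventually)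
    qed
    show "AE y in M. norm (indicator {y. 0 < m n y} y * f y) \<le> \<bar>f y\<bar>" for n
      by (auto simp: indicator_def)
  qed
  then show ?thesis
    using mm(2) LIMSEQ_le_const by blast
qed

text \<open>Unboundedness of the orbit sums is unaffected by dropping the first term, so this event
  is strictly invariant and has probability 0 or 1. Probability 1 would make some orbit sum positive
  almost surely, and the integral could not be negative.\<close>

lemma (in prob_space) ergodic_orbit_sum_bdd:
  fixes f :: "'a \<Rightarrow> real"
  assumes T[measurable]: "T \<in> M \<rightarrow>\<^sub>M M" and inv: "distr M M T = M" and f: "integrable M f"
    and sp: "space M = UNIV"
    and erg: "\<And>A. A \<in> sets M \<Longrightarrow> T -` A = A \<Longrightarrow> prob A \<in> {0, 1}"
    and neg: "(\<integral>y. f y \<partial>M) < 0"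
  shows "AE y in M. \<exists>C. \<forall>n. (\<Sum>i<n. f ((T ^^ i) y)) \<le> C"
proof -
  have [measurable]: "f \<in> borel_measurable M" using f by auto
  have [measurable]: "(T ^^ i) \<in> M \<rightarrow>\<^sub>M M" for i by (induction i) (auto simp: id_def)
  define S where "S n y = (\<Sum>i<n. f ((T ^^ i) y))" for n y
  have [measurable]: "S n \<in> borel_measurable M" for n unfolding S_def by measurable
  have SS: "S (Suc n) y = f y + S n (T y)" for n y
    unfolding S_def by (subst sum.lessThan_Suc_shift) (simp add: funpow_swap1)
  define E where "E = {y. \<forall>k::nat. \<exists>n. real k < S n y}"
  have Em[measurable]: "E \<in> sets M"
  proof -
    have "{y \<in> space M. \<forall>k::nat. \<exists>n. real k < S n y} \<in> sets M" by measurable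
    then show ?thesis by (simp add: E_def sp)
  qed
  have E_iff: "y \<in> E \<longleftrightarrow> (\<forall>C. \<exists>n. C < S n y)" for y
  proof -
    have "\<exists>n. C < S n y" if "\<forall>k::nat. \<exists>n. real k < S n y" for C
      using that reals_Archimedean2[of C] by (meson less_trans)
    then show ?thesis by (auto simp: E_def)
  qed
  have "T y \<in> E \<longleftrightarrow> y \<in> E" for y
  proof
    assume "T y \<in> E"
    show "y \<in> E" unfolding E_iff
    proof
      fix C obtain n where "C - f y < S n (T y)" using \<open>T y \<in> E\<close> E_iff by blast
      then have "C < S (Suc n) y" by (simp add: SS)
      then show "\<exists>n. C < S n y" by blast
    qed
  next
    assume "y \<in> E"
    show "T y \<in> E" unfolding E_iff
    proof
      \<comment> \<open>The maximum with 0 rules out \<open>n = 0\<close>, where the orbit sum is 0,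
        so a first term can be split off.\<close>
      fix C obtain n where n: "max 0 (C + f y) < S n y" using \<open>y \<in> E\<close> E_iff by blast
      then obtain k where "n = Suc k" by (cases n) (auto simp: S_def)
      then have "C < S k (T y)" using n by (simp add: SS)
      then show "\<exists>n. C < S n (T y)" by blast
    qed
  qed
  then have "T -` E = E" by auto
  then have "prob E = 0 \<or> prob E = 1" using erg[OF Em] by auto
  then show ?thesis
  proof
    assume "prob E = 0"
    then have "AE y in M. y \<notin> E" using Em prob_eq_0 by blast
    then show ?thesis by eventually_elim (auto simp: E_iff S_def not_less)
  next
    assume "prob E = 1"
    then have "AE y in M. y \<in> E" using Em prob_eq_1 by blast
    then have "AE y in M. \<exists>n. 0 < S n y" by eventually_elim (auto simp: E_iff)
    then have "0 \<le> (\<integral>y. f y \<partial>M)"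
      using integral_nonneg_if_orbit_sum_pos[OF T inv f] by (simp add: S_def)
    then show ?thesis using neg by simp
  qed
qed

text \<open>Centring \<open>f\<close> and \<open>- f\<close> and subtracting a small e makes the
  integral negative, so the orbit sums stay within C + n * e of n times the mean. Taking e = 1 / (k
  + 1) for all k gives almost sure convergence, and boundedness upgrades it to convergence in
  mean.\<close>

lemma (in prob_space) birkhoff_bounded:
  fixes f :: "'a \<Rightarrow> real"
  assumes T[measurable]: "T \<in> M \<rightarrow>\<^sub>M M" and inv: "distr M M T = M"
    and fm[measurable]: "f \<in> borel_measurable M" and fB: "\<And>y. \<bar>f y\<bar> \<le> B"
    and sp: "space M = UNIV"
    and erg: "\<And>A. A \<in> sets M \<Longrightarrow> T -` A = A \<Longrightarrow> prob A \<in> {0, 1}"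
  shows "(\<lambda>n. \<integral>y. \<bar>(\<Sum>i<n. f ((T ^^ i) y)) / real n - (\<integral>y. f y \<partial>M)\<bar> \<partial>M) \<longlonglongrightarrow> 0"
proof -
  have [measurable]: "(T ^^ i) \<in> M \<rightarrow>\<^sub>M M" for i by (induction i) (auto simp: id_def)
  have fi: "integrable M f" by (rule integrable_const_bound[of _ B]) (use fB in auto)
  let ?I = "\<integral>y. f y \<partial>M"
  define S where "S n y = (\<Sum>i<n. f ((T ^^ i) y))" for n y
  have [measurable]: "S n \<in> borel_measurable M" for n unfolding S_def by measurable
  have one: "AE y in M. \<exists>C. \<forall>n. (\<Sum>i<n. h ((T ^^ i) y)) - real n * ((\<integral>y. h y \<partial>M) + e) \<le> C"
    if "0 < e" "integrable M h" for h :: "'a \<Rightarrow> real" and e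
  proof -
    have "AE y in M. \<exists>C. \<forall>n. (\<Sum>i<n. h ((T ^^ i) y) - ((\<integral>y. h y \<partial>M) + e)) \<le> C"
      using that by (intro ergodic_orbit_sum_bdd[OF T inv _ sp erg, of "\<lambda>y. h y - ((\<integral>y. h y \<partial>M) + e)"])
        (auto simp: prob_space)
    then show ?thesis by (simp add: sum_subtractf)
  qed
  have "AE y in M. \<forall>k. (\<exists>C. \<forall>n. S n y - real n * (?I + 1 / real (Suc k)) \<le> C) \<and>
           (\<exists>C. \<forall>n. - S n y - real n * (- ?I + 1 / real (Suc k)) \<le> C)"
    unfolding AE_all_countable
  proof
    fix k
    show "AE y in M. (\<exists>C. \<forall>n. S n y - real n * (?I + 1 / real (Suc k)) \<le> C) \<and>
           (\<exists>C. \<forall>n. - S n y - real n * (- ?I + 1 / real (Suc k)) \<le> C)"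
      using one[of "1 / real (Suc k)" f] one[of "1 / real (Suc k)" "\<lambda>y. - f y"] fi
      by (auto simp: S_def sum_negf)
  qed
  then have ae: "AE y in M. (\<lambda>n. S n y / real n) \<longlonglongrightarrow> ?I"
  proof eventually_elim
    case (elim y)
    show ?case
    proof (rule LIMSEQ_I)
      fix r :: real assume "0 < r"
      then obtain k where k: "1 / real (Suc k) < r / 2" using nat_approx_posE[of "r/2"] by auto
      obtain C where C: "\<And>n. S n y - real n * (?I + 1 / real (Suc k)) \<le> C"
        using elim by blast
      obtain C' where C': "\<And>n. - S n y - real n * (- ?I + 1 / real (Suc k)) \<le> C'"
        using elim by blast
      define D where "D = max \<bar>C\<bar> \<bar>C'\<bar>"
      obtain N where N: "2 * D / r < real N" using reals_Archimedean2 by blast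
      have "0 \<le> D" by (simp add: D_def)
      have "norm (S n y / real n - ?I) < r" if n: "n \<ge> N" for n
      proof -
        have np: "0 < real n" using N n \<open>0 \<le> D\<close> \<open>0 < r\<close>
          by (metis divide_nonneg_pos linorder_not_le mult_nonneg_nonneg of_nat_le_iff of_nat_0_less_iff
              order_le_less_trans zero_le_numeral gr0I le_zero_eq of_nat_0)
        have Dn: "D < real n * (r / 2)"
        proof -
          have "2 * D < real N * r" using N \<open>0 < r\<close> by (simp add: pos_divide_less_eq)
          also have "\<dots> \<le> real n * r" using n \<open>0 < r\<close> by simp
          finally show ?thesis by simp
        qed
        have kn: "real n * (1 / real (Suc k)) \<le> real n * (r / 2)"
          using k np by (intro mult_left_mono) auto
        have "S n y - real n * ?I \<le> D + real n * (1 / real (Suc k))"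
          using C[of n] by (simp add: D_def algebra_simps)
        moreover have "- (S n y - real n * ?I) \<le> D + real n * (1 / real (Suc k))"
          using C'[of n] by (simp add: D_def algebra_simps)
        ultimately have "\<bar>S n y - real n * ?I\<bar> < real n * r" using Dn kn by linarith
        moreover have "S n y / real n - ?I = (S n y - real n * ?I) / real n"
          using np by (simp add: field_simps)
        ultimately show ?thesis using np by (simp add: pos_divide_less_eq mult.commute)
      qed
      then show "\<exists>N. \<forall>n\<ge>N. norm (S n y / real n - ?I) < r" by blast
    qed
  qed
  have Sb: "\<bar>S n y / real n\<bar> \<le> B" for n y
  proof -
    have "0 \<le> B" using fB[of y] by linarith
    have "\<bar>S n y\<bar> \<le> (\<Sum>i<n. B)" unfolding S_def
      by (rule order_trans[OF sum_abs]) (intro sum_mono fB)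
    then show ?thesis using \<open>0 \<le> B\<close> by (cases n) (auto simp: field_simps)
  qed
  have "(\<lambda>n. \<integral>y. \<bar>S n y / real n - ?I\<bar> \<partial>M) \<longlonglongrightarrow> (\<integral>y. 0 \<partial>M)"
  proof (rule integral_dominated_convergence[where w="\<lambda>y. B + \<bar>?I\<bar>"])
    show "AE y in M. (\<lambda>n. \<bar>S n y / real n - ?I\<bar>) \<longlonglongrightarrow> 0"
      using ae by eventually_elim (metis LIM_zero tendsto_rabs_zero)
    show "AE y in M. norm \<bar>S n y / real n - ?I\<bar> \<le> B + \<bar>?I\<bar>" for n
    proof (intro AE_I2)
      fix y show "norm \<bar>S n y / real n - ?I\<bar> \<le> B + \<bar>?I\<bar>"
        using Sb[of n y] by (simp, linarith)
    qed
  qed auto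
  then show ?thesis by (simp add: S_def)
qed

section \<open>Weighted total variation\<close>

text \<open>The sum on the left transfers a Hahn-type decomposition to integrals without signed
  measures and without subtracting possibly infinite values.\<close>

lemma nn_integral_emeasure_add:
  assumes sets_eq: "sets b = sets a" "sets c = sets a"
    and add: "\<And>A. A \<in> sets a \<Longrightarrow> emeasure a A + emeasure b A = emeasure c A"
    and u: "u \<in> borel_measurable a"
  shows "(\<integral>\<^sup>+x. u x \<partial>a) + (\<integral>\<^sup>+x. u x \<partial>b) = (\<integral>\<^sup>+x. u x \<partial>c)"
  using u
proof (induction u rule: borel_measurable_induct)
  case (cong f g)
  then show ?case
    using sets_eq[THEN sets_eq_imp_space_eq] by (simp cong: nn_integral_cong_simp)
next
  case (set A)
  then show ?case using sets_eq add by simp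
next
  case (mult u v)
  moreover have "u \<in> borel_measurable b" "u \<in> borel_measurable c"
    using mult(2) measurable_cong_sets[OF sets_eq(1) refl] measurable_cong_sets[OF sets_eq(2) refl] by auto
  ultimately show ?case by (simp add: nn_integral_cmult flip: distrib_left)
next
  case (add u v)
  moreover have "u \<in> borel_measurable b" "u \<in> borel_measurable c"
    "v \<in> borel_measurable b" "v \<in> borel_measurable c"
    using add(1,3) measurable_cong_sets[OF sets_eq(1) refl] measurable_cong_sets[OF sets_eq(2) refl] by auto
  ultimately show ?case by (simp add: nn_integral_add ac_simps flip: add.IH)
next
  case (seq U)
  moreover have "U i \<in> borel_measurable b" "U i \<in> borel_measurable c" for i
    using seq(1)[of i] measurable_cong_sets[OF sets_eq(1) refl] measurable_cong_sets[OF sets_eq(2) refl] by auto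
  moreover have "incseq (\<lambda>i. \<integral>\<^sup>+x. U i x \<partial>a)" "incseq (\<lambda>i. \<integral>\<^sup>+x. U i x \<partial>b)"
    using \<open>incseq U\<close> by (auto simp: incseq_def le_fun_def intro!: nn_integral_mono)
  ultimately show ?case
    by (simp add: image_comp SUP_apply nn_integral_monotone_convergence_SUP flip: ennreal_SUP_add)
qed

text \<open>Where \<open>M\<close> dominates \<open>N\<close> the absolute values drop, so every
  finite partition of \<open>B\<close> gives the same sum as the trivial one. The version with
  exchanged arguments serves the negative Hahn set.\<close>

lemma tv_measure_Hahn_part:
  assumes fin: "finite_measure M" "finite_measure N" and sets_eq: "sets N = sets M"
    and B: "B \<in> sets M" and le: "\<And>C. C \<in> sets M \<Longrightarrow> C \<subseteq> B \<Longrightarrow> measure N C \<le> measure M C"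
  shows "emeasure (tv_measure M N) B + emeasure N B = emeasure M B"
    and "emeasure (tv_measure N M) B + emeasure N B = emeasure M B"
proof -
  interpret M: finite_measure M by fact
  interpret N: finite_measure N by fact
  have part: "(\<Sum>C\<in>P. ennreal \<bar>measure M C - measure N C\<bar>) = ennreal (measure M B - measure N B)"
    "(\<Sum>C\<in>P. ennreal \<bar>measure N C - measure M C\<bar>) = ennreal (measure M B - measure N B)"
    if P: "finite P" "disjoint P" "P \<subseteq> sets M" "\<Union>P = B" for P
  proof -
    have "measure M B = (\<Sum>C\<in>P. measure M C)" "measure N B = (\<Sum>C\<in>P. measure N C)"
      using P M.finite_measure_finite_Union[of P id] N.finite_measure_finite_Union[of P id] sets_eq
      by (auto simp: disjoint_image_disjoint_family_on disjoint_family_on_def disjoint_def)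
    moreover have "measure N C \<le> measure M C" if "C \<in> P" for C
      using le[of C] that P(3,4) by blast
    ultimately show "(\<Sum>C\<in>P. ennreal \<bar>measure M C - measure N C\<bar>) = ennreal (measure M B - measure N B)"
      by (simp add: sum_ennreal flip: sum_subtractf)
    then show "(\<Sum>C\<in>P. ennreal \<bar>measure N C - measure M C\<bar>) = ennreal (measure M B - measure N B)"
      by (simp add: abs_minus_commute)
  qed
  have ne: "{B} \<in> {P. finite P \<and> disjoint P \<and> P \<subseteq> sets M \<and> \<Union> P = B}" using B by (auto simp: disjoint_def)
  have "emeasure (tv_measure M N) B = ennreal (measure M B - measure N B)"
    unfolding emeasure_tv_measure[OF fin sets_eq B]
    by (intro antisym SUP_least SUP_upper2[OF ne]) (use part in \<open>auto simp: disjoint_def B\<close>)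
  moreover have "emeasure (tv_measure N M) B = ennreal (measure M B - measure N B)"
    unfolding emeasure_tv_measure[OF fin(2,1) sets_eq[symmetric] B[folded sets_eq]] sets_eq
    by (intro antisym SUP_least SUP_upper2[OF ne]) (use part in \<open>auto simp: disjoint_def B\<close>)
  ultimately show "emeasure (tv_measure M N) B + emeasure N B = emeasure M B"
    "emeasure (tv_measure N M) B + emeasure N B = emeasure M B"
    using le[of B] B by (simp_all add: M.emeasure_eq_measure N.emeasure_eq_measure flip: ennreal_plus)
qed

lemma sets_tv_measure [simp, measurable_cong]: "sets (tv_measure M N) = sets M"
  by (simp add: tv_measure_def)

text \<open>Boundedness of \<open>u\<close> makes the integrals against \<open>M\<close> and
  \<open>N\<close> finite, so the additive relation can be solved for the one against
  \<open>t\<close>. Densities \<open>indicator B\<close> encode the restriction to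
  \<open>B\<close>.\<close>

lemma nn_integral_tv_measure_part:
  fixes u :: "'a \<Rightarrow> real"
  assumes fin: "finite_measure M" "finite_measure N" and sets_eq: "sets N = sets M"
    and sets_t: "sets t = sets M"
    and B: "B \<in> sets M"
    and add: "\<And>C. C \<in> sets M \<Longrightarrow> C \<subseteq> B \<Longrightarrow> emeasure t C + emeasure N C = emeasure M C"
    and u: "u \<in> borel_measurable M" and u0: "\<And>x. 0 \<le> u x" and uN: "\<And>x. u x \<le> n"
  shows "(\<integral>\<^sup>+x. ennreal (u x) * indicator B x \<partial>t)
      = ennreal ((\<integral>x. u x * indicator B x \<partial>M) - (\<integral>x. u x * indicator B x \<partial>N))"
    and "(\<integral>x. u x * indicator B x \<partial>N) \<le> (\<integral>x. u x * indicator B x \<partial>M)"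
proof -
  interpret M: finite_measure M by fact
  interpret N: finite_measure N by fact
  note [measurable] = B u
  note [measurable_cong] = sets_eq sets_t
  have restr: "emeasure (density m (indicator B)) A = emeasure m (B \<inter> A)"
    if "sets m = sets M" "A \<in> sets M" for m A
    using that B by (intro emeasure_restricted) auto
  have "(\<integral>\<^sup>+x. ennreal (u x) \<partial>density t (indicator B)) + (\<integral>\<^sup>+x. ennreal (u x) \<partial>density N (indicator B))
      = (\<integral>\<^sup>+x. ennreal (u x) \<partial>density M (indicator B))"
  proof (rule nn_integral_emeasure_add)
    show "emeasure (density t (indicator B)) A + emeasure (density N (indicator B)) A
        = emeasure (density M (indicator B)) A" if "A \<in> sets (density t (indicator B))" for A
      using that add[of "B \<inter> A"] B by (simp add: restr sets_t sets_eq)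
  qed (auto simp: sets_eq sets_t)
  then have eq: "(\<integral>\<^sup>+x. ennreal (u x) * indicator B x \<partial>t) + (\<integral>\<^sup>+x. ennreal (u x) * indicator B x \<partial>N)
      = (\<integral>\<^sup>+x. ennreal (u x) * indicator B x \<partial>M)"
    by (simp add: nn_integral_density mult.commute)
  have i: "integrable M (\<lambda>x. u x * indicator B x)"
    by (rule M.integrable_const_bound[of _ n])
      (use u0 uN order_trans[OF u0 uN] in \<open>auto simp: indicator_def\<close>)
  have 1: "(\<integral>\<^sup>+x. ennreal (u x) * indicator B x \<partial>M) = ennreal (\<integral>x. u x * indicator B x \<partial>M)"
    by (subst nn_integral_eq_integral[OF i, symmetric])
      (auto simp: u0 indicator_def intro!: nn_integral_cong)
  have j: "integrable N (\<lambda>x. u x * indicator B x)"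
    by (rule N.integrable_const_bound[of _ n])
      (use u0 uN order_trans[OF u0 uN] in \<open>auto simp: indicator_def\<close>)
  have 2: "(\<integral>\<^sup>+x. ennreal (u x) * indicator B x \<partial>N) = ennreal (\<integral>x. u x * indicator B x \<partial>N)"
    by (subst nn_integral_eq_integral[OF j, symmetric])
      (auto simp: u0 indicator_def intro!: nn_integral_cong)
  have nn: "0 \<le> (\<integral>x. u x * indicator B x \<partial>N)" "0 \<le> (\<integral>x. u x * indicator B x \<partial>M)"
    by (intro integral_nonneg_AE; auto simp: u0)+
  show "(\<integral>\<^sup>+x. ennreal (u x) * indicator B x \<partial>t)
      = ennreal ((\<integral>x. u x * indicator B x \<partial>M) - (\<integral>x. u x * indicator B x \<partial>N))"
    using eq[unfolded 1 2] nn ennreal_minus[OF nn(1)]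
    by (metis ennreal_add_diff_cancel_right ennreal_neq_top)
  have "ennreal (\<integral>x. u x * indicator B x \<partial>N) \<le> ennreal (\<integral>x. u x * indicator B x \<partial>M)"
    using eq[unfolded 1 2] by (metis add.commute le_iff_add)
  then show "(\<integral>x. u x * indicator B x \<partial>N) \<le> (\<integral>x. u x * indicator B x \<partial>M)"
    using nn by (simp add: ennreal_le_iff)
qed

text \<open>Duality: the optimal test function is \<open>1 + V\<close> on the positive Hahn set and
  its negative on the complement. It is first truncated at \<open>n\<close>, so that its integrals
  exist without any moment of \<open>V\<close>; monotone convergence removes the truncation.\<close>

lemma rho1_le:
  fixes V :: "'x::topological_space \<Rightarrow> real"
  assumes "prob_space \<mu>" "prob_space \<nu>"
    and sets_borel: "sets \<mu> = sets borel" "sets \<nu> = sets borel"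
    and V[measurable]: "V \<in> borel_measurable borel" and V0: "\<And>x. 0 \<le> V x"
    and test: "\<And>\<psi> N. \<psi> \<in> borel_measurable borel \<Longrightarrow> (\<And>x. \<bar>\<psi> x\<bar> \<le> 1 + V x) \<Longrightarrow> (\<And>x. \<bar>\<psi> x\<bar> \<le> N) \<Longrightarrow>
                 (\<integral>x. \<psi> x \<partial>\<mu>) - (\<integral>x. \<psi> x \<partial>\<nu>) \<le> e"
  shows "rho1 V \<mu> \<nu> \<le> ennreal e"
proof -
  interpret \<mu>: prob_space \<mu> by fact
  interpret \<nu>: prob_space \<nu> by fact
  note [measurable_cong] = sets_borel
  have sets_eq: "sets \<nu> = sets \<mu>" using sets_borel by simp
  have fin: "finite_measure \<mu>" "finite_measure \<nu>" by unfold_locales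
  obtain Y where Y: "Y \<in> sets \<mu>"
    and Y1: "\<And>X. X \<in> sets \<mu> \<Longrightarrow> X \<subseteq> Y \<Longrightarrow> emeasure \<nu> X \<le> emeasure \<mu> X"
    and Y2: "\<And>X. X \<in> sets \<mu> \<Longrightarrow> X \<inter> Y = {} \<Longrightarrow> emeasure \<mu> X \<le> emeasure \<nu> X"
    using finite_unsigned_Hahn_decomposition[OF fin sets_eq] by blast
  have [measurable]: "Y \<in> sets borel" using Y sets_borel by simp
  have on_Y: "emeasure (tv_measure \<mu> \<nu>) C + emeasure \<nu> C = emeasure \<mu> C"
    if "C \<in> sets \<mu>" "C \<subseteq> Y" for C
    using Y1 that by (intro tv_measure_Hahn_part(1)[OF fin sets_eq])
      (auto simp: \<mu>.emeasure_eq_measure \<nu>.emeasure_eq_measure)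
  have on_Yc: "emeasure (tv_measure \<mu> \<nu>) C + emeasure \<mu> C = emeasure \<nu> C"
    if "C \<in> sets \<nu>" "C \<subseteq> - Y" for C
  proof (rule tv_measure_Hahn_part(2)[OF fin(2,1) sets_eq[symmetric] that(1)])
    fix D assume "D \<in> sets \<nu>" "D \<subseteq> C"
    then have "D \<in> sets \<mu>" "D \<inter> Y = {}" using that sets_eq by auto
    then show "measure \<mu> D \<le> measure \<nu> D"
      using Y2[of D] by (simp add: \<mu>.emeasure_eq_measure \<nu>.emeasure_eq_measure)
  qed
  have bound: "(\<integral>\<^sup>+x. ennreal (min (1 + V x) (real n)) \<partial>tv_measure \<mu> \<nu>) \<le> ennreal e" for n
  proof -
    define u where "u x = min (1 + V x) (real n)" for x
    have u[measurable]: "u \<in> borel_measurable borel" unfolding u_def by measurable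
    have u0: "0 \<le> u x" and un: "u x \<le> real n" and uV: "u x \<le> 1 + V x" for x
      using V0[of x] by (auto simp: u_def)
    define \<psi> where "\<psi> x = u x * indicator Y x - u x * indicator (-Y) x" for x
    have i: "integrable \<mu> (\<lambda>x. u x * indicator Y x)" "integrable \<mu> (\<lambda>x. u x * indicator (-Y) x)"
      by (rule \<mu>.integrable_const_bound[of _ n]; use u0 un in \<open>auto simp: indicator_def\<close>)+
    have j: "integrable \<nu> (\<lambda>x. u x * indicator Y x)" "integrable \<nu> (\<lambda>x. u x * indicator (-Y) x)"
      by (rule \<nu>.integrable_const_bound[of _ n]; use u0 un in \<open>auto simp: indicator_def\<close>)+
    note p1 = nn_integral_tv_measure_part[where u=u and n="real n" and t="tv_measure \<mu> \<nu>", OF fin sets_eq _ Y on_Y]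
    note p2 = nn_integral_tv_measure_part[where u=u and n="real n" and t="tv_measure \<mu> \<nu>" and B="-Y",
        OF fin(2,1) sets_eq[symmetric] _ _ on_Yc]
    have "(\<integral>\<^sup>+x. ennreal (u x) \<partial>tv_measure \<mu> \<nu>)
        = (\<integral>\<^sup>+x. ennreal (u x) * indicator Y x + ennreal (u x) * indicator (-Y) x \<partial>tv_measure \<mu> \<nu>)"
      by (intro nn_integral_cong) (auto simp: indicator_def)
    also have "\<dots> = (\<integral>\<^sup>+x. ennreal (u x) * indicator Y x \<partial>tv_measure \<mu> \<nu>)
        + (\<integral>\<^sup>+x. ennreal (u x) * indicator (-Y) x \<partial>tv_measure \<mu> \<nu>)"
      by (intro nn_integral_add) (auto simp: sets_borel)
    also have "\<dots> = ennreal (((\<integral>x. u x * indicator Y x \<partial>\<mu>) - (\<integral>x. u x * indicator Y x \<partial>\<nu>))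
        + ((\<integral>x. u x * indicator (-Y) x \<partial>\<nu>) - (\<integral>x. u x * indicator (-Y) x \<partial>\<mu>)))"
      using u0 un p1 p2 sets_borel by (subst ennreal_plus) auto
    also have "\<dots> = ennreal ((\<integral>x. \<psi> x \<partial>\<mu>) - (\<integral>x. \<psi> x \<partial>\<nu>))"
      using i j unfolding \<psi>_def by (simp add: algebra_simps)
    also have "\<dots> \<le> ennreal e"
    proof (intro ennreal_leI test[where N="real n"])
      show "\<psi> \<in> borel_measurable borel" unfolding \<psi>_def by measurable
      show "\<bar>\<psi> x\<bar> \<le> 1 + V x" "\<bar>\<psi> x\<bar> \<le> real n" for x
        using u0[of x] uV[of x] un[of x] by (auto simp: \<psi>_def indicator_def)
    qed
    finally show ?thesis by (simp add: u_def)
  qed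
  have "rho1 V \<mu> \<nu> = (\<integral>\<^sup>+x. (SUP n. ennreal (min (1 + V x) (real n))) \<partial>tv_measure \<mu> \<nu>)"
    unfolding rho1_def
  proof (intro nn_integral_cong antisym)
    fix x
    obtain n where "1 + V x < real n" using reals_Archimedean2 by blast
    then show "ennreal (1 + V x) \<le> (SUP n. ennreal (min (1 + V x) (real n)))"
      by (intro SUP_upper2[of n]) (auto simp: min_def)
    show "(SUP n. ennreal (min (1 + V x) (real n))) \<le> ennreal (1 + V x)"
      by (intro SUP_least ennreal_leI) auto
  qed
  also have "\<dots> = (SUP n. \<integral>\<^sup>+x. ennreal (min (1 + V x) (real n)) \<partial>tv_measure \<mu> \<nu>)"
    by (intro nn_integral_monotone_convergence_SUP)
      (auto simp: incseq_def le_fun_def sets_borel intro!: ennreal_leI min.mono)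
  also have "\<dots> \<le> ennreal e" by (intro SUP_least bound)
  finally show ?thesis .
qed

text \<open>Rounding \<psi> down to multiples of \<open>1 / real (Suc k)\<close> leaves finitely
  many values. The rounding error is the same for all probability measures, and the integral of the
  rounded function is a finite combination of probabilities of sets.\<close>

lemma integral_tendsto_setwise:
  fixes L :: "nat \<Rightarrow> 'x::topological_space measure" and \<psi> :: "'x \<Rightarrow> real"
  assumes L: "\<And>n. prob_space (L n)" "\<And>n. sets (L n) = sets borel"
    and \<mu>: "prob_space \<mu>" "sets \<mu> = sets borel"
    and conv: "\<And>B. B \<in> sets borel \<Longrightarrow> (\<lambda>n. measure (L n) B) \<longlonglongrightarrow> measure \<mu> B"
    and \<psi>[measurable]: "\<psi> \<in> borel_measurable borel" and bd: "\<And>x. \<bar>\<psi> x\<bar> \<le> N"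
  shows "(\<lambda>n. \<integral>x. \<psi> x \<partial>L n) \<longlonglongrightarrow> (\<integral>x. \<psi> x \<partial>\<mu>)"
proof (rule LIMSEQ_I)
  fix r :: real assume r: "0 < r"
  obtain k :: nat where k: "1 / real (Suc k) < r / 3" using nat_approx_posE[of "r/3"] r by auto
  define fl where "fl x = \<lfloor>\<psi> x * real (Suc k)\<rfloor>" for x
  define J where "J = {\<lfloor>- N * real (Suc k)\<rfloor>..\<lfloor>N * real (Suc k)\<rfloor>}"
  define h where "h x = real_of_int (fl x) / real (Suc k)" for x
  have flJ: "fl x \<in> J" for x
  proof -
    have "- N * real (Suc k) \<le> \<psi> x * real (Suc k)" "\<psi> x * real (Suc k) \<le> N * real (Suc k)"
      using bd[of x] by (intro mult_right_mono; simp)+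
    then show ?thesis unfolding fl_def J_def by (auto intro!: floor_mono)
  qed
  have [measurable]: "fl \<in> borel \<rightarrow>\<^sub>M count_space UNIV" unfolding fl_def by measurable
  have close: "\<bar>\<psi> x - h x\<bar> \<le> 1 / real (Suc k)" for x
  proof -
    have "\<bar>\<psi> x * real (Suc k) - real_of_int (fl x)\<bar> \<le> 1" unfolding fl_def by linarith
    moreover have "\<psi> x - h x = (\<psi> x * real (Suc k) - real_of_int (fl x)) / real (Suc k)"
      by (simp add: h_def field_simps)
    ultimately show ?thesis by (simp add: divide_right_mono abs_divide)
  qed
  have h_eq: "h x = (\<Sum>j\<in>J. real_of_int j / real (Suc k) * indicator {x. fl x = j} x)" for x
  proof -
    have "(\<Sum>j\<in>J. real_of_int j / real (Suc k) * indicator {x. fl x = j} x)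
        = (\<Sum>j\<in>J. if j = fl x then real_of_int j / real (Suc k) else 0)"
      by (intro sum.cong) auto
    also have "\<dots> = h x" using flJ[of x] by (simp add: J_def h_def)
    finally show ?thesis by simp
  qed
  have sets_fl: "{x. fl x = j} \<in> sets borel" for j
  proof -
    have "{x \<in> space borel. fl x = j} \<in> sets borel" by measurable
    then show ?thesis by simp
  qed
  have int_h: "(\<integral>x. h x \<partial>m) = (\<Sum>j\<in>J. real_of_int j / real (Suc k) * measure m {x. fl x = j})"
    and close_int: "\<bar>(\<integral>x. \<psi> x \<partial>m) - (\<integral>x. h x \<partial>m)\<bar> \<le> 1 / real (Suc k)"
    if m: "prob_space m" "sets m = sets borel" for m
  proof -
    interpret prob_space m by fact
    note [measurable_cong] = m(2)
    have ii: "integrable m (indicator {x. fl x = j} :: _ \<Rightarrow> real)" for j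
      using sets_fl[of j] m(2) by (simp add: emeasure_eq_measure)
    show "(\<integral>x. h x \<partial>m) = (\<Sum>j\<in>J. real_of_int j / real (Suc k) * measure m {x. fl x = j})"
      unfolding h_eq using ii sets_eq_imp_space_eq[OF m(2)] by (simp del: of_nat_Suc)
    have "integrable m h" unfolding h_eq using ii by simp
    moreover have "integrable m \<psi>" by (rule integrable_const_bound[of _ N]) (use bd in auto)
    ultimately have "\<bar>(\<integral>x. \<psi> x \<partial>m) - (\<integral>x. h x \<partial>m)\<bar> = \<bar>\<integral>x. \<psi> x - h x \<partial>m\<bar>" by simp
    also have "\<dots> \<le> (\<integral>x. \<bar>\<psi> x - h x\<bar> \<partial>m)" by (rule integral_abs_bound)
    also have "\<dots> \<le> (\<integral>x. 1 / real (Suc k) \<partial>m)"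
      using \<open>integrable m h\<close> \<open>integrable m \<psi>\<close> close by (intro integral_mono) auto
    finally show "\<bar>(\<integral>x. \<psi> x \<partial>m) - (\<integral>x. h x \<partial>m)\<bar> \<le> 1 / real (Suc k)" by (simp add: prob_space)
  qed
  have "(\<lambda>n. \<integral>x. h x \<partial>L n) \<longlonglongrightarrow> (\<integral>x. h x \<partial>\<mu>)"
    unfolding int_h[OF \<mu>] int_h[OF L] by (intro tendsto_intros conv sets_fl)
  then obtain n0 where n0: "\<And>n. n \<ge> n0 \<Longrightarrow> \<bar>(\<integral>x. h x \<partial>L n) - (\<integral>x. h x \<partial>\<mu>)\<bar> < r / 3"
    using r LIMSEQ_D[of _ _ "r/3"] by (metis divide_pos_pos real_norm_def zero_less_numeral)
  have "norm ((\<integral>x. \<psi> x \<partial>L n) - (\<integral>x. \<psi> x \<partial>\<mu>)) < r" if "n \<ge> n0" for n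
    using n0[OF that] close_int[OF \<mu>] close_int[OF L, of n] k unfolding real_norm_def by linarith
  then show "\<exists>no. \<forall>n\<ge>no. norm ((\<integral>x. \<psi> x \<partial>L n) - (\<integral>x. \<psi> x \<partial>\<mu>)) < r" by blast
qed

text \<open>These are the test functions dual to \<open>rho1\<close>. Boundedness, with no common
  bound, makes them integrable for every probability measure, so that estimates on laws do not
  presuppose moments of \<open>V\<close>.\<close>

definition weighted_test :: "('x::topological_space \<Rightarrow> real) \<Rightarrow> ('x \<Rightarrow> real) \<Rightarrow> bool"
  where "weighted_test V \<psi> \<longleftrightarrow> \<psi> \<in> borel_measurable borel \<and> (\<forall>x. \<bar>\<psi> x\<bar> \<le> 1 + V x) \<and> (\<exists>N. \<forall>x. \<bar>\<psi> x\<bar> \<le> N)"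

text \<open>Completeness of the weighted distance. Indicators are test functions, so the
  probabilities are Cauchy uniformly over all Borel sets; this uniformity is what makes the setwise
  limit countably additive.\<close>

lemma weighted_tv_limit:
  fixes L :: "nat \<Rightarrow> 'x::topological_space measure" and V :: "'x \<Rightarrow> real"
  assumes L: "\<And>n. prob_space (L n)" "\<And>n. sets (L n) = sets borel" and V0: "\<And>x. 0 \<le> V x"
    and cauchy: "\<And>e. 0 < e \<Longrightarrow> \<exists>T. \<forall>m\<ge>T. \<forall>n\<ge>T. \<forall>\<psi>. weighted_test V \<psi> \<longrightarrow>
                   \<bar>(\<integral>x. \<psi> x \<partial>L m) - (\<integral>x. \<psi> x \<partial>L n)\<bar> \<le> e"
  shows "\<exists>\<mu>. prob_space \<mu> \<and> sets \<mu> = sets borel \<and>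
           (\<forall>e>0. \<exists>T. \<forall>n\<ge>T. \<forall>\<psi>. weighted_test V \<psi> \<longrightarrow> \<bar>(\<integral>x. \<psi> x \<partial>L n) - (\<integral>x. \<psi> x \<partial>\<mu>)\<bar> \<le> e)"
proof -
  have ind: "weighted_test V (indicator B)" if "B \<in> sets borel" for B
    unfolding weighted_test_def
  proof (intro conjI allI exI[of _ 1])
    show "\<bar>indicator B x :: real\<bar> \<le> 1 + V x" for x using V0[of x] by (simp add: indicator_def)
  qed (use that in \<open>auto simp: indicator_def\<close>)
  have int_ind: "(\<integral>x. indicator B x \<partial>L n) = measure (L n) B" for B n
    using sets_eq_imp_space_eq[OF L(2)[of n]] by simp
  have unif: "\<exists>T. \<forall>m\<ge>T. \<forall>n\<ge>T. \<forall>B\<in>sets borel. \<bar>measure (L m) B - measure (L n) B\<bar> \<le> e" if "0 < e" for e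
    using cauchy[OF that] ind int_ind by metis
  define p where "p B = lim (\<lambda>n. measure (L n) B)" for B
  have conv: "(\<lambda>n. measure (L n) B) \<longlonglongrightarrow> p B" if B: "B \<in> sets borel" for B
  proof -
    have "Cauchy (\<lambda>n. measure (L n) B)"
    proof (rule metric_CauchyI)
      fix e :: real assume "0 < e"
      then obtain T where "\<forall>m\<ge>T. \<forall>n\<ge>T. \<bar>measure (L m) B - measure (L n) B\<bar> \<le> e / 2"
        using unif[of "e/2"] B by auto
      then show "\<exists>M. \<forall>m\<ge>M. \<forall>n\<ge>M. dist (measure (L m) B) (measure (L n) B) < e"
        using \<open>0 < e\<close> unfolding dist_real_def
        by (intro exI[of _ T] allI impI) (drule spec, drule mp, assumption, drule spec, drule mp, assumption, linarith)
    qed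
    then show ?thesis unfolding p_def using real_Cauchy_convergent convergent_LIMSEQ_iff by blast
  qed
  have unif_p: "\<exists>T. \<forall>n\<ge>T. \<forall>B\<in>sets borel. \<bar>measure (L n) B - p B\<bar> \<le> e" if "0 < e" for e
  proof -
    obtain T where T: "\<forall>m\<ge>T. \<forall>n\<ge>T. \<forall>B\<in>sets borel. \<bar>measure (L m) B - measure (L n) B\<bar> \<le> e"
      using unif[of e] \<open>0 < e\<close> by blast
    have "\<bar>measure (L n) B - p B\<bar> \<le> e" if "n \<ge> T" "B \<in> sets borel" for n B
    proof (rule LIMSEQ_le_const2)
      show "(\<lambda>m. \<bar>measure (L n) B - measure (L m) B\<bar>) \<longlonglongrightarrow> \<bar>measure (L n) B - p B\<bar>"
        by (intro tendsto_intros conv that)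
      show "\<exists>N. \<forall>m\<ge>N. \<bar>measure (L n) B - measure (L m) B\<bar> \<le> e" using T that by blast
    qed
    then show ?thesis by blast
  qed
  have p0: "0 \<le> p B" if "B \<in> sets borel" for B
    by (rule LIMSEQ_le_const[OF conv[OF that]]) auto
  define \<mu> where "\<mu> = measure_of (UNIV :: 'x set) (sets borel) (\<lambda>B. ennreal (p B))"
  have sets_\<mu>: "sets \<mu> = sets borel"
    unfolding \<mu>_def using sets.sigma_sets_eq[of "borel :: 'x measure"] by (simp add: sets_measure_of_conv)
  have p_sums: "(\<lambda>i. p (F i)) sums p (\<Union>i. F i)"
    if F: "range F \<subseteq> sets borel" "disjoint_family F" for F :: "nat \<Rightarrow> 'x set"
  proof -
    have fin: "(\<Sum>i<k. p (F i)) = p (\<Union>i<k. F i)" for k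
    proof (rule LIMSEQ_unique)
      show "(\<lambda>n. measure (L n) (\<Union>i<k. F i)) \<longlonglongrightarrow> p (\<Union>i<k. F i)"
        using F by (intro conv) auto
      have "measure (L n) (\<Union>i<k. F i) = (\<Sum>i<k. measure (L n) (F i))" for n
      proof -
        interpret prob_space "L n" by (rule L)
        show ?thesis using F L(2) by (intro finite_measure_finite_Union) (auto simp: disjoint_family_on_def)
      qed
      then show "(\<lambda>n. measure (L n) (\<Union>i<k. F i)) \<longlonglongrightarrow> (\<Sum>i<k. p (F i))"
        using F by (auto intro!: tendsto_intros conv)
    qed
    \<comment> \<open>Continuity from below of a single \<open>L n\<close> is carried over to
      \<open>p\<close>, to which it is close on all sets at once; three errors of at most
      \<open>r / 4\<close> add up to less than \<open>r\<close>.\<close>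
    show ?thesis unfolding sums_def fin
    proof (rule LIMSEQ_I)
      fix r :: real assume r: "0 < r"
      then obtain n where n: "\<forall>B\<in>sets borel. \<bar>measure (L n) B - p B\<bar> \<le> r / 4"
        using unif_p[of "r/4"] by auto
      interpret prob_space "L n" by (rule L)
      have "(\<lambda>k. measure (L n) (\<Union>i<k. F i)) \<longlonglongrightarrow> measure (L n) (\<Union>k. \<Union>i<k. F i)"
        using F L(2) by (intro finite_Lim_measure_incseq) (auto 4 4 simp: incseq_def intro: less_le_trans)
      moreover have "(\<Union>k. \<Union>i<k. F i) = (\<Union>i. F i)" by auto
      ultimately obtain k0 where k0: "\<And>k. k \<ge> k0 \<Longrightarrow>
          \<bar>measure (L n) (\<Union>i<k. F i) - measure (L n) (\<Union>i. F i)\<bar> < r / 4"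
        using r LIMSEQ_D[of _ _ "r/4"] by (metis divide_pos_pos real_norm_def zero_less_numeral)
      have "norm (p (\<Union>i<k. F i) - p (\<Union>i. F i)) < r" if "k \<ge> k0" for k
      proof -
        have "(\<Union>i<k. F i) \<in> sets borel" "(\<Union>i. F i) \<in> sets borel" using F by auto
        then have "\<bar>measure (L n) (\<Union>i<k. F i) - p (\<Union>i<k. F i)\<bar> \<le> r / 4"
            "\<bar>measure (L n) (\<Union>i. F i) - p (\<Union>i. F i)\<bar> \<le> r / 4" using n by blast+
        then show ?thesis using k0[OF that] r unfolding real_norm_def by linarith
      qed
      then show "\<exists>no. \<forall>k\<ge>no. norm (p (\<Union>i<k. F i) - p (\<Union>i. F i)) < r" by blast
    qed
  qed
  have em: "emeasure \<mu> B = ennreal (p B)" if "B \<in> sets borel" for B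
  proof (rule emeasure_measure_of[OF \<mu>_def])
    show "countably_additive (sets \<mu>) (\<lambda>B. ennreal (p B))"
      unfolding sets_\<mu>
    proof (rule countably_additiveI)
      fix F :: "nat \<Rightarrow> 'x set" assume F: "range F \<subseteq> sets borel" "disjoint_family F" 
      then show "(\<Sum>i. ennreal (p (F i))) = ennreal (p (\<Union> (range F)))"
        using p_sums[OF F] by (intro suminf_ennreal_eq p0) auto
    qed
    show "positive (sets \<mu>) (\<lambda>B. ennreal (p B))"
      by (simp add: positive_def p_def)
  qed (use that sets_\<mu> in auto)
  have p1: "p UNIV = 1"
  proof (rule LIMSEQ_unique[OF conv])
    have "measure (L n) UNIV = 1" for n
      using prob_space.prob_space[OF L(1)[of n]] sets_eq_imp_space_eq[OF L(2)[of n]] by simp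
    then show "(\<lambda>n. measure (L n) UNIV) \<longlonglongrightarrow> 1" by simp
  qed simp
  have pr: "prob_space \<mu>"
    using em[of UNIV] p1 sets_eq_imp_space_eq[OF sets_\<mu>] by (intro prob_spaceI) simp
  have mu_p: "measure \<mu> B = p B" if "B \<in> sets borel" for B
    using em[OF that] p0[OF that] by (simp add: measure_def)
  have lim: "(\<lambda>n. \<integral>x. \<psi> x \<partial>L n) \<longlonglongrightarrow> (\<integral>x. \<psi> x \<partial>\<mu>)" if "weighted_test V \<psi>" for \<psi>
    using that conv mu_p unfolding weighted_test_def
    by (auto intro!: integral_tendsto_setwise[OF L pr sets_\<mu>])
  have "\<exists>T. \<forall>n\<ge>T. \<forall>\<psi>. weighted_test V \<psi> \<longrightarrow> \<bar>(\<integral>x. \<psi> x \<partial>L n) - (\<integral>x. \<psi> x \<partial>\<mu>)\<bar> \<le> e" if e: "0 < e" for e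
  proof -
    obtain T where T: "\<forall>m\<ge>T. \<forall>n\<ge>T. \<forall>\<psi>. weighted_test V \<psi> \<longrightarrow>
                   \<bar>(\<integral>x. \<psi> x \<partial>L m) - (\<integral>x. \<psi> x \<partial>L n)\<bar> \<le> e"
      using cauchy[OF e] by blast
    have "\<bar>(\<integral>x. \<psi> x \<partial>L n) - (\<integral>x. \<psi> x \<partial>\<mu>)\<bar> \<le> e" if "n \<ge> T" "weighted_test V \<psi>" for n \<psi>
    proof (rule LIMSEQ_le_const2)
      show "(\<lambda>m. \<bar>(\<integral>x. \<psi> x \<partial>L n) - (\<integral>x. \<psi> x \<partial>L m)\<bar>) \<longlonglongrightarrow> \<bar>(\<integral>x. \<psi> x \<partial>L n) - (\<integral>x. \<psi> x \<partial>\<mu>)\<bar>"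
        by (intro tendsto_intros lim that)
      show "\<exists>N. \<forall>m\<ge>N. \<bar>(\<integral>x. \<psi> x \<partial>L n) - (\<integral>x. \<psi> x \<partial>L m)\<bar> \<le> e" using T that by blast
    qed
    then show ?thesis by blast
  qed
  then show ?thesis using pr sets_\<mu> by blast
qed

section \<open>Oscillation under drift and minorization\<close>

text \<open>Pushing \<open>L x\<close> forward along \<open>y\<close> to \<open>(x, y)\<close>
  yields a kernel on the product space, against which one fixed function is integrated.\<close>

lemma integral_kernel_measurable:
  fixes f :: "'a \<Rightarrow> 'b \<Rightarrow> real"
  assumes f[measurable]: "(\<lambda>(x, y). f x y) \<in> borel_measurable (M \<Otimes>\<^sub>M N)"
    and L[measurable]: "L \<in> measurable M (subprob_algebra N)"
  shows "(\<lambda>x. integral\<^sup>L (L x) (f x)) \<in> borel_measurable M"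
proof -
  note integral_measurable_subprob_algebra[measurable]
  note measurable_distr2[measurable]
  have "(\<lambda>x. integral\<^sup>L (distr (L x) (M \<Otimes>\<^sub>M N) (\<lambda>y. (x, y))) (\<lambda>(x, y). f x y)) \<in> borel_measurable M"
    by measurable
  then show ?thesis
  proof (rule measurable_cong[THEN iffD1, rotated])
    fix x assume x: "x \<in> space M"
    then have [simp, measurable_cong]: "sets (L x) = sets N" by (rule sets_kernel[OF L])
    show "integral\<^sup>L (distr (L x) (M \<Otimes>\<^sub>M N) (\<lambda>y. (x, y))) (\<lambda>(x, y). f x y) = integral\<^sup>L (L x) (f x)"
      using x by (subst integral_distr) auto
  qed
qed

lemma nn_integral_minorization:
  assumes P: "prob_space P" and \<nu>: "prob_space \<nu>" and s: "sets P = sets \<nu>" and \<alpha>: "0 \<le> \<alpha>"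
    and minor: "\<And>B. B \<in> sets \<nu> \<Longrightarrow> \<alpha> * measure \<nu> B \<le> measure P B"
    and u: "u \<in> borel_measurable \<nu>"
  shows "ennreal \<alpha> * (\<integral>\<^sup>+x. u x \<partial>\<nu>) \<le> (\<integral>\<^sup>+x. u x \<partial>P)"
proof -
  interpret P: prob_space P by fact
  interpret \<nu>: prob_space \<nu> by fact
  have "scale_measure (ennreal \<alpha>) \<nu> \<le> P"
    using minor \<alpha> s
    by (auto simp: le_measure P.emeasure_eq_measure \<nu>.emeasure_eq_measure simp flip: ennreal_mult)
  then show ?thesis
    using nn_integral_mono_measure[of "scale_measure (ennreal \<alpha>) \<nu>" P u] s u
    by (simp add: nn_integral_scale_measure)
qed

text \<open>A Lipschitz condition for the distance \<open>a + b * (V x + V x')\<close> between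
  distinct points, as in the Hairer-Mattingly proof of Harris' theorem. Minorization acts on
  \<open>a\<close>, drift on \<open>b\<close>.\<close>

definition osc_le :: "('x \<Rightarrow> real) \<Rightarrow> ('x \<Rightarrow> real) \<Rightarrow> real \<Rightarrow> real \<Rightarrow> bool"
  where "osc_le V f a b \<longleftrightarrow> (\<forall>x x'. \<bar>f x - f x'\<bar> \<le> a + b * (V x + V x'))"

text \<open>Each \<open>f x - w x\<close> lies below each \<open>f x' + w x'\<close>, so the infimum
  of the latter separates the two families. The constant \<open>a\<close> is shared evenly between
  the two points.\<close>

lemma osc_le_center:
  assumes V: "\<And>x. 0 \<le> V x" and "osc_le V f a b" "0 \<le> a" "0 \<le> b"
  shows "\<exists>c. \<forall>x. \<bar>f x - c\<bar> \<le> a / 2 + b * V x"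
proof -
  define w where "w x = a / 2 + b * V x" for x
  have le: "f x - w x \<le> f x' + w x'" for x x'
    using assms(2) unfolding osc_le_def w_def by (smt (verit) distrib_left field_sum_of_halves)
  define c where "c = (INF x. f x + w x)"
  have bdd: "bdd_below (range (\<lambda>x. f x + w x))"
    using le[of undefined] by (intro bdd_belowI[of _ "f undefined - w undefined"]) auto
  have "c \<le> f x + w x" for x unfolding c_def by (rule cINF_lower[OF bdd]) simp
  moreover have "f x - w x \<le> c" for x unfolding c_def by (rule cINF_greatest) (use le in auto)
  ultimately have "\<bar>f x - c\<bar> \<le> w x" for x by (smt (verit))
  then show ?thesis by (auto simp: w_def)
qed

lemma integral_le_of_nn_integral:
  assumes "u \<in> borel_measurable M" "\<And>x. 0 \<le> u x" "0 \<le> v" "(\<integral>\<^sup>+x. ennreal (u x) \<partial>M) \<le> ennreal v"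
  shows "integrable M u" "(\<integral>x. u x \<partial>M) \<le> v"
proof -
  show i: "integrable M u"
    by (rule integrableI_nonneg) (use assms in \<open>auto simp: top_unique less_top[symmetric]\<close>)
  show "(\<integral>x. u x \<partial>M) \<le> v"
    using nn_integral_eq_integral[OF i] assms integral_nonneg_AE[of u M] by simp
qed

text \<open>A substitute for a coupling. After centring, \<open>u1\<close> and \<open>u2\<close> are
  nonnegative with \<open>u1 + u2\<close> at least \<open>a\<close>. Integration against the common
  part \<open>\<alpha> * \<nu>\<close> gives \<open>\<alpha> * a\<close> as a lower bound for the
  integral of \<open>u1\<close> under \<open>P\<close> plus that of \<open>u2\<close> under
  \<open>P'\<close>; in this sum the centring constant cancels.\<close>

lemma osc_integral_le:
  fixes V f :: "'x::topological_space \<Rightarrow> real"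
  assumes V[measurable]: "V \<in> borel_measurable borel" and V0: "\<And>x. 0 \<le> V x"
    and P: "prob_space P" "sets P = sets borel" and P': "prob_space P'" "sets P' = sets borel"
    and f[measurable]: "f \<in> borel_measurable borel" and fN: "\<And>x. \<bar>f x\<bar> \<le> N"
    and osc: "osc_le V f a b" and ab: "0 \<le> a" "0 \<le> b"
    and v: "0 \<le> v" "(\<integral>\<^sup>+x. ennreal (V x) \<partial>P) \<le> ennreal v"
    and v': "0 \<le> v'" "(\<integral>\<^sup>+x. ennreal (V x) \<partial>P') \<le> ennreal v'"
    and \<nu>: "prob_space \<nu>" "sets \<nu> = sets borel" and \<alpha>: "0 \<le> \<alpha>"
    and minor: "\<And>B. B \<in> sets borel \<Longrightarrow> \<alpha> * measure \<nu> B \<le> measure P B"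
    and minor': "\<And>B. B \<in> sets borel \<Longrightarrow> \<alpha> * measure \<nu> B \<le> measure P' B"
  shows "(\<integral>x. f x \<partial>P) - (\<integral>x. f x \<partial>P') \<le> (1 - \<alpha>) * a + b * (v + v')"
proof -
  interpret P: prob_space P by fact
  interpret P': prob_space P' by fact
  interpret \<nu>: prob_space \<nu> by fact
  note [measurable_cong] = P(2) P'(2) \<nu>(2)
  obtain c where c: "\<And>x. \<bar>f x - c\<bar> \<le> a / 2 + b * V x"
    using osc_le_center[OF V0 osc ab] by blast
  define u1 where "u1 z = a / 2 + b * V z - (f z - c)" for z
  define u2 where "u2 z = a / 2 + b * V z + (f z - c)" for z
  have u0: "0 \<le> u1 z" "0 \<le> u2 z" for z using c[of z] by (auto simp: u1_def u2_def abs_le_iff)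
  have [measurable]: "u1 \<in> borel_measurable borel" "u2 \<in> borel_measurable borel"
    unfolding u1_def u2_def by measurable
  note VP = integral_le_of_nn_integral[of V P, OF _ V0 v] and VP' = integral_le_of_nn_integral[of V P', OF _ V0 v']
  have iP: "integrable P f" by (rule P.integrable_const_bound[of _ N]) (use fN in auto)
  have iP': "integrable P' f" by (rule P'.integrable_const_bound[of _ N]) (use fN in auto)
  have i1: "integrable P u1" "(\<integral>z. u1 z \<partial>P) = a / 2 + b * (\<integral>z. V z \<partial>P) - ((\<integral>z. f z \<partial>P) - c)"
    unfolding u1_def using VP iP by (auto simp: P.prob_space)
  have i2: "integrable P' u2" "(\<integral>z. u2 z \<partial>P') = a / 2 + b * (\<integral>z. V z \<partial>P') + ((\<integral>z. f z \<partial>P') - c)"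
    unfolding u2_def using VP' iP' by (auto simp: P'.prob_space)
  have "ennreal (\<alpha> * a) = ennreal \<alpha> * (\<integral>\<^sup>+z. ennreal a \<partial>\<nu>)"
    using \<alpha> ab by (simp add: \<nu>.emeasure_space_1 ennreal_mult)
  also have "\<dots> \<le> ennreal \<alpha> * (\<integral>\<^sup>+z. ennreal (u1 z) + ennreal (u2 z) \<partial>\<nu>)"
    using u0 V0 ab by (intro mult_left_mono nn_integral_mono)
      (auto simp: u1_def u2_def simp flip: ennreal_plus intro!: ennreal_leI)
  also have "\<dots> = ennreal \<alpha> * (\<integral>\<^sup>+z. ennreal (u1 z) \<partial>\<nu>) + ennreal \<alpha> * (\<integral>\<^sup>+z. ennreal (u2 z) \<partial>\<nu>)"
    by (subst nn_integral_add) (auto simp: distrib_left)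
  also have "\<dots> \<le> (\<integral>\<^sup>+z. ennreal (u1 z) \<partial>P) + (\<integral>\<^sup>+z. ennreal (u2 z) \<partial>P')"
    by (intro add_mono nn_integral_minorization P P' \<nu> \<alpha>) (use minor minor' P P' \<nu> in auto)
  also have "\<dots> = ennreal ((\<integral>z. u1 z \<partial>P) + (\<integral>z. u2 z \<partial>P'))"
    using i1(1) i2(1) u0 by (simp add: nn_integral_eq_integral integral_nonneg_AE)
  finally have "ennreal (\<alpha> * a) \<le> ennreal ((\<integral>z. u1 z \<partial>P) + (\<integral>z. u2 z \<partial>P'))" .
  moreover have "0 \<le> (\<integral>z. u1 z \<partial>P) + (\<integral>z. u2 z \<partial>P')"
    using u0 by (intro add_nonneg_nonneg integral_nonneg_AE) auto
  ultimately have "\<alpha> * a \<le> (\<integral>z. u1 z \<partial>P) + (\<integral>z. u2 z \<partial>P')"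
    by (rule ennreal_le_iff[THEN iffD1, rotated])
  moreover have "b * (\<integral>z. V z \<partial>P) \<le> b * v" "b * (\<integral>z. V z \<partial>P') \<le> b * v'"
    by (intro mult_left_mono VP(2) VP'(2) ab; measurable)+
  moreover have "(1 - \<alpha>) * a = a - \<alpha> * a" "b * (v + v') = b * v + b * v'"
    by (simp_all add: algebra_simps)
  ultimately show ?thesis unfolding i1(2) i2(2) by linarith
qed

section \<open>Paths, shifts and expectations along a fixed path\<close>

definition path_shift :: "int \<Rightarrow> (int \<Rightarrow> 'y) \<Rightarrow> int \<Rightarrow> 'y"
  where "path_shift i y = (\<lambda>j. y (j + i))"

lemma path_shift_apply [simp]: "path_shift i y j = y (j + i)"
  by (simp add: path_shift_def)

lemma path_shift_0 [simp]: "path_shift 0 y = y"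
  by (simp add: path_shift_def)

lemma path_shift_shift [simp]: "path_shift i (path_shift j y) = path_shift (i + j) y"
  by (simp add: path_shift_def add.assoc)

abbreviation path_space :: "(int \<Rightarrow> 'y::topological_space) measure"
  where "path_space \<equiv> Pi\<^sub>M UNIV (\<lambda>_. borel)"

lemma space_path_space [simp]: "space path_space = UNIV"
  by (simp add: space_PiM)

lemma path_shift_measurable [measurable]: "path_shift i \<in> path_space \<rightarrow>\<^sub>M path_space"
  unfolding path_shift_def by (rule measurable_PiM_single') (auto simp: space_PiM)

lemma path_shift_funpow: "(path_shift 1 ^^ n) y = path_shift (int n) y"
  by (induction n) (auto simp: algebra_simps)

primrec env_exp :: "('y \<Rightarrow> 'x \<Rightarrow> 'x measure) \<Rightarrow> nat \<Rightarrow> (int \<Rightarrow> 'y) \<Rightarrow> ('x \<Rightarrow> real) \<Rightarrow> 'x \<Rightarrow> real"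
  where
    "env_exp Q 0 y f = f"
  | "env_exp Q (Suc t) y f = (\<lambda>x. \<integral>z. env_exp Q t (path_shift 1 y) f z \<partial>Q (y 0) x)"

locale drift_minorization =
  fixes Q :: "'y::polish_space \<Rightarrow> 'x::polish_space \<Rightarrow> 'x measure"
    and V :: "'x \<Rightarrow> real" and A :: "nat \<Rightarrow> 'y set" and lam K alpha :: "nat \<Rightarrow> real"
    and \<nu> :: "nat \<Rightarrow> 'x measure"
  assumes kernel: "kernel_family Q"
    and V_measurable [measurable]: "V \<in> borel_measurable borel" and V_nonneg: "\<And>x. 0 \<le> V x"
    and A_borel: "\<And>n. A n \<in> sets borel" and A_cover: "(\<Union>n. A n) = UNIV"
    and lam_antimono: "antimono lam" and lam: "\<And>n. 0 < lam n \<and> lam n \<le> 1/3"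
    and K_mono: "mono K" and K_ge_1: "\<And>n. 1 \<le> K n"
    and drift: "\<And>x y. (\<integral>\<^sup>+ z. ennreal (V z) \<partial>Q y x)
                 \<le> ennreal ((1 - lam (level A y)) * V x + K (level A y))"
    and alpha: "\<And>n. 0 < alpha n \<and> alpha n \<le> 1/3"
    and \<nu>_prob: "\<And>n. prob_space (\<nu> n)" and \<nu>_sets: "\<And>n. sets (\<nu> n) = sets borel"
    and minor: "\<And>y x B. V x \<le> 8 * K (level A y) / lam (level A y) \<Longrightarrow> B \<in> sets borel \<Longrightarrow>
           measure (Q y x) B \<ge> alpha (level A y) * measure (\<nu> (level A y)) B"
begin

abbreviation "lev y \<equiv> level A y"

lemma Q_measurable [measurable]: "(\<lambda>(y, x). Q y x) \<in> borel \<Otimes>\<^sub>M borel \<rightarrow>\<^sub>M prob_algebra borel"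
  using kernel by (simp add: kernel_family_def)

lemma Q_measurable_env [measurable]:
  "(\<lambda>(y, x). Q (y i) x) \<in> path_space \<Otimes>\<^sub>M borel \<rightarrow>\<^sub>M subprob_algebra borel"
proof -
  have "(\<lambda>p. (fst p i, snd p)) \<in> path_space \<Otimes>\<^sub>M borel \<rightarrow>\<^sub>M borel \<Otimes>\<^sub>M borel"
    by measurable
  from measurable_compose[OF this measurable_prob_algebraD[OF Q_measurable]]
  show ?thesis by (simp add: case_prod_beta')
qed

lemma Q_space: "Q y x \<in> space (prob_algebra borel)"
  using measurable_space[OF Q_measurable, of "(y, x)"] by (simp add: space_pair_measure)

lemma Q_prob: "prob_space (Q y x)" and Q_sets [simp, measurable_cong]: "sets (Q y x) = sets borel"
  using Q_space[of y x] by (auto simp: space_prob_algebra)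

lemma level_measurable [measurable]: "level A \<in> borel \<rightarrow>\<^sub>M count_space UNIV"
proof (rule measurable_count_space_eq2_countable[THEN iffD2], safe)
  show "level A -` {n} \<inter> space borel \<in> sets borel" for n
  proof -
    have "level A y = n \<longleftrightarrow> y \<in> A n \<and> (\<forall>k<n. y \<notin> A k)" for y
    proof
      have "\<exists>n. y \<in> A n" using A_cover by blast
      then show "level A y = n \<Longrightarrow> y \<in> A n \<and> (\<forall>k<n. y \<notin> A k)"
        unfolding level_def by (metis LeastI_ex not_less_Least)
      show "y \<in> A n \<and> (\<forall>k<n. y \<notin> A k) \<Longrightarrow> level A y = n"
        unfolding level_def by (intro Least_equality) (auto simp: not_less[symmetric])
    qed
    then have "level A -` {n} = A n - (\<Union>k<n. A k)" by auto
    then show ?thesis using A_borel by auto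
  qed
qed auto

lemma level_env_measurable [measurable]: "(\<lambda>y. level A (y i)) \<in> path_space \<rightarrow>\<^sub>M count_space UNIV"
  by measurable

lemma level_fun_measurable:
  "(\<lambda>y. (h :: nat \<Rightarrow> 'b::topological_space) (level A (y i))) \<in> borel_measurable path_space"
  by (rule measurable_compose[OF level_env_measurable]) simp

lemma env_exp_measurable_pair:
  assumes [measurable]: "f \<in> borel_measurable borel"
  shows "(\<lambda>(y, x). env_exp Q t y f x) \<in> borel_measurable (path_space \<Otimes>\<^sub>M borel)"
proof (induction t)
  case 0 show ?case by simp
next
  case (Suc t)
  note [measurable] = Suc
  have "(\<lambda>p. integral\<^sup>L (case p of (y, x) \<Rightarrow> Q (y 0) x) (\<lambda>z. env_exp Q t (path_shift 1 (fst p)) f z))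
      \<in> borel_measurable (path_space \<Otimes>\<^sub>M borel)"
  proof (rule integral_kernel_measurable)
    have "(\<lambda>q. (path_shift 1 (fst (fst q)), snd q)) \<in> (path_space \<Otimes>\<^sub>M borel) \<Otimes>\<^sub>M borel \<rightarrow>\<^sub>M path_space \<Otimes>\<^sub>M borel"
      by measurable
    from measurable_compose[OF this Suc]
    show "(\<lambda>(p, z). env_exp Q t (path_shift 1 (fst p)) f z) \<in> borel_measurable ((path_space \<Otimes>\<^sub>M borel) \<Otimes>\<^sub>M borel)"
      by (simp add: case_prod_beta')
  qed measurable
  then show ?case by (simp add: case_prod_beta')
qed

lemma env_exp_measurable [measurable]:
  assumes f[measurable]: "f \<in> borel_measurable borel" and [measurable]: "g \<in> N \<rightarrow>\<^sub>M path_space" "h \<in> N \<rightarrow>\<^sub>M borel"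
  shows "(\<lambda>w. env_exp Q t (g w) f (h w)) \<in> borel_measurable N"
  using measurable_compose[OF measurable_Pair[OF assms(2,3)] env_exp_measurable_pair[OF f, of t]]
  by simp

lemma env_exp_bounded:
  assumes f[measurable]: "f \<in> borel_measurable borel" and B: "\<And>x. \<bar>f x\<bar> \<le> B"
  shows "\<bar>env_exp Q t y f x\<bar> \<le> B"
proof (induction t arbitrary: y x)
  case 0 then show ?case using B by simp
next
  case (Suc t)
  interpret prob_space "Q (y 0) x" by (rule Q_prob)
  have i: "integrable (Q (y 0) x) (\<lambda>z. env_exp Q t (path_shift 1 y) f z)"
    by (rule integrable_const_bound[of _ B]) (use Suc in auto)
  have "\<bar>\<integral>z. env_exp Q t (path_shift 1 y) f z \<partial>Q (y 0) x\<bar> \<le> (\<integral>z. \<bar>env_exp Q t (path_shift 1 y) f z\<bar> \<partial>Q (y 0) x)"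
    by (rule integral_abs_bound)
  also have "\<dots> \<le> (\<integral>z. B \<partial>Q (y 0) x)" using Suc i by (intro integral_mono) auto
  finally show ?case by (simp add: prob_space)
qed

section \<open>One-step propagation of oscillations\<close>

lemma drift_rate: "0 < lam n" "lam n \<le> 1/3" "0 < alpha n" "alpha n \<le> 1/3" "1 \<le> K n" "0 < K n"
  using lam[of n] alpha[of n] K_ge_1[of n] by auto

lemma osc_step:
  assumes f: "f \<in> borel_measurable borel" "\<And>x. \<bar>f x\<bar> \<le> N" and osc: "osc_le V f a b" and ab: "0 \<le> a" "0 \<le> b"
  shows "osc_le V (\<lambda>x. \<integral>z. f z \<partial>Q y x) (a + 2 * b * K (lev y)) (b * (1 - lam (lev y)))"
proof -
  \<comment> \<open>With \<alpha> = 0 the minorization is void and any probability may stand for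
    \<nu>, so only the drift acts.\<close>
  have "(\<integral>z. f z \<partial>Q y x) - (\<integral>z. f z \<partial>Q y x') \<le> (1 - 0) * a +
      b * (((1 - lam (lev y)) * V x + K (lev y)) + ((1 - lam (lev y)) * V x' + K (lev y)))" for x x'
    using drift_rate[of "lev y"] V_nonneg
    by (intro osc_integral_le[where N=N and \<nu>="Q y x" and \<alpha>=0, OF V_measurable V_nonneg Q_prob Q_sets Q_prob Q_sets f osc ab])
      (auto intro!: drift Q_prob add_nonneg_nonneg mult_nonneg_nonneg simp del: ennreal_plus)
  note * = this
  show ?thesis unfolding osc_le_def
  proof (intro allI)
    fix x x' show "\<bar>(\<integral>z. f z \<partial>Q y x) - (\<integral>z. f z \<partial>Q y x')\<bar> \<le> a + 2 * b * K (lev y) + b * (1 - lam (lev y)) * (V x + V x')"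
      using *[of x x'] *[of x' x] by (simp add: abs_le_iff algebra_simps)
  qed
qed

text \<open>If \<open>V x + V x'\<close> is at most R, both points lie in the small set and the
  common part saves \<open>alpha m * a\<close>. Otherwise nothing is saved, but
  \<open>alpha m * a\<close> is at most \<open>alpha m * a / R * (V x + V x')\<close> and can be
  charged to the slope. One pair of parameters thus covers both cases.\<close>

lemma osc_step_minor:
  assumes f: "f \<in> borel_measurable borel" "\<And>x. \<bar>f x\<bar> \<le> N" and osc: "osc_le V f a b" and ab: "0 \<le> a" "0 \<le> b"
    and m: "lev y = m"
  shows "osc_le V (\<lambda>x. \<integral>z. f z \<partial>Q y x) ((1 - alpha m) * a + 2 * b * K m)
     (b * (1 - lam m) + alpha m * a / (8 * K m / lam m))"
proof -
  define R where "R = 8 * K m / lam m"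
  have R: "0 < R" using drift_rate[of m] by (simp add: R_def)
  have *: "(\<integral>z. f z \<partial>Q y x) - (\<integral>z. f z \<partial>Q y x') \<le> (1 - alpha m) * a + 2 * b * K m
      + (b * (1 - lam m) + alpha m * a / R) * (V x + V x')" for x x'
  proof (cases "V x + V x' \<le> R")
    case True
    have "(\<integral>z. f z \<partial>Q y x) - (\<integral>z. f z \<partial>Q y x') \<le> (1 - alpha m) * a +
      b * (((1 - lam m) * V x + K m) + ((1 - lam m) * V x' + K m))"
    proof (rule osc_integral_le[where N=N and \<nu>="\<nu> m", OF V_measurable V_nonneg Q_prob Q_sets Q_prob Q_sets f osc ab])
      have "V x \<le> R" "V x' \<le> R" using True V_nonneg[of x] V_nonneg[of x'] by linarith+
      then show "B \<in> sets borel \<Longrightarrow> alpha m * measure (\<nu> m) B \<le> measure (Q y x) B"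
        "B \<in> sets borel \<Longrightarrow> alpha m * measure (\<nu> m) B \<le> measure (Q y x') B" for B
        using minor[of x y B] minor[of x' y B] m by (auto simp: R_def)
    qed (use drift[of y] m drift_rate[of m] V_nonneg \<nu>_prob \<nu>_sets in \<open>auto intro!: add_nonneg_nonneg mult_nonneg_nonneg simp del: ennreal_plus\<close>)
    moreover have "0 \<le> alpha m * a / R * (V x + V x')"
      using drift_rate[of m] ab R V_nonneg by (intro mult_nonneg_nonneg divide_nonneg_pos add_nonneg_nonneg) auto
    ultimately show ?thesis by (simp add: algebra_simps)
  next
    case False
    have "(\<integral>z. f z \<partial>Q y x) - (\<integral>z. f z \<partial>Q y x') \<le> a + 2 * b * K m + b * (1 - lam m) * (V x + V x')"
      using osc_step[OF f osc ab, of y] m unfolding osc_le_def by (meson abs_le_D1)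
    moreover have "alpha m * a \<le> alpha m * a / R * (V x + V x')"
    proof -
      have "alpha m * a / R * R \<le> alpha m * a / R * (V x + V x')"
        using False drift_rate[of m] ab R by (intro mult_left_mono divide_nonneg_pos mult_nonneg_nonneg) auto
      then show ?thesis using R by simp
    qed
    ultimately show ?thesis by (simp add: algebra_simps)
  qed
  show ?thesis unfolding osc_le_def R_def[symmetric]
  proof (intro allI)
    fix x x' show "\<bar>(\<integral>z. f z \<partial>Q y x) - (\<integral>z. f z \<partial>Q y x')\<bar> \<le> (1 - alpha m) * a + 2 * b * K m
      + (b * (1 - lam m) + alpha m * a / R) * (V x + V x')"
      using *[of x x'] *[of x' x] by (auto simp: abs_le_iff add.commute)
  qed
qed

text \<open>The drift recursion started from 0 in the infinite past; only coordinates before time 0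
  are read. Values in \<open>ennreal\<close> allow for paths on which the series diverges.\<close>

definition drift_sum :: "(int \<Rightarrow> 'y) \<Rightarrow> ennreal"
  where "drift_sum y = (\<Sum>j. ennreal (K (lev (y (- 1 - int j))) * (\<Prod>i<j. 1 - lam (lev (y (- 1 - int i))))))"

lemma drift_sum_measurable [measurable]: "drift_sum \<in> borel_measurable path_space"
proof -
  note [measurable] = level_fun_measurable[where 'b=real]
  show ?thesis unfolding drift_sum_def by measurable
qed

lemma drift_prod_nonneg: "0 \<le> (\<Prod>i\<in>I. 1 - lam (h i))"
proof (intro prod_nonneg)
  show "0 \<le> 1 - lam (h i)" for i using drift_rate(2)[of "h i"] by simp
qed

text \<open>After the shift the term with index 0 is \<open>K\<close> at time 0, and every other
  term is an old one with the factor for time 0 added.\<close>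

lemma drift_sum_shift:
  "drift_sum (path_shift 1 y) = ennreal (1 - lam (lev (y 0))) * drift_sum y + ennreal (K (lev (y 0)))"
proof -
  let ?f = "\<lambda>j. ennreal (K (lev (y (- int j))) * (\<Prod>i<j. 1 - lam (lev (y (- int i)))))"
  have "drift_sum (path_shift 1 y) = suminf ?f" by (simp add: drift_sum_def)
  also have "\<dots> = (\<Sum>j. ?f (j + 1)) + (\<Sum>j<1. ?f j)" by (rule suminf_offset) simp
  also have "(\<Sum>j<1. ?f j) = ennreal (K (lev (y 0)))" by simp
  also have "(\<Sum>j. ?f (j + 1)) = (\<Sum>j. ennreal (1 - lam (lev (y 0))) *
      ennreal (K (lev (y (- 1 - int j))) * (\<Prod>i<j. 1 - lam (lev (y (- 1 - int i))))))"
  proof (intro suminf_cong)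
    fix j
    have P: "(\<Prod>i<j + 1. 1 - lam (lev (y (- int i)))) = (1 - lam (lev (y 0))) * (\<Prod>i<j. 1 - lam (lev (y (- 1 - int i))))"
      unfolding Suc_eq_plus1[symmetric] by (subst prod.lessThan_Suc_shift) simp
    have e: "- int (j + 1) = - 1 - int j" by simp
    have "?f (j + 1) = ennreal ((1 - lam (lev (y 0))) *
        (K (lev (y (- 1 - int j))) * (\<Prod>i<j. 1 - lam (lev (y (- 1 - int i))))))"
      unfolding P e by (rule arg_cong[where f=ennreal], rule mult.left_commute)
    also have "\<dots> = ennreal (1 - lam (lev (y 0))) *
      ennreal (K (lev (y (- 1 - int j))) * (\<Prod>i<j. 1 - lam (lev (y (- 1 - int i)))))"
    proof (rule ennreal_mult)
      show "0 \<le> 1 - lam (lev (y 0))" using drift_rate[of "lev (y 0)"] by simp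
      show "0 \<le> K (lev (y (- 1 - int j))) * (\<Prod>i<j. 1 - lam (lev (y (- 1 - int i))))"
        by (intro mult_nonneg_nonneg drift_prod_nonneg less_imp_le[OF drift_rate(6)])
    qed
    finally show "?f (j + 1) = ennreal (1 - lam (lev (y 0))) *
      ennreal (K (lev (y (- 1 - int j))) * (\<Prod>i<j. 1 - lam (lev (y (- 1 - int i)))))" .
  qed
  also have "\<dots> = ennreal (1 - lam (lev (y 0))) * drift_sum y" by (simp add: drift_sum_def)
  finally show ?thesis .
qed

text \<open>The term with index 0 alone is at least 1. This lower bound absorbs constants, as in
  \<open>2 + 2 * w\<close> against \<open>4 * w\<close>, and bounds \<open>b\<close> by
  \<open>b\<close> times the series.\<close>

lemma drift_sum_ge_1: "1 \<le> drift_sum y"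
proof -
  have "1 \<le> ennreal (K (lev (y (- 1 - int 0))) * (\<Prod>i<0. 1 - lam (lev (y (- 1 - int i)))))"
    using K_ge_1 by simp
  also have "\<dots> \<le> drift_sum y" unfolding drift_sum_def
    using sum_le_suminf[of "\<lambda>j. ennreal (K (lev (y (- 1 - int j))) * (\<Prod>i<j. 1 - lam (lev (y (- 1 - int i)))))" "{0}"] by simp
  finally show ?thesis .
qed

lemma drift_sum_shift_finite: "drift_sum y < \<top> \<Longrightarrow> drift_sum (path_shift (int t) y) < \<top>"
proof (induction t)
  case (Suc t)
  have "path_shift (int (Suc t)) y = path_shift 1 (path_shift (int t) y)" by simp
  then show ?case
    using Suc drift_sum_shift[of "path_shift (int t) y"] by (simp only: ennreal_mult_less_top ennreal_add_less_top) simp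
qed simp

lemma enn2real_drift_sum_shift:
  assumes "drift_sum y < \<top>"
  shows "enn2real (drift_sum (path_shift 1 y)) = (1 - lam (lev (y 0))) * enn2real (drift_sum y) + K (lev (y 0))"
proof -
  have "drift_sum y = ennreal (enn2real (drift_sum y))" using assms by simp
  have "drift_sum (path_shift 1 y) = ennreal (1 - lam (lev (y 0))) * ennreal (enn2real (drift_sum y)) + ennreal (K (lev (y 0)))"
    using drift_sum_shift[of y] \<open>drift_sum y = _\<close> by simp
  also have "\<dots> = ennreal ((1 - lam (lev (y 0))) * enn2real (drift_sum y) + K (lev (y 0)))"
    using drift_rate[of "lev (y 0)"] by (subst ennreal_plus) (auto simp: ennreal_mult)
  finally show ?thesis using drift_rate[of "lev (y 0)"] by (simp add: add_nonneg_nonneg del: ennreal_plus)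
qed

lemma enn2real_drift_sum_ge_1: "drift_sum y < \<top> \<Longrightarrow> 1 \<le> enn2real (drift_sum y)"
  using enn2real_mono[OF drift_sum_ge_1[of y]] by simp

end

section \<open>Good times and the contraction they produce\<close>

context drift_minorization
begin

text \<open>The threshold exceeds \<open>K m / lam m\<close>, the fixed point of the recursion at
  level \<open>m\<close>, so above it the series decreases in the next step. It is also a quarter of
  the radius \<open>8 * K m / lam m\<close> of the small set, which keeps the slope created by the
  minorization affordable.\<close>

definition good :: "nat \<Rightarrow> (int \<Rightarrow> 'y) set"
  where "good m = {y. lev (y 0) = m \<and> drift_sum y \<le> ennreal (2 * K m / lam m)}"

definition visits :: "nat \<Rightarrow> nat \<Rightarrow> (int \<Rightarrow> 'y) \<Rightarrow> nat"
  where "visits m t y = card {i. i < t \<and> path_shift (int i) y \<in> good m}"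

text \<open>Put H = 2 + 2/\<lambda>. Going backwards past a good time, \<open>a\<close> becomes at
  least the fraction 1/H of the whole potential; another good time removes \<alpha>a/2, hence at
  least the fraction \<alpha>/(2H).\<close>

definition merge_rate :: "nat \<Rightarrow> real"
  where "merge_rate m = 1 - alpha m / (2 * (2 + 2 / lam m))"

lemma good_measurable [measurable]: "good m \<in> sets path_space"
proof -
  have "{y \<in> space path_space. lev (y 0) = m \<and> drift_sum y \<le> ennreal (2 * K m / lam m)} \<in> sets path_space"
    by measurable
  then show ?thesis by (simp add: good_def)
qed

lemma visits_0 [simp]: "visits m 0 y = 0"
  by (simp add: visits_def)

lemma visits_Suc: "visits m (Suc t) y = (if y \<in> good m then 1 else 0) + visits m t (path_shift 1 y)"
proof -
  let ?S = "{i. i < t \<and> path_shift (int i) (path_shift 1 y) \<in> good m}"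
  have eq: "{i. i < Suc t \<and> path_shift (int i) y \<in> good m} = (if y \<in> good m then {0} else {}) \<union> Suc ` ?S"
  proof (intro set_eqI)
    fix i show "i \<in> {i. i < Suc t \<and> path_shift (int i) y \<in> good m} \<longleftrightarrow>
        i \<in> (if y \<in> good m then {0} else {}) \<union> Suc ` ?S"
      by (cases i) (auto simp: algebra_simps)
  qed
  have "finite ?S" by (rule finite_subset[of _ "{..<t}"]) auto
  then show ?thesis unfolding visits_def eq by (subst card_Un_disjoint) (auto simp: card_image)
qed

lemma visits_measurable [measurable]: "visits m t \<in> path_space \<rightarrow>\<^sub>M count_space UNIV"
proof (induction t)
  case 0 have "visits m 0 = (\<lambda>_. 0)" by auto
  then show ?case by simp
next
  case (Suc t)
  note [measurable] = Suc
  show ?case unfolding visits_Suc[abs_def] by measurable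
qed

lemma merge_rate_bounds: "0 < merge_rate m" "merge_rate m < 1"
proof -
  have H: "2 * (2 + 2 / lam m) > 1" using drift_rate[of m] by (simp add: add_pos_pos)
  then have "alpha m / (2 * (2 + 2 / lam m)) < 1"
    using drift_rate[of m] by (subst divide_less_eq_1_pos) linarith+
  moreover have "0 < alpha m / (2 * (2 + 2 / lam m))"
    using H drift_rate[of m] by (intro divide_pos_pos) linarith+
  ultimately show "0 < merge_rate m" "merge_rate m < 1" by (auto simp: merge_rate_def)
qed

text \<open>If \<^term>\<open>f\<close> has weighted oscillation \<open>(a, b)\<close> at time \<open>t\<close>, then \<open>a + 2 b W\<close>, where \<open>W\<close> is
  \<^const>\<open>drift_sum\<close> at the current time, does not increase when time runs backwards. The
  minorization at a good time transfers a fixed proportion of \<open>a\<close> away, and after one good time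
  \<open>a\<close> controls the whole potential.\<close>

lemma env_exp_osc:
  assumes f: "f \<in> borel_measurable borel" "\<And>x. \<bar>f x\<bar> \<le> N" and osc: "osc_le V f a b" and ab: "0 \<le> a" "0 \<le> b"
    and fin: "drift_sum y < \<top>"
  shows "\<exists>a' b'. 0 \<le> a' \<and> 0 \<le> b' \<and> osc_le V (env_exp Q t y f) a' b' \<and>
     a' + 2 * b' * enn2real (drift_sum y)
       \<le> merge_rate m ^ (visits m t y - 1) * (a + 2 * b * enn2real (drift_sum (path_shift (int t) y))) \<and>
     (visits m t y \<ge> 1 \<longrightarrow> a' + 2 * b' * enn2real (drift_sum y) \<le> (2 + 2 / lam m) * a')"
  using fin
proof (induction t arbitrary: y)
  case 0
  then show ?case using osc ab by (intro exI[of _ a] exI[of _ b]) simp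
next
  case (Suc t)
  define P where "P = a + 2 * b * enn2real (drift_sum (path_shift (int (Suc t)) y))"
  define H where "H = 2 + 2 / lam m"
  define w where "w = enn2real (drift_sum y)"
  define w1 where "w1 = enn2real (drift_sum (path_shift 1 y))"
  define n1 where "n1 = visits m t (path_shift 1 y)"
  have sh: "path_shift (int t) (path_shift 1 y) = path_shift (int (Suc t)) y" by (simp add: add.commute)
  have fin1: "drift_sum (path_shift 1 y) < \<top>" using drift_sum_shift_finite[OF Suc.prems, of 1] by simp
  obtain a1 b1 where ab1: "0 \<le> a1" "0 \<le> b1" and osc1: "osc_le V (env_exp Q t (path_shift 1 y) f) a1 b1"
    and P1: "a1 + 2 * b1 * w1 \<le> merge_rate m ^ (n1 - 1) * P"
    and H1: "n1 \<ge> 1 \<Longrightarrow> a1 + 2 * b1 * w1 \<le> H * a1"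
    using Suc.IH[OF fin1] unfolding P_def H_def w1_def n1_def sh by blast
  let ?n = "lev (y 0)"
  note r = drift_rate[of ?n] and rm = drift_rate[of m]
  have w1: "w1 = (1 - lam ?n) * w + K ?n"
    unfolding w1_def w_def by (rule enn2real_drift_sum_shift[OF Suc.prems])
  have g: "env_exp Q t (path_shift 1 y) f \<in> borel_measurable borel" "\<And>x. \<bar>env_exp Q t (path_shift 1 y) f x\<bar> \<le> N"
    using f env_exp_bounded[OF f] by auto
  have w0: "1 \<le> w" unfolding w_def by (rule enn2real_drift_sum_ge_1[OF Suc.prems])
  have H0: "2 \<le> H" using rm by (simp add: H_def)
  show ?case
  proof (cases "y \<in> good m")
    case False
    then have v: "visits m (Suc t) y = n1" by (simp add: visits_Suc n1_def)
    let ?a = "a1 + 2 * b1 * K ?n" and ?b = "b1 * (1 - lam ?n)"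
    have eq: "?a + 2 * ?b * w = a1 + 2 * b1 * w1" by (simp add: w1 algebra_simps)
    have ge: "a1 \<le> ?a" using ab1 r by simp
    have "0 \<le> ?a" "0 \<le> ?b" using ab1 r by auto
    moreover have "osc_le V (env_exp Q (Suc t) y f) ?a ?b"
      using osc_step[OF g osc1 ab1, of "y 0"] by simp
    moreover have "?a + 2 * ?b * w \<le> merge_rate m ^ (visits m (Suc t) y - 1) * P"
      unfolding v eq by (rule P1)
    moreover have "?a + 2 * ?b * w \<le> H * ?a" if "visits m (Suc t) y \<ge> 1"
      unfolding eq using H1 that v ge H0 mult_left_mono[OF ge, of H] by linarith
    ultimately show ?thesis unfolding P_def H_def w_def by blast
  next
    case True
    then have m: "?n = m" and W: "w \<le> 2 * K m / lam m"
      using rm by (auto simp: good_def w_def intro!: enn2real_leI)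
    have v: "visits m (Suc t) y = Suc n1" using True by (simp add: visits_Suc n1_def)
    define R where "R = 8 * K m / lam m"
    have R: "0 < R" "4 * w \<le> R" using rm W by (auto simp: R_def)
    define a' where "a' = (1 - alpha m) * a1 + 2 * b1 * K m"
    define b' where "b' = b1 * (1 - lam m) + alpha m * a1 / R"
    have nn: "0 \<le> a'" "0 \<le> b'" unfolding a'_def b'_def using ab1 rm R by auto
    have osc': "osc_le V (env_exp Q (Suc t) y f) a' b'"
      using osc_step_minor[OF g osc1 ab1 m] by (simp add: a'_def b'_def R_def)
    have wR: "alpha m * a1 / R * (4 * w) \<le> alpha m * a1"
    proof -
      have "alpha m * a1 / R * (4 * w) \<le> alpha m * a1 / R * R"
        using R ab1 rm by (intro mult_left_mono) auto
      then show ?thesis using R by simp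
    qed
    have dec: "a' + 2 * b' * w \<le> a1 + 2 * b1 * w1 - alpha m * a1 / 2"
      using wR by (simp add: w1 m a'_def b'_def algebra_simps)
    have aa: "0 \<le> alpha m * a1" using ab1 rm by simp
    \<comment> \<open>The two parts of \<open>b' * w\<close> are compared with the two summands of
      \<open>a'\<close>. The drift part costs a factor \<open>1 / lam m\<close> against
      \<open>2 * b1 * K m\<close>, because \<open>w\<close> is at most
      \<open>2 * K m / lam m\<close>. The minorization part is covered by
      \<open>(1 - alpha m) * a1\<close>, since \<open>alpha m\<close> is at most 1/3.\<close>
    have a'H: "a' + 2 * b' * w \<le> H * a'"
    proof -
      have "b1 * (1 - lam m) * w \<le> b1 * w"
        using ab1 rm w0 by (intro mult_right_mono mult_left_le) auto
      also have "\<dots> \<le> b1 * (2 * K m / lam m)" using W ab1 by (intro mult_left_mono) auto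
      also have "\<dots> = (2 * b1 * K m) * (1 / lam m)" by simp
      also have "\<dots> \<le> a' * (1 / lam m)" using ab1 rm by (intro mult_right_mono) (auto simp: a'_def)
      finally have 1: "2 * (b1 * (1 - lam m) * w) \<le> 2 / lam m * a'" by simp
      have "alpha m * a1 \<le> 1/3 * a1" using ab1 rm by (intro mult_right_mono) auto
      then have "alpha m * a1 / 2 \<le> (1 - alpha m) * a1" using ab1 by (simp add: algebra_simps)
      also have "\<dots> \<le> a'" using ab1 rm by (simp add: a'_def)
      finally have 2: "alpha m * a1 / 2 \<le> a'" .
      have "2 * b' * w = 2 * (b1 * (1 - lam m) * w) + alpha m * a1 / R * (4 * w) / 2"
        by (simp add: b'_def algebra_simps)
      also have "\<dots> \<le> 2 / lam m * a' + a'"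
        by (rule add_mono[OF 1 order_trans[OF divide_right_mono[OF wR] 2]]) simp
      finally have "a' + 2 * b' * w \<le> a' + (2 / lam m * a' + a')" by simp
      then show ?thesis by (simp add: H_def algebra_simps)
    qed
    have "a' + 2 * b' * w \<le> merge_rate m ^ (visits m (Suc t) y - 1) * P"
    \<comment> \<open>A factor is earned only if a later good time exists, for only then does
      \<open>a1\<close> control the potential. The last good time in the window, met first when
      going backwards, earns none; hence the exponent is one less than the number of visits.\<close>
    proof (cases "n1 \<ge> 1")
      case True
      have Hp: "0 < H" using H0 by simp
      have "a1 + 2 * b1 * w1 \<le> H * a1" by (rule H1[OF True])
      then have "(a1 + 2 * b1 * w1) / H \<le> a1" using Hp by (simp add: pos_divide_le_eq mult.commute)
      then have "alpha m / 2 * ((a1 + 2 * b1 * w1) / H) \<le> alpha m / 2 * a1"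
        using rm by (intro mult_left_mono) auto
      moreover have "merge_rate m * (a1 + 2 * b1 * w1)
          = (a1 + 2 * b1 * w1) - alpha m / 2 * ((a1 + 2 * b1 * w1) / H)"
        unfolding merge_rate_def H_def[symmetric] by (simp add: left_diff_distrib)
      moreover have "alpha m / 2 * a1 = alpha m * a1 / 2" by simp
      ultimately have "a' + 2 * b' * w \<le> merge_rate m * (a1 + 2 * b1 * w1)"
        using dec by linarith
      also have "\<dots> \<le> merge_rate m * (merge_rate m ^ (n1 - 1) * P)"
        using P1 merge_rate_bounds[of m] by (intro mult_left_mono) auto
      also have "\<dots> = merge_rate m ^ (visits m (Suc t) y - 1) * P"
        using True v by (cases n1) auto
      finally show ?thesis .
    next
      case False
      then have "n1 = 0" by simp
      then show ?thesis using dec P1 v aa by simp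
    qed
    then show ?thesis using nn osc' a'H unfolding P_def H_def w_def by blast
  qed
qed

text \<open>Iterating the drift step alone keeps the slope below \<open>b\<close>. The contracting
  estimate controls the slope only through the series at the final time; multiplied by
  \<open>V\<close> this has no available moment, so bad environments need the present bound.\<close>

lemma env_exp_osc_plain:
  assumes f: "f \<in> borel_measurable borel" "\<And>x. \<bar>f x\<bar> \<le> N" and osc: "osc_le V f a b" and ab: "0 \<le> a" "0 \<le> b"
    and fin: "drift_sum y < \<top>"
  shows "\<exists>a' b'. 0 \<le> a' \<and> 0 \<le> b' \<and> b' \<le> b \<and> osc_le V (env_exp Q t y f) a' b' \<and>
     a' + 2 * b' * enn2real (drift_sum y) \<le> a + 2 * b * enn2real (drift_sum (path_shift (int t) y))"
  using fin
proof (induction t arbitrary: y)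
  case 0
  then show ?case using osc ab by (intro exI[of _ a] exI[of _ b]) simp
next
  case (Suc t)
  have sh: "path_shift (int t) (path_shift 1 y) = path_shift (int (Suc t)) y" by (simp add: add.commute)
  have fin1: "drift_sum (path_shift 1 y) < \<top>" using drift_sum_shift_finite[OF Suc.prems, of 1] by simp
  obtain a1 b1 where ab1: "0 \<le> a1" "0 \<le> b1" and b1: "b1 \<le> b" and osc1: "osc_le V (env_exp Q t (path_shift 1 y) f) a1 b1"
    and P1: "a1 + 2 * b1 * enn2real (drift_sum (path_shift 1 y))
       \<le> a + 2 * b * enn2real (drift_sum (path_shift (int (Suc t)) y))"
    using Suc.IH[OF fin1] unfolding sh by blast
  note r = drift_rate[of "lev (y 0)"]
  have g: "env_exp Q t (path_shift 1 y) f \<in> borel_measurable borel" "\<And>x. \<bar>env_exp Q t (path_shift 1 y) f x\<bar> \<le> N"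
    using f env_exp_bounded[OF f] by auto
  let ?a = "a1 + 2 * b1 * K (lev (y 0))" and ?b = "b1 * (1 - lam (lev (y 0)))"
  have "0 \<le> ?a" "0 \<le> ?b" using ab1 r by auto
  moreover have "?b \<le> b" using ab1 r b1 mult_left_le[of "1 - lam (lev (y 0))" b1] by simp
  moreover have "osc_le V (env_exp Q (Suc t) y f) ?a ?b"
    using osc_step[OF g osc1 ab1, of "y 0"] by simp
  moreover have "?a + 2 * ?b * enn2real (drift_sum y) = a1 + 2 * b1 * enn2real (drift_sum (path_shift 1 y))"
    by (simp add: enn2real_drift_sum_shift[OF Suc.prems] algebra_simps)
  ultimately show ?case using P1 by (intro exI[of _ ?a] exI[of _ ?b]) linarith
qed

lemma weighted_test_osc: "weighted_test V f \<Longrightarrow> osc_le V f 2 1"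
  unfolding weighted_test_def osc_le_def by (smt (verit))

text \<open>A weighted test function starts with \<open>a = 2\<close> and \<open>b = 1\<close>. The
  first bound is small after many visits; the second is additive in \<open>w\<close> and
  \<open>V\<close>, hence integrable, and serves where visits are few or \<open>w\<close> is
  large.\<close>

lemma env_exp_merge:
  fixes t :: nat
  assumes f: "weighted_test V f" and fin: "drift_sum y < \<top>"
  defines "w \<equiv> enn2real (drift_sum (path_shift (int t) y))"
  shows "\<bar>env_exp Q t y f x - env_exp Q t y f x'\<bar> \<le> 4 * w * merge_rate m ^ (visits m t y - 1) * (1 + V x + V x')"
    and "\<bar>env_exp Q t y f x - env_exp Q t y f x'\<bar> \<le> 4 * w + V x + V x'"
proof -
  obtain N where fm: "f \<in> borel_measurable borel" and N: "\<And>x. \<bar>f x\<bar> \<le> N" using f by (auto simp: weighted_test_def)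
  have w0: "1 \<le> enn2real (drift_sum y)" by (rule enn2real_drift_sum_ge_1[OF fin])
  have w1: "1 \<le> w" unfolding w_def by (rule enn2real_drift_sum_ge_1[OF drift_sum_shift_finite[OF fin]])
  have S: "0 \<le> V x + V x'" using V_nonneg[of x] V_nonneg[of x'] by simp
  have bw: "b \<le> b * enn2real (drift_sum y)" if "0 \<le> b" for b
    using mult_left_mono[OF w0 that] by simp
  have q: "0 \<le> merge_rate m ^ (visits m t y - 1)" using merge_rate_bounds[of m] by simp
  show "\<bar>env_exp Q t y f x - env_exp Q t y f x'\<bar> \<le> 4 * w * merge_rate m ^ (visits m t y - 1) * (1 + V x + V x')"
  proof -
    obtain a b where ab: "0 \<le> a" "0 \<le> b" "osc_le V (env_exp Q t y f) a b"
      and le: "a + 2 * b * enn2real (drift_sum y) \<le> merge_rate m ^ (visits m t y - 1) * (2 + 2 * 1 * w)"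
      using env_exp_osc[OF fm N weighted_test_osc[OF f] _ _ fin, of t m] unfolding w_def by auto
    define q where "q = merge_rate m ^ (visits m t y - 1)"
    have "q * (2 + 2 * 1 * w) \<le> q * (4 * w)" using q w1 by (intro mult_left_mono) (auto simp: q_def)
    then have l: "a + 2 * b * enn2real (drift_sum y) \<le> 4 * w * q" using le by (simp add: q_def mult_ac)
    then have "a \<le> 4 * w * q" "b \<le> 4 * w * q" using bw[OF ab(2)] ab by linarith+
    then have "a + b * (V x + V x') \<le> 4 * w * q + 4 * w * q * (V x + V x')"
      using S by (intro add_mono mult_right_mono)
    also have "\<dots> = 4 * w * q * (1 + V x + V x')" by (simp add: algebra_simps)
    finally show ?thesis using ab(3) unfolding osc_le_def q_def by (meson order_trans)
  qed
  show "\<bar>env_exp Q t y f x - env_exp Q t y f x'\<bar> \<le> 4 * w + V x + V x'"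
  proof -
    obtain a b where ab: "0 \<le> a" "0 \<le> b" "b \<le> 1" "osc_le V (env_exp Q t y f) a b"
      and le: "a + 2 * b * enn2real (drift_sum y) \<le> 2 + 2 * 1 * w"
      using env_exp_osc_plain[OF fm N weighted_test_osc[OF f] _ _ fin, of t] unfolding w_def by auto
    have "a \<le> 4 * w" using le bw[OF ab(2)] ab w1 by linarith
    moreover have "b * (V x + V x') \<le> V x + V x'" using mult_right_mono[OF ab(3) S] by simp
    moreover have "\<bar>env_exp Q t y f x - env_exp Q t y f x'\<bar> \<le> a + b * (V x + V x')"
      using ab(4) unfolding osc_le_def by blast
    ultimately show ?thesis by linarith
  qed
qed

end

section \<open>Stationary ergodic environments\<close>

lemma nn_integral_tail_tendsto_0:
  fixes u :: "'a \<Rightarrow> ennreal"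
  assumes [measurable]: "u \<in> borel_measurable M" and fin: "(\<integral>\<^sup>+x. u x \<partial>M) < \<top>"
  shows "(\<lambda>n::nat. \<integral>\<^sup>+x. u x * indicator {v. of_nat n < v} (u x) \<partial>M) \<longlonglongrightarrow> 0"
proof -
  have "(\<lambda>n::nat. \<integral>\<^sup>+x. u x * indicator {v. of_nat n < v} (u x) \<partial>M) \<longlonglongrightarrow> (\<integral>\<^sup>+x. 0 \<partial>M)"
  proof (rule nn_integral_dominated_convergence[where w=u])
    show "(\<integral>\<^sup>+x. u x \<partial>M) < \<infinity>" using fin by simp
    have "AE x in M. u x \<noteq> \<infinity>" using fin by (intro nn_integral_PInf_AE) auto
    then show "AE x in M. (\<lambda>n::nat. u x * indicator {v. of_nat n < v} (u x)) \<longlonglongrightarrow> 0"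
    proof eventually_elim
      case (elim x)
      then obtain r where r: "u x = ennreal r" "0 \<le> r" by (cases "u x") auto
      obtain n0 :: nat where n0: "r < real n0" using reals_Archimedean2 by blast
      have "eventually (\<lambda>n. u x * indicator {v. of_nat n < v} (u x) = 0) sequentially"
        using eventually_ge_at_top[of n0]
      proof eventually_elim
        case (elim n)
        then have "u x \<le> of_nat n" using r n0 by (simp add: ennreal_of_nat_eq_real_of_nat)
        then show ?case by (simp add: not_less[symmetric] indicator_def)
      qed
      then show ?case by (rule tendsto_eventually)
    qed
  qed (auto simp: indicator_def)
  then show ?thesis by simp
qed

locale random_environment = drift_minorization Q V A lam K alpha \<nu> + prob_space M
  for Q :: "'y::polish_space \<Rightarrow> 'x::polish_space \<Rightarrow> 'x measure"
    and V :: "'x \<Rightarrow> real" and A :: "nat \<Rightarrow> 'y set" and lam K alpha :: "nat \<Rightarrow> real"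
    and \<nu> :: "nat \<Rightarrow> 'x measure" and M :: "'w measure" +
  fixes Y :: "int \<Rightarrow> 'w \<Rightarrow> 'y"
  assumes stationary: "strongly_stationary M Y" and ergodic: "ergodic_process M Y"
begin

definition env :: "'w \<Rightarrow> int \<Rightarrow> 'y"
  where "env w = (\<lambda>i. Y i w)"

lemma env_apply [simp]: "env w i = Y i w"
  by (simp add: env_def)

abbreviation "D \<equiv> path_law M Y"

lemma Y_measurable [measurable]: "Y i \<in> borel_measurable M"
  using stationary by (simp add: strongly_stationary_def)

lemma env_measurable [measurable]: "env \<in> M \<rightarrow>\<^sub>M path_space"
  unfolding env_def by (rule measurable_PiM_single') (auto simp: space_PiM)

lemma sets_D [simp, measurable_cong]: "sets D = sets path_space"
  by (simp add: path_law_def)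

lemma space_D [simp]: "space D = UNIV"
  by (simp add: path_law_def space_PiM)

lemma distr_env: "distr M path_space (\<lambda>w. path_shift s (env w)) = D"
  using stationary unfolding strongly_stationary_def path_law_def path_shift_def env_def by simp

lemma prob_space_D: "prob_space D"
  unfolding distr_env[of 0, symmetric] by (rule prob_space_distr) simp

lemma nn_integral_env:
  assumes [measurable]: "h \<in> borel_measurable path_space"
  shows "(\<integral>\<^sup>+w. h (path_shift s (env w)) \<partial>M) = (\<integral>\<^sup>+y. h y \<partial>D)"
  unfolding distr_env[of s, symmetric] by (subst nn_integral_distr) auto

lemma integral_env:
  fixes h :: "_ \<Rightarrow> real"
  assumes [measurable]: "h \<in> borel_measurable path_space"
  shows "(\<integral>w. h (path_shift s (env w)) \<partial>M) = (\<integral>y. h y \<partial>D)"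
  unfolding distr_env[of s, symmetric] by (subst integral_distr) auto

lemma distr_D_path_shift: "distr D path_space (path_shift s) = D"
proof -
  have "distr (distr M path_space (\<lambda>w. path_shift 0 (env w))) path_space (path_shift s)
      = distr M path_space (\<lambda>w. path_shift s (env w))"
    by (subst distr_distr) (auto simp: comp_def)
  then show ?thesis unfolding distr_env .
qed

lemma nn_integral_D_shift:
  assumes [measurable]: "h \<in> borel_measurable path_space"
  shows "(\<integral>\<^sup>+y. h (path_shift s y) \<partial>D) = (\<integral>\<^sup>+y. h y \<partial>D)"
  by (subst (2) distr_D_path_shift[of s, symmetric], subst nn_integral_distr) auto

lemma ergodic_D:
  assumes "B \<in> sets D" "path_shift 1 -` B = B"
  shows "measure D B \<in> {0, 1}"
  using assms ergodic unfolding ergodic_process_def path_shift_def[abs_def] sets_D by blast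

text \<open>Finiteness of the integral is what lets the almost sure strict decrease become a strict
  inequality between two integrals that stationarity makes equal.\<close>

lemma ex_good_positive:
  assumes fin: "(\<integral>\<^sup>+y. drift_sum y \<partial>D) < \<top>"
  shows "\<exists>m. 0 < measure D (good m)"
proof (rule ccontr)
  interpret D: prob_space D by (rule prob_space_D)
  assume "\<not> (\<exists>m. 0 < measure D (good m))"
  then have z: "measure D (good m) = 0" for m by (metis measure_nonneg order_le_less)
  have "AE y in D. y \<notin> good m" for m
    using z[of m] D.prob_eq_0[of "good m"] by simp
  then have ng: "AE y in D. \<forall>m. y \<notin> good m" by (simp add: AE_all_countable)
  have fin_ae: "AE y in D. drift_sum y \<noteq> \<infinity>" using fin by (intro nn_integral_PInf_AE) auto
  define w where "w y = enn2real (drift_sum y)" for y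
  have [measurable]: "w \<in> borel_measurable path_space" unfolding w_def by measurable
  have w0: "0 \<le> w y" for y by (simp add: w_def)
  have eqw: "(\<integral>\<^sup>+y. ennreal (w y) \<partial>D) = (\<integral>\<^sup>+y. drift_sum y \<partial>D)"
    using fin_ae by (intro nn_integral_cong_AE) (auto simp: w_def less_top)
  have iw: "integrable D w"
    by (rule integrableI_nonneg) (use w0 eqw fin in auto)
  have iw1: "integrable D (\<lambda>y. w (path_shift 1 y))"
    using nn_integral_D_shift[of "\<lambda>y. ennreal (w y)" 1] w0 eqw fin by (intro integrableI_nonneg) auto
  have eq: "(\<integral>y. w (path_shift 1 y) \<partial>D) = (\<integral>y. w y \<partial>D)"
    by (subst (2) distr_D_path_shift[of 1, symmetric], subst integral_distr) auto
  have "AE y in D. w (path_shift 1 y) < w y"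
    using ng fin_ae
  proof eventually_elim
    case (elim y)
    let ?m = "lev (y 0)"
    have f: "drift_sum y < \<top>" using elim(2) by (simp add: less_top)
    have "\<not> drift_sum y \<le> ennreal (2 * K ?m / lam ?m)" using elim(1) by (auto simp: good_def)
    then have "2 * K ?m / lam ?m < w y"
      using f drift_rate[of ?m] unfolding w_def by (metis ennreal_enn2real ennreal_leI not_le)
    then have "2 * K ?m < lam ?m * w y" using drift_rate[of ?m] by (simp add: pos_divide_less_eq mult.commute)
    then have "K ?m < lam ?m * w y" using drift_rate[of ?m] by linarith
    then show ?case unfolding w_def enn2real_drift_sum_shift[OF f] by (simp add: algebra_simps)
  qed
  then have "(\<integral>y. w (path_shift 1 y) \<partial>D) < (\<integral>y. w y \<partial>D)"
    by (intro D.integral_less_AE_space iw iw1) (auto simp: D.emeasure_space_1[unfolded space_D])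
  then show False using eq by simp
qed

lemma visits_mono: "t \<le> t' \<Longrightarrow> visits m t y \<le> visits m t' y"
  unfolding visits_def by (rule card_mono) (auto intro: finite_subset[of _ "{..<t'}"])

text \<open>Poincare recurrence gives infinitely many visits with positive probability, ergodicity almost
  surely.\<close>

lemma AE_visits_unbounded:
  assumes pos: "0 < measure D (good m)"
  shows "AE y in D. \<forall>L. \<exists>t. L \<le> visits m t y"
proof -
  interpret D: prob_space D by (rule prob_space_D)
  define B where "B n = {y. \<exists>i\<ge>n. path_shift (int i) y \<in> good m}" for n
  define E where "E = (\<Inter>n. B n)"
  have B_m[measurable]: "B n \<in> sets path_space" for n
  proof -
    have "{y \<in> space path_space. \<exists>i\<ge>n. path_shift (int i) y \<in> good m} \<in> sets path_space"
      by measurable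
    then show ?thesis by (simp add: B_def)
  qed
  have E_m: "E \<in> sets D" unfolding E_def by simp
  have "decseq B" by (auto simp: B_def decseq_def intro: order_trans)
  \<comment> \<open>Being good at time \<open>n\<close> is as likely as at time 0, so every
    \<open>B n\<close>, and with them their decreasing intersection, has at least this
    measure.\<close>
  have "measure D (good m) \<le> measure D (B n)" for n
  proof -
    have "measure D (good m) = measure (distr D path_space (path_shift (int n))) (good m)"
      by (simp add: distr_D_path_shift)
    also have "\<dots> = measure D (path_shift (int n) -` good m)"
      by (subst measure_distr) auto
    also have "\<dots> \<le> measure D (B n)" by (intro D.finite_measure_mono) (use B_m[of n] in \<open>auto simp: B_def\<close>)
    finally show ?thesis .
  qed
  moreover have "(\<lambda>n. measure D (B n)) \<longlonglongrightarrow> measure D E"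
    unfolding E_def using \<open>decseq B\<close> by (intro D.finite_Lim_measure_decseq) auto
  ultimately have "measure D (good m) \<le> measure D E" by (intro LIMSEQ_le_const) auto
  then have "0 < measure D E" using pos by simp
  moreover have "path_shift 1 -` E = E"
  proof (intro set_eqI)
    fix y
    have "path_shift 1 y \<in> E \<longleftrightarrow> (\<forall>n. \<exists>i\<ge>n. path_shift (int (Suc i)) y \<in> good m)"
      by (simp add: E_def B_def add.commute)
    also have "\<dots> \<longleftrightarrow> (\<forall>n. \<exists>i\<ge>n. path_shift (int i) y \<in> good m)"
    proof safe
      fix n assume "\<forall>n. \<exists>i\<ge>n. path_shift (int (Suc i)) y \<in> good m"
      then obtain i where "i \<ge> n" "path_shift (int (Suc i)) y \<in> good m" by blast
      then show "\<exists>i\<ge>n. path_shift (int i) y \<in> good m" by (intro exI[of _ "Suc i"]) simp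
    next
      fix n assume "\<forall>n. \<exists>i\<ge>n. path_shift (int i) y \<in> good m"
      then obtain i where i: "i \<ge> Suc n" "path_shift (int i) y \<in> good m" by blast
      then show "\<exists>i\<ge>n. path_shift (int (Suc i)) y \<in> good m" by (intro exI[of _ "i - 1"]) auto
    qed
    finally show "y \<in> path_shift 1 -` E \<longleftrightarrow> y \<in> E" by (simp add: E_def B_def)
  qed
  ultimately have "measure D E = 1" using ergodic_D[OF E_m] by auto
  then have "AE y in D. y \<in> E" using D.prob_eq_1[OF E_m] by blast
  then show ?thesis
  proof eventually_elim
    case (elim y)
    have inf: "infinite {i. path_shift (int i) y \<in> good m}"
      using elim unfolding E_def B_def infinite_nat_iff_unbounded_le by auto
    show ?case
    proof
      fix L
      obtain S where S: "S \<subseteq> {i. path_shift (int i) y \<in> good m}" "finite S" "card S = L"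
        using infinite_arbitrarily_large[OF inf] by blast
      define t where "t = Suc (Max (insert 0 S))"
      have "S \<subseteq> {i. i < t \<and> path_shift (int i) y \<in> good m}"
        using S by (auto simp: t_def le_imp_less_Suc)
      moreover have "finite {i. i < t \<and> path_shift (int i) y \<in> good m}" by simp
      ultimately have "L \<le> visits m t y" unfolding visits_def S(3)[symmetric] by (intro card_mono)
      then show "\<exists>t. L \<le> visits m t y" by blast
    qed
  qed
qed

text \<open>Monotonicity of the counts turns the almost sure statement into a probability at one
  fixed time \<open>t\<close>; by stationarity the same \<open>t\<close> then serves every starting
  time.\<close>

lemma visits_few_tendsto_0:
  assumes pos: "0 < measure D (good m)"
  shows "(\<lambda>t. measure D {y. visits m t y < L}) \<longlonglongrightarrow> 0"
proof -
  interpret D: prob_space D by (rule prob_space_D)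
  have m: "{y. visits m t y < L} \<in> sets path_space" for t
  proof -
    have "{y \<in> space path_space. visits m t y < L} \<in> sets path_space" by measurable
    then show ?thesis by simp
  qed
  have "decseq (\<lambda>t. {y. visits m t y < L})"
    by (auto simp: decseq_def intro: le_less_trans[OF visits_mono])
  then have "(\<lambda>t. measure D {y. visits m t y < L}) \<longlonglongrightarrow> measure D (\<Inter>t. {y. visits m t y < L})"
    using m by (intro D.finite_Lim_measure_decseq) auto
  moreover have "measure D (\<Inter>t. {y. visits m t y < L}) = 0"
  proof -
    have "AE y in D. y \<notin> (\<Inter>t. {y. visits m t y < L})"
      using AE_visits_unbounded[OF pos] by eventually_elim (auto simp: not_less)
    then show ?thesis using D.prob_eq_0[of "\<Inter>t. {y. visits m t y < L}"] m by auto
  qed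
  ultimately show ?thesis by simp
qed

text \<open>The term with index j is at most \<open>K n * (1 - lam n) ^ j\<close> whenever
  \<open>n\<close> bounds the levels it reads. The default is \<open>n = g (j + 1)\<close>; if that
  fails, the scales \<open>g (k + 1)\<close> with k > j are tried, and scale k is used only on an
  event of probability at most \<open>l k\<close>. Summed over j, the default part is dominated by
  the first series of the hypotheses and the exceptional part, geometric in j, by the
  second.\<close>

lemma drift_sum_integral_finite:
  fixes g :: "nat \<Rightarrow> nat" and l :: "nat \<Rightarrow> real"
  assumes g: "mono g" and l: "\<And>t. 0 \<le> l t \<and> l t \<le> 1"
    and maximal: "\<And>t. t \<ge> 1 \<Longrightarrow>
           measure M {w \<in> space M. Max ((\<lambda>i. level A (Y (int i) w)) ` {1..t}) \<ge> g t} \<le> l t"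
    and r1: "summable (\<lambda>k. K (g k) / alpha (g k) * exp (- real k * alpha (g k) * lam (g k) / 2))"
    and r2: "summable (\<lambda>k. K (g (k + 1)) / ((alpha (g (k + 1)))\<^sup>2 * lam (g (k + 1))) * sqrt (l k))"
  shows "(\<integral>\<^sup>+y. drift_sum y \<partial>D) < \<top>"
proof -
  define mx where "mx t w = Max ((\<lambda>i. level A (Y (int i) w)) ` {1..t})" for t w
  have mx_ge: "lev (Y (int i) w) \<le> mx t w" if "1 \<le> i" "i \<le> t" for i t w
    unfolding mx_def using that by (intro Max_ge) auto
  have mx_mono: "mx t w \<le> mx t' w" if "1 \<le> t" "t \<le> t'" for t t' w
    unfolding mx_def using that by (intro Max_mono) auto
  have mx_m[measurable]: "{w \<in> space M. n \<le> mx t w} \<in> sets M" if "1 \<le> t" for n t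
  proof -
    have "{w \<in> space M. n \<le> mx t w} = {w \<in> space M. \<exists>i\<in>{1..t}. n \<le> lev (Y (int i) w)}"
      using that by (auto simp: mx_def Max_ge_iff)
    also have "\<dots> \<in> sets M" by measurable
    finally show ?thesis .
  qed
  let ?T = "\<lambda>j y. ennreal (K (lev (y (- 1 - int j))) * (\<Prod>i<j. 1 - lam (lev (y (- 1 - int i)))))"
  let ?a = "\<lambda>j n. K n * (1 - lam n) ^ j"
  have a0: "0 \<le> ?a j n" for j n using drift_rate[of n] by simp
  have term_le: "K n * (\<Prod>i<j. 1 - lam (h i)) \<le> ?a j n'"
    if "n \<le> n'" "\<And>i. i < j \<Longrightarrow> h i \<le> n'" for n n' j h
  proof (rule mult_mono)
    show "K n \<le> K n'" using K_mono that(1) by (auto simp: mono_def)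
    have "(\<Prod>i<j. 1 - lam (h i)) \<le> (\<Prod>i<j. 1 - lam n')"
    proof (rule prod_mono)
      fix i assume "i \<in> {..<j}"
      then show "0 \<le> 1 - lam (h i) \<and> 1 - lam (h i) \<le> 1 - lam n'"
        using that(2)[of i] lam_antimono drift_rate(2)[of "h i"] by (auto simp: antimono_def)
    qed
    then show "(\<Prod>i<j. 1 - lam (h i)) \<le> (1 - lam n') ^ j" by simp
  qed (use drift_rate[of n'] drift_prod_nonneg in auto)
  define F where "F j k w = (if Suc j \<le> k \<and> g k \<le> mx k w then ennreal (?a j (g (Suc k))) else 0)" for j k w
  have F_m[measurable]: "F j k \<in> borel_measurable M" for j k
    unfolding F_def by (cases "Suc j \<le> k") (auto intro!: measurable_If)
  let ?B = "\<lambda>j w. ennreal (?a j (g (Suc j))) + (\<Sum>k. F j k w)"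
  \<comment> \<open>Split at the first \<open>k > j\<close> for which the maximum over the first \<open>j + 1\<close> levels is below \<open>g (k + 1)\<close>;
    if there is none, the series in \<open>?B\<close> diverges.\<close>
  have point: "?T j (path_shift (int j + 2) (env w)) \<le> ?B j w" for j w
  proof -
    let ?h = "\<lambda>i. lev (Y (int (Suc j - i)) w)"
    let ?f = "\<lambda>k. F j k w"
    \<comment> \<open>The term reads the coordinates -1-j, ..., -1. The shift by j + 2 moves them to
      1, ..., j + 1, the range of the maximal process.\<close>
    have T_eq: "?T j (path_shift (int j + 2) (env w)) = ennreal (K (lev (Y 1 w)) * (\<Prod>i<j. 1 - lam (?h i)))"
    proof -
      have "(\<Prod>i<j. 1 - lam (lev (path_shift (int j + 2) (env w) (- 1 - int i)))) = (\<Prod>i<j. 1 - lam (?h i))"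
        by (intro prod.cong) (auto simp: of_nat_diff Suc_diff_le algebra_simps)
      then show ?thesis by simp
    qed
    have le: "?T j (path_shift (int j + 2) (env w)) \<le> ennreal (?a j n)" if "mx (Suc j) w \<le> n" for n
      unfolding T_eq
    proof (intro ennreal_leI term_le)
      show "lev (Y 1 w) \<le> n" using mx_ge[of 1 "Suc j" w] that by simp
      show "?h i \<le> n" if "i < j" for i
      proof -
        have "?h i \<le> mx (Suc j) w" using that by (intro mx_ge) auto
        then show ?thesis using \<open>mx (Suc j) w \<le> n\<close> by (rule order_trans)
      qed
    qed
    show ?thesis
    proof (cases "\<exists>k\<ge>Suc j. mx (Suc j) w < g (Suc k)")
      case False
      have "?f k = ennreal (?a j (g (Suc k)))" if "Suc j \<le> k" for k
      proof -
        have "g k \<le> g (Suc k)" using g by (simp add: mono_def)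
        also have "\<dots> \<le> mx (Suc j) w" using False that by (auto simp: not_less)
        also have "\<dots> \<le> mx k w" using that by (intro mx_mono) auto
        finally show ?thesis using that by (simp add: F_def)
      qed
      \<comment> \<open>As \<open>K\<close> is at least 1 and \<open>lam\<close> at most 1/3, the
        summands with k > j stay above a positive number independent of k.\<close>
      then have lower: "ennreal ((2/3) ^ j) \<le> ?f (k + Suc j)" for k
      proof -
        have "1 * (2/3) ^ j \<le> ?a j (g (Suc (k + Suc j)))"
          using drift_rate[of "g (Suc (k + Suc j))"] by (intro mult_mono power_mono) auto
        then show ?thesis using \<open>\<And>k. Suc j \<le> k \<Longrightarrow> ?f k = _\<close>[of "k + Suc j"] by (simp add: ennreal_leI)
      qed
      have "\<top> = (\<Sum>k::nat. ennreal ((2/3) ^ j))"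
      proof (rule ccontr)
        assume "\<top> \<noteq> (\<Sum>k::nat. ennreal ((2/3) ^ j))"
        then have "summable (\<lambda>k::nat. (2/3::real) ^ j)" by (intro summable_suminf_not_top) auto
        then show False using summable_LIMSEQ_zero[of "\<lambda>k::nat. (2/3::real) ^ j"] by (simp add: LIMSEQ_const_iff)
      qed
      also have "\<dots> \<le> (\<Sum>k. ?f (k + Suc j))" by (intro suminf_le summableI lower)
      also have "\<dots> \<le> (\<Sum>k. ?f k)"
        by (subst (2) suminf_offset[of _ "Suc j"]) (auto intro: summableI)
      finally have "(\<Sum>k. ?f k) = \<top>" by (simp add: top_unique)
      then show ?thesis by simp
    next
      case True
      define k where "k = (LEAST k. Suc j \<le> k \<and> mx (Suc j) w < g (Suc k))"
      have k: "Suc j \<le> k \<and> mx (Suc j) w < g (Suc k)"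
        unfolding k_def by (rule LeastI_ex) (use True in blast)
      show ?thesis
      proof (cases "mx (Suc j) w < g (Suc j)")
        case True
        then show ?thesis using le[of "g (Suc j)"] by (simp add: add_increasing2 less_imp_le)
      next
        case False
        have "g k \<le> mx k w"
        proof (cases "k = Suc j")
          case True then show ?thesis using False by simp
        next
          case k': False
          then obtain k1 where k1: "k = Suc k1" "Suc j \<le> k1" using k by (cases k) auto
          then have "\<not> (Suc j \<le> k1 \<and> mx (Suc j) w < g (Suc k1))"
            unfolding k_def by (metis not_less_Least lessI)
          then have "g k \<le> mx (Suc j) w" using k1 by simp
          also have "\<dots> \<le> mx k w" using k by (intro mx_mono) auto
          finally show ?thesis .
        qed
        then have "?f k = ennreal (?a j (g (Suc k)))" using k by (simp add: F_def)
        then have "?T j (path_shift (int j + 2) (env w)) \<le> ?f k" using le[of "g (Suc k)"] k by simp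
        also have "\<dots> \<le> (\<Sum>k. ?f k)" using sum_le_suminf[of ?f "{k}"] by simp
        finally show ?thesis by (simp add: add_increasing)
      qed
    qed
  qed
  note [measurable] = level_fun_measurable[where 'b=real]
  have bound_j: "(\<integral>\<^sup>+y. ?T j y \<partial>D) \<le> ennreal (?a j (g (Suc j))) + (\<Sum>k. ennreal (?a j (g (Suc k)) * l k))" for j
  proof -
    have "(\<integral>\<^sup>+y. ?T j y \<partial>D) = (\<integral>\<^sup>+w. ?T j (path_shift (int j + 2) (env w)) \<partial>M)"
      by (rule nn_integral_env[symmetric]) measurable
    also have "\<dots> \<le> (\<integral>\<^sup>+w. ?B j w \<partial>M)" by (intro nn_integral_mono point)
    also have "\<dots> = ennreal (?a j (g (Suc j))) + (\<integral>\<^sup>+w. (\<Sum>k. F j k w) \<partial>M)"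
      by (subst nn_integral_add) (auto simp: emeasure_space_1)
    also have "(\<integral>\<^sup>+w. (\<Sum>k. F j k w) \<partial>M) = (\<Sum>k. \<integral>\<^sup>+w. F j k w \<partial>M)"
      by (rule nn_integral_suminf) (rule F_m)
    also have "\<dots> \<le> (\<Sum>k. ennreal (?a j (g (Suc k)) * l k))"
    proof (intro suminf_le summableI)
      fix k
      show "(\<integral>\<^sup>+w. F j k w \<partial>M) \<le> ennreal (?a j (g (Suc k)) * l k)"
      proof (cases "Suc j \<le> k")
        case True
        have "(\<integral>\<^sup>+w. F j k w \<partial>M)
            = (\<integral>\<^sup>+w. ennreal (?a j (g (Suc k))) * indicator {w \<in> space M. g k \<le> mx k w} w \<partial>M)"
          using True by (intro nn_integral_cong) (auto simp: indicator_def F_def)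
        also have "\<dots> = ennreal (?a j (g (Suc k))) * emeasure M {w \<in> space M. g k \<le> mx k w}"
          using True mx_m[of k "g k"] by (intro nn_integral_cmult_indicator) auto
        also have "\<dots> \<le> ennreal (?a j (g (Suc k))) * ennreal (l k)"
          using maximal[of k] True by (intro mult_left_mono) (auto simp: emeasure_eq_measure mx_def intro!: ennreal_leI)
        also have "\<dots> = ennreal (?a j (g (Suc k)) * l k)"
          using a0[of "g (Suc k)" j] l[of k] by (subst ennreal_mult) auto
        finally show ?thesis .
      qed (simp add: F_def)
    qed
    finally show ?thesis by (simp add: add_left_mono)
  qed
  have S1: "(\<Sum>j. ennreal (?a j (g (Suc j)))) < \<top>"
  proof -
    let ?r = "\<lambda>k. K (g k) / alpha (g k) * exp (- real k * alpha (g k) * lam (g k) / 2)"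
    \<comment> \<open>The power \<open>j\<close> is one short of the index \<open>Suc j\<close> of
      the level. Since \<open>alpha\<close> is at most 1, the mismatch costs no more than the factor
      \<open>exp (1/2)\<close>, which is at most 2.\<close>
    have "?a j (g (Suc j)) \<le> 2 * ?r (Suc j)" for j
    proof -
      let ?n = "g (Suc j)"
      note r = drift_rate[of ?n]
      have "(1 - lam ?n) ^ j \<le> exp (- lam ?n) ^ j"
        using r exp_ge_add_one_self[of "- lam ?n"] by (intro power_mono) auto
      also have "\<dots> = exp (- real j * lam ?n)" by (simp flip: exp_of_nat_mult)
      also have "\<dots> \<le> exp (1/2 + (- real (Suc j) * alpha ?n * lam ?n / 2))"
      proof -
        have "real (Suc j) * (alpha ?n * lam ?n) \<le> real (Suc j) * (1 * lam ?n)"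
          using r by (intro mult_left_mono mult_right_mono) auto
        also have "\<dots> = lam ?n + real j * lam ?n" by (simp add: algebra_simps)
        finally have "real (Suc j) * alpha ?n * lam ?n \<le> lam ?n + real j * lam ?n" by (simp only: mult.assoc)
        moreover have "real j * lam ?n \<ge> 0" using r by simp
        moreover have "- real (Suc j) * alpha ?n * lam ?n / 2 = - (real (Suc j) * alpha ?n * lam ?n / 2)"
          "- real j * lam ?n = - (real j * lam ?n)" by (simp_all only: mult_minus_left minus_divide_left)
        ultimately have "- real j * lam ?n \<le> 1/2 + (- real (Suc j) * alpha ?n * lam ?n / 2)"
          using r(1,2) by linarith
        then show ?thesis by simp
      qed
      also have "\<dots> = exp (1/2) * exp (- real (Suc j) * alpha ?n * lam ?n / 2)" by (simp only: exp_add)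
      also have "\<dots> \<le> 2 * exp (- real (Suc j) * alpha ?n * lam ?n / 2)"
      proof (rule mult_right_mono)
        have "(exp (1/2))\<^sup>2 = exp (1::real)" by (simp flip: exp_double)
        then have "(exp (1/2 :: real))\<^sup>2 \<le> 2\<^sup>2" using exp_le by simp
        then show "exp (1/2 :: real) \<le> 2" by (rule power2_le_imp_le) simp
      qed simp
      finally have "(1 - lam ?n) ^ j \<le> 2 * exp (- real (Suc j) * alpha ?n * lam ?n / 2)" .
      then have "?a j ?n \<le> K ?n * (2 * exp (- real (Suc j) * alpha ?n * lam ?n / 2))"
        using r by (intro mult_left_mono) auto
      also have "\<dots> \<le> K ?n / alpha ?n * (2 * exp (- real (Suc j) * alpha ?n * lam ?n / 2))"
        using r by (intro mult_right_mono) (auto simp: pos_le_divide_eq)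
      finally show ?thesis by (simp add: mult_ac)
    qed
    then have "(\<Sum>j. ennreal (?a j (g (Suc j)))) \<le> (\<Sum>j. ennreal (2 * ?r (Suc j)))"
      by (intro suminf_le summableI ennreal_leI)
    also have "\<dots> < \<top>"
    proof -
      have "summable (\<lambda>j. 2 * ?r (Suc j))" using r1 summable_Suc_iff[of ?r] by (intro summable_mult) blast
      moreover have "0 \<le> 2 * ?r (Suc j)" for j using drift_rate[of "g (Suc j)"] by simp
      ultimately show ?thesis using ennreal_suminf_neq_top less_top by blast
    qed
    finally show ?thesis .
  qed
  \<comment> \<open>After exchanging the sums, the geometric series in j leaves
    \<open>K / lam * l k\<close>. This is below the k-th term of the given series because
    \<open>alpha\<close> and \<open>l k\<close> are at most 1, so that \<open>l k\<close> is at most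
    its square root.\<close>
  have S2: "(\<Sum>j. \<Sum>k. ennreal (?a j (g (Suc k)) * l k)) < \<top>"
  proof -
    have "(\<Sum>j. \<Sum>k. ennreal (?a j (g (Suc k)) * l k))
        = (\<integral>\<^sup>+j. \<integral>\<^sup>+k. ennreal (?a j (g (Suc k)) * l k) \<partial>count_space UNIV \<partial>count_space UNIV)"
      by (simp add: nn_integral_count_space_nat)
    also have "\<dots> = (\<integral>\<^sup>+k. \<integral>\<^sup>+j. ennreal (?a j (g (Suc k)) * l k) \<partial>count_space UNIV \<partial>count_space UNIV)"
      by (rule pair_sigma_finite.Fubini') (auto simp: pair_sigma_finite_def sigma_finite_measure_count_space)
    also have "\<dots> = (\<Sum>k. \<Sum>j. ennreal (?a j (g (Suc k)) * l k))"
      by (simp add: nn_integral_count_space_nat)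
    also have "\<dots> \<le> (\<Sum>k. ennreal (K (g (k + 1)) / ((alpha (g (k + 1)))\<^sup>2 * lam (g (k + 1))) * sqrt (l k)))"
    proof (intro suminf_le summableI)
      fix k
      let ?n = "g (Suc k)"
      note r = drift_rate[of ?n]
      have "(\<lambda>j. (1 - lam ?n) ^ j) sums (1 / (1 - (1 - lam ?n)))" using r by (intro geometric_sums) auto
      then have "(\<lambda>j. K ?n * l k * (1 - lam ?n) ^ j) sums (K ?n * l k * (1 / (1 - (1 - lam ?n))))"
        by (rule sums_mult)
      then have "(\<lambda>j. ?a j ?n * l k) sums (K ?n / lam ?n * l k)" by (simp add: mult_ac)
      then have "(\<Sum>j. ennreal (?a j ?n * l k)) = ennreal (K ?n / lam ?n * l k)"
        using a0 l by (intro suminf_ennreal_eq) auto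
      also have "\<dots> \<le> ennreal (K ?n / ((alpha ?n)\<^sup>2 * lam ?n) * sqrt (l k))"
      proof (intro ennreal_leI mult_mono)
        have "(alpha ?n)\<^sup>2 \<le> 1" using r by (simp add: power_le_one)
        then have "(alpha ?n)\<^sup>2 * lam ?n \<le> lam ?n" using r by (simp add: mult_left_le_one_le)
        then show "K ?n / lam ?n \<le> K ?n / ((alpha ?n)\<^sup>2 * lam ?n)"
          using r by (intro divide_left_mono) auto
        have "sqrt (l k) * sqrt (l k) \<le> sqrt (l k) * 1"
          using l[of k] by (intro mult_left_mono) auto
        then show "l k \<le> sqrt (l k)" using l[of k] by simp
      qed (use r l in auto)
      finally show "(\<Sum>j. ennreal (?a j (g (Suc k)) * l k)) \<le>
          ennreal (K (g (k + 1)) / ((alpha (g (k + 1)))\<^sup>2 * lam (g (k + 1))) * sqrt (l k))" by simp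
    qed
    also have "\<dots> < \<top>"
      using r2 drift_rate l by (subst less_top[symmetric], intro ennreal_suminf_neq_top)
        (auto simp: less_imp_le)
    finally show ?thesis .
  qed
  have "(\<integral>\<^sup>+y. drift_sum y \<partial>D) = (\<Sum>j. \<integral>\<^sup>+y. ?T j y \<partial>D)"
    unfolding drift_sum_def
    by (rule nn_integral_suminf) measurable
  also have "\<dots> \<le> (\<Sum>j. ennreal (?a j (g (Suc j))) + (\<Sum>k. ennreal (?a j (g (Suc k)) * l k)))"
    by (intro suminf_le summableI bound_j)
  also have "\<dots> = (\<Sum>j. ennreal (?a j (g (Suc j)))) + (\<Sum>j. \<Sum>k. ennreal (?a j (g (Suc k)) * l k))"
    by (intro suminf_add[symmetric] summableI)
  also have "\<dots> < \<top>" using S1 S2 by simp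
  finally show ?thesis .
qed

end

section \<open>The chain in the random environment\<close>

locale environment_chain = random_environment Q V A lam K alpha \<nu> M Y
  for Q :: "'y::polish_space \<Rightarrow> 'x::polish_space \<Rightarrow> 'x measure"
    and V :: "'x \<Rightarrow> real" and A :: "nat \<Rightarrow> 'y set" and lam K alpha :: "nat \<Rightarrow> real"
    and \<nu> :: "nat \<Rightarrow> 'x measure" and M :: "'w measure" and Y :: "int \<Rightarrow> 'w \<Rightarrow> 'y" +
  fixes X :: "nat \<Rightarrow> 'w \<Rightarrow> 'x"
  assumes process: "process_in_environment M Y Q X"
    and V0_integrable: "integrable M (\<lambda>w. V (X 0 w))"
    and drift_sum_finite: "(\<integral>\<^sup>+y. drift_sum y \<partial>D) < \<top>"
begin

abbreviation "H t \<equiv> history M Y X t"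

lemma X_measurable [measurable]: "X t \<in> borel_measurable M"
  using process by (simp add: process_in_environment_def)

lemma space_H [simp]: "space (H t) = space M"
  by (simp add: history_def space_measure_of_conv)

lemma sets_H: "sets (H t) = sigma_sets (space M) ({Y j -` B \<inter> space M | j B. B \<in> sets borel} \<union>
     {X j -` B \<inter> space M | j B. j \<le> t \<and> B \<in> sets borel})"
  unfolding history_def by (rule sets_measure_of) auto

lemma H_subalgebra: "subalgebra M (H t)"
  unfolding subalgebra_def sets_H by (auto intro!: sets.sigma_sets_subset)

lemma H_mono: "sets (H t) \<subseteq> sets (H (Suc t))"
  unfolding sets_H by (intro sigma_sets_mono' Un_mono order_refl) (blast intro: le_SucI)

lemma measurable_H_M: "f \<in> H t \<rightarrow>\<^sub>M N \<Longrightarrow> f \<in> M \<rightarrow>\<^sub>M N"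
  by (rule measurable_from_subalg[OF H_subalgebra])

lemma measurable_H_Suc: "f \<in> H t \<rightarrow>\<^sub>M N \<Longrightarrow> f \<in> H (Suc t) \<rightarrow>\<^sub>M N"
  using H_mono[of t] by (auto simp: measurable_def)

lemma Y_measurable_H [measurable]: "Y j \<in> H t \<rightarrow>\<^sub>M borel"
  by (rule measurableI) (auto simp: sets_H intro!: sigma_sets.Basic)

lemma X_measurable_H: "j \<le> t \<Longrightarrow> X j \<in> H t \<rightarrow>\<^sub>M borel"
  by (rule measurableI) (auto simp: sets_H intro!: sigma_sets.Basic)

lemma X_measurable_H' [measurable]: "X t \<in> H t \<rightarrow>\<^sub>M borel"
  by (rule X_measurable_H) simp

text \<open>The history contains the environment at all times, the future included, so functionals
  of the whole path may serve as weights when conditioning on the past of the chain.\<close>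

lemma env_measurable_H [measurable]: "env \<in> H t \<rightarrow>\<^sub>M path_space"
  unfolding env_def by (rule measurable_PiM_single') (auto simp: space_PiM)

lemma id_measurable_M_H [measurable]: "(\<lambda>w. w) \<in> M \<rightarrow>\<^sub>M H t"
  by (rule measurable_H_M[where t=t]) (rule measurable_ident_sets[OF refl])

section \<open>One-step law and Markov property given the environment\<close>

lemma Q_measurable_M: "(\<lambda>w. Q (Y i w) (X t w)) \<in> M \<rightarrow>\<^sub>M subprob_algebra borel"
proof -
  have "(\<lambda>w. (Y i w, X t w)) \<in> M \<rightarrow>\<^sub>M borel \<Otimes>\<^sub>M borel" by measurable
  from measurable_compose[OF this measurable_prob_algebraD[OF Q_measurable]] show ?thesis by simp
qed

lemma kernel_pair_measurable:
  "(\<lambda>w. distr (Q (Y (int t) w) (X t w)) (H t \<Otimes>\<^sub>M borel) (Pair w)) \<in> M \<rightarrow>\<^sub>M subprob_algebra (H t \<Otimes>\<^sub>M borel)"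
proof (rule measurable_distr2[OF _ Q_measurable_M])
  have "(\<lambda>p. (fst p, snd p)) \<in> M \<Otimes>\<^sub>M borel \<rightarrow>\<^sub>M H t \<Otimes>\<^sub>M borel"
    by (intro measurable_Pair measurable_compose[OF measurable_fst id_measurable_M_H]) simp
  then show "case_prod Pair \<in> M \<Otimes>\<^sub>M borel \<rightarrow>\<^sub>M H t \<Otimes>\<^sub>M borel" by (simp add: case_prod_beta')
qed

lemma Pair_measurable_Q:
  "w \<in> space M \<Longrightarrow> Pair w \<in> Q y x \<rightarrow>\<^sub>M H t \<Otimes>\<^sub>M borel"
  using measurable_cong_sets[OF Q_sets refl] by (auto intro!: measurable_Pair1')

lemma pair_X_measurable: "(\<lambda>w. (w, X (Suc t) w)) \<in> M \<rightarrow>\<^sub>M H t \<Otimes>\<^sub>M borel"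
  by measurable

text \<open>Integrating over one event of the history disposes of the exceptional null sets, which
  may differ from one Borel set to another.\<close>

lemma prob_step:
  assumes a: "a \<in> sets (H t)" and B: "B \<in> sets borel"
  shows "emeasure M (a \<inter> X (Suc t) -` B) = (\<integral>\<^sup>+w. indicator a w * emeasure (Q (Y (int t) w) (X t w)) B \<partial>M)"
proof -
  interpret S: finite_measure_subalgebra M "H t" by unfold_locales (rule H_subalgebra)
  have aM: "a \<in> sets M" using a H_subalgebra by (auto simp: subalgebra_def)
  let ?I = "indicator (X (Suc t) -` B \<inter> space M) :: 'w \<Rightarrow> real"
  have XB[measurable]: "X (Suc t) -` B \<inter> space M \<in> sets M" using B by measurable
  have [measurable]: "(\<lambda>w. measure (Q (Y (int t) w) (X t w)) B) \<in> borel_measurable M"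
    by (rule measurable_compose[OF Q_measurable_M]) (use B in measurable)
  have i: "integrable M ?I" by (simp add: emeasure_eq_measure)
  have ae: "AE w in M. real_cond_exp M (H t) ?I w = measure (Q (Y (int t) w) (X t w)) B"
    using process B unfolding process_in_environment_def by blast
  have "measure M (a \<inter> X (Suc t) -` B) = (\<integral>w\<in>a. ?I w \<partial>M)"
  proof -
    have "(\<integral>w\<in>a. ?I w \<partial>M) = (\<integral>w. indicator (a \<inter> X (Suc t) -` B) w \<partial>M)"
      unfolding set_lebesgue_integral_def
      using sets.sets_into_space[OF aM] by (intro Bochner_Integration.integral_cong) (auto simp: indicator_def)
    also have "\<dots> = measure M (a \<inter> X (Suc t) -` B \<inter> space M)" by simp
    also have "a \<inter> X (Suc t) -` B \<inter> space M = a \<inter> X (Suc t) -` B" using sets.sets_into_space[OF aM] by auto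
    finally show ?thesis by simp
  qed
  also have "\<dots> = (\<integral>w\<in>a. real_cond_exp M (H t) ?I w \<partial>M)" by (rule S.real_cond_exp_intA[OF i a])
  also have "\<dots> = (\<integral>w. indicator a w * measure (Q (Y (int t) w) (X t w)) B \<partial>M)"
    unfolding set_lebesgue_integral_def using ae aM by (intro integral_cong_AE) auto
  finally have eq: "measure M (a \<inter> X (Suc t) -` B) = (\<integral>w. indicator a w * measure (Q (Y (int t) w) (X t w)) B \<partial>M)" .
  have "integrable M (\<lambda>w. indicator a w * measure (Q (Y (int t) w) (X t w)) B)"
    by (rule integrable_const_bound[of _ 1])
      (use aM prob_space.prob_le_1[OF Q_prob] in \<open>auto simp: indicator_def\<close>)
  from nn_integral_eq_integral[OF this] have "ennreal (\<integral>w. indicator a w * measure (Q (Y (int t) w) (X t w)) B \<partial>M)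
      = (\<integral>\<^sup>+w. ennreal (indicator a w * measure (Q (Y (int t) w) (X t w)) B) \<partial>M)" by simp
  also have "\<dots> = (\<integral>\<^sup>+w. indicator a w * emeasure (Q (Y (int t) w) (X t w)) B \<partial>M)"
  proof (rule nn_integral_cong)
    fix w
    interpret q: prob_space "Q (Y (int t) w) (X t w)" by (rule Q_prob)
    show "ennreal (indicator a w * measure (Q (Y (int t) w) (X t w)) B) = indicator a w * emeasure (Q (Y (int t) w) (X t w)) B"
      by (auto simp: q.emeasure_eq_measure indicator_def)
  qed
  finally show ?thesis using eq by (simp add: emeasure_eq_measure)
qed

text \<open>Carrying the sample point itself as first component, with the history as its
  sigma-field, covers every jointly measurable function of the past and the next state. Rectangles
  form an intersection-stable generator, so it suffices to compare both sides there.\<close>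

lemma joint_law_step:
  "distr M (H t \<Otimes>\<^sub>M borel) (\<lambda>w. (w, X (Suc t) w))
    = M \<bind> (\<lambda>w. distr (Q (Y (int t) w) (X t w)) (H t \<Otimes>\<^sub>M borel) (Pair w))"
    (is "?N1 = ?N2")
proof (rule measure_eqI_generator_eq)
  let ?E = "{a \<times> b | a b. a \<in> sets (H t) \<and> b \<in> sets (borel :: 'x measure)}"
  let ?Om = "space M \<times> (UNIV :: 'x set)"
  show "Int_stable ?E" by (rule Int_stable_pair_measure_generator)
  show "?E \<subseteq> Pow ?Om" using sets.sets_into_space[of _ "H t"] by fastforce
  show s1: "sets ?N1 = sigma_sets ?Om ?E" by (simp add: sets_pair_measure)
  have "sets ?N2 = sets (H t \<Otimes>\<^sub>M borel)" by (rule sets_bind) (auto simp: not_empty)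
  then show "sets ?N2 = sigma_sets ?Om ?E" by (simp add: sets_pair_measure)
  have "?Om \<in> ?E" using sets.top[of "H t"] by (intro CollectI exI[of _ "space M"] exI[of _ UNIV]) simp
  then show "range (\<lambda>_::nat. ?Om) \<subseteq> ?E" by blast
  show "(\<Union>i::nat. ?Om) = ?Om" by simp
  show "emeasure ?N1 ?Om \<noteq> \<infinity>"
    using prob_space.emeasure_le_1[OF prob_space_distr[OF pair_X_measurable[of t]], of ?Om]
    by (auto simp: top_unique)
  fix S assume "S \<in> ?E"
  then obtain a b where S: "S = a \<times> b" and a: "a \<in> sets (H t)" and b: "b \<in> sets borel" by auto
  have aM: "a \<subseteq> space M" using sets.sets_into_space[OF a] by simp
  have "emeasure ?N1 S = emeasure M ((\<lambda>w. (w, X (Suc t) w)) -` S \<inter> space M)"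
    using a b by (intro emeasure_distr[OF pair_X_measurable]) (simp add: S)
  also have "(\<lambda>w. (w, X (Suc t) w)) -` S \<inter> space M = a \<inter> X (Suc t) -` b" using aM by (auto simp: S)
  also have "emeasure M \<dots> = (\<integral>\<^sup>+w. indicator a w * emeasure (Q (Y (int t) w) (X t w)) b \<partial>M)"
    by (rule prob_step[OF a b])
  also have "\<dots> = (\<integral>\<^sup>+w. emeasure (distr (Q (Y (int t) w) (X t w)) (H t \<Otimes>\<^sub>M borel) (Pair w)) S \<partial>M)"
  proof (rule nn_integral_cong)
    fix w assume w: "w \<in> space M"
    have "emeasure (distr (Q (Y (int t) w) (X t w)) (H t \<Otimes>\<^sub>M borel) (Pair w)) S
        = emeasure (Q (Y (int t) w) (X t w)) (Pair w -` S \<inter> space (Q (Y (int t) w) (X t w)))"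
      using a b by (intro emeasure_distr Pair_measurable_Q w) (simp add: S)
    also have "Pair w -` S \<inter> space (Q (Y (int t) w) (X t w)) = (if w \<in> a then b else {})"
      using sets_eq_imp_space_eq[OF Q_sets] by (auto simp: S)
    finally show "indicator a w * emeasure (Q (Y (int t) w) (X t w)) b
        = emeasure (distr (Q (Y (int t) w) (X t w)) (H t \<Otimes>\<^sub>M borel) (Pair w)) S"
      by (simp add: indicator_def)
  qed
  also have "\<dots> = emeasure ?N2 S"
    using a b not_empty by (intro emeasure_bind[OF _ kernel_pair_measurable, symmetric]) (auto simp: S)
  finally show "emeasure ?N1 S = emeasure ?N2 S" .
qed

lemma nn_integral_step:
  assumes h[measurable]: "(\<lambda>(w, z). h w z) \<in> borel_measurable (H t \<Otimes>\<^sub>M borel)"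
  shows "(\<integral>\<^sup>+w. h w (X (Suc t) w) \<partial>M) = (\<integral>\<^sup>+w. \<integral>\<^sup>+z. h w z \<partial>Q (Y (int t) w) (X t w) \<partial>M)"
proof -
  have "(\<integral>\<^sup>+w. h w (X (Suc t) w) \<partial>M)
      = (\<integral>\<^sup>+p. (case p of (w, z) \<Rightarrow> h w z) \<partial>distr M (H t \<Otimes>\<^sub>M borel) (\<lambda>w. (w, X (Suc t) w)))"
    by (subst nn_integral_distr[OF pair_X_measurable]) (use h in simp_all)
  also have "\<dots> = (\<integral>\<^sup>+w. \<integral>\<^sup>+p. (case p of (w, z) \<Rightarrow> h w z)
      \<partial>distr (Q (Y (int t) w) (X t w)) (H t \<Otimes>\<^sub>M borel) (Pair w) \<partial>M)"
    unfolding joint_law_step by (rule nn_integral_bind[OF h kernel_pair_measurable])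
  also have "\<dots> = (\<integral>\<^sup>+w. \<integral>\<^sup>+z. h w z \<partial>Q (Y (int t) w) (X t w) \<partial>M)"
    by (intro nn_integral_cong, subst nn_integral_distr[OF Pair_measurable_Q]) (use h in simp_all)
  finally show ?thesis .
qed

lemma integral_step:
  fixes h :: "'w \<Rightarrow> 'x \<Rightarrow> real"
  assumes h[measurable]: "(\<lambda>(w, z). h w z) \<in> borel_measurable (H t \<Otimes>\<^sub>M borel)"
    and bd: "\<And>w z. \<bar>h w z\<bar> \<le> B"
  shows "(\<integral>w. h w (X (Suc t) w) \<partial>M) = (\<integral>w. (\<integral>z. h w z \<partial>Q (Y (int t) w) (X t w)) \<partial>M)"
proof -
  have "(\<integral>w. h w (X (Suc t) w) \<partial>M)
      = (\<integral>p. (case p of (w, z) \<Rightarrow> h w z) \<partial>distr M (H t \<Otimes>\<^sub>M borel) (\<lambda>w. (w, X (Suc t) w)))"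
    by (subst integral_distr[OF pair_X_measurable]) (use h in simp_all)
  also have "\<dots> = (\<integral>w. (\<integral>p. (case p of (w, z) \<Rightarrow> h w z)
      \<partial>distr (Q (Y (int t) w) (X t w)) (H t \<Otimes>\<^sub>M borel) (Pair w)) \<partial>M)"
    unfolding joint_law_step
  proof (rule integral_bind[OF h _ kernel_pair_measurable])
    show "\<bar>case p of (w, z) \<Rightarrow> h w z\<bar> \<le> B" for p using bd by (cases p) simp
    show "AE w in M. emeasure (distr (Q (Y (int t) w) (X t w)) (H t \<Otimes>\<^sub>M borel) (Pair w))
      (space (distr (Q (Y (int t) w) (X t w)) (H t \<Otimes>\<^sub>M borel) (Pair w))) \<le> ennreal 1"
      by (intro AE_I2)
        (use prob_space.emeasure_le_1[OF prob_space.prob_space_distr[OF Q_prob Pair_measurable_Q]] in simp)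
  qed unfold_locales
  also have "\<dots> = (\<integral>w. (\<integral>z. h w z \<partial>Q (Y (int t) w) (X t w)) \<partial>M)"
    by (intro Bochner_Integration.integral_cong, simp, subst integral_distr[OF Pair_measurable_Q]) (use h in simp_all)
  finally show ?thesis .
qed

text \<open>The induction hypothesis is applied from \<open>Suc s\<close>, where the weight is still
  measurable, and then the step at \<open>s\<close> is integrated out. The weight may depend on the
  past of the chain, as the covariance estimate demands.\<close>

lemma markov:
  assumes f[measurable]: "f \<in> borel_measurable borel" and fB: "\<And>x. \<bar>f x\<bar> \<le> B"
    and \<zeta>: "\<zeta> \<in> borel_measurable (H s)" and \<zeta>C: "\<And>w. \<bar>\<zeta> w\<bar> \<le> C"
  shows "(\<integral>w. \<zeta> w * f (X (s + t) w) \<partial>M)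
    = (\<integral>w. \<zeta> w * env_exp Q t (path_shift (int s) (env w)) f (X s w) \<partial>M)"
  using \<zeta>
proof (induction t arbitrary: s)
  case 0 then show ?case by simp
next
  case (Suc t)
  note [measurable] = Suc.prems
  have C0: "0 \<le> C" using \<zeta>C[of undefined] by linarith
  let ?h = "\<lambda>w z. \<zeta> w * env_exp Q t (path_shift (int (Suc s)) (env w)) f z"
  have "(\<integral>w. \<zeta> w * f (X (s + Suc t) w) \<partial>M) = (\<integral>w. \<zeta> w * f (X (Suc s + t) w) \<partial>M)" by simp
  also have "\<dots> = (\<integral>w. ?h w (X (Suc s) w) \<partial>M)"
    by (rule Suc.IH[OF measurable_H_Suc[OF Suc.prems]])
  also have "\<dots> = (\<integral>w. (\<integral>z. ?h w z \<partial>Q (Y (int s) w) (X s w)) \<partial>M)"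
  proof (rule integral_step)
    show "(\<lambda>(w, z). ?h w z) \<in> borel_measurable (H s \<Otimes>\<^sub>M borel)" by measurable
    show "\<bar>?h w z\<bar> \<le> C * B" for w z
      unfolding abs_mult by (intro mult_mono \<zeta>C env_exp_bounded f fB C0) auto
  qed
  also have "\<dots> = (\<integral>w. \<zeta> w * env_exp Q (Suc t) (path_shift (int s) (env w)) f (X s w) \<partial>M)"
    by (simp add: add.commute)
  finally show ?case .
qed

text \<open>Iterated drift. The weight must be arbitrary, because each step multiplies it by
  \<open>1 - lam\<close> at the current level; the accumulated \<open>K\<close> terms stay below the
  series since it solves the same recursion. Taking the indicator of bad environments as weight,
  this yields the uniform integrability that merging needs.\<close>

lemma V_moment:
  assumes "\<zeta> \<in> borel_measurable path_space"
  shows "(\<integral>\<^sup>+w. \<zeta> (env w) * ennreal (V (X s w)) \<partial>M)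
    \<le> (\<integral>\<^sup>+w. \<zeta> (env w) * (ennreal (V (X 0 w)) + drift_sum (path_shift (int s) (env w))) \<partial>M)"
  using assms
proof (induction s arbitrary: \<zeta>)
  case 0 then show ?case by (intro nn_integral_mono mult_left_mono) auto
next
  case (Suc s)
  note [measurable] = Suc.prems level_fun_measurable[where 'b=ennreal]
  have lm'[measurable]: "(\<lambda>w. h (lev (Y i w))) \<in> borel_measurable M" for h :: "nat \<Rightarrow> ennreal" and i
    using measurable_compose[OF env_measurable level_fun_measurable[of h i]] by simp
  let ?l = "\<lambda>w. ennreal (1 - lam (lev (env w (int s))))" and ?k = "\<lambda>w. ennreal (K (lev (env w (int s))))"
  have "(\<integral>\<^sup>+w. \<zeta> (env w) * ennreal (V (X (Suc s) w)) \<partial>M)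
      = (\<integral>\<^sup>+w. \<integral>\<^sup>+z. \<zeta> (env w) * ennreal (V z) \<partial>Q (Y (int s) w) (X s w) \<partial>M)"
    by (rule nn_integral_step) measurable
  also have "\<dots> \<le> (\<integral>\<^sup>+w. (\<zeta> (env w) * ?l w) * ennreal (V (X s w)) + \<zeta> (env w) * ?k w \<partial>M)"
  proof (rule nn_integral_mono)
    fix w
    have "(\<integral>\<^sup>+z. \<zeta> (env w) * ennreal (V z) \<partial>Q (Y (int s) w) (X s w))
        = \<zeta> (env w) * (\<integral>\<^sup>+z. ennreal (V z) \<partial>Q (Y (int s) w) (X s w))"
      by (rule nn_integral_cmult) measurable
    also have "\<dots> \<le> \<zeta> (env w) * ennreal ((1 - lam (lev (Y (int s) w))) * V (X s w) + K (lev (Y (int s) w)))"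
      by (intro mult_left_mono drift) auto
    also have "\<dots> = (\<zeta> (env w) * ?l w) * ennreal (V (X s w)) + \<zeta> (env w) * ?k w"
      using drift_rate[of "lev (Y (int s) w)"] V_nonneg[of "X s w"]
      by (simp add: ennreal_plus ennreal_mult distrib_left mult.assoc)
    finally show "(\<integral>\<^sup>+z. \<zeta> (env w) * ennreal (V z) \<partial>Q (Y (int s) w) (X s w))
        \<le> (\<zeta> (env w) * ?l w) * ennreal (V (X s w)) + \<zeta> (env w) * ?k w" .
  qed
  also have "\<dots> = (\<integral>\<^sup>+w. (\<zeta> (env w) * ?l w) * ennreal (V (X s w)) \<partial>M) + (\<integral>\<^sup>+w. \<zeta> (env w) * ?k w \<partial>M)"
    by (rule nn_integral_add) measurable
  also have "\<dots> \<le> (\<integral>\<^sup>+w. (\<zeta> (env w) * ?l w) * (ennreal (V (X 0 w)) + drift_sum (path_shift (int s) (env w))) \<partial>M)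
      + (\<integral>\<^sup>+w. \<zeta> (env w) * ?k w \<partial>M)"
  proof (rule add_right_mono)
    have "(\<lambda>y. \<zeta> y * ennreal (1 - lam (lev (y (int s))))) \<in> borel_measurable path_space" by measurable
    from Suc.IH[OF this]
    show "(\<integral>\<^sup>+w. (\<zeta> (env w) * ?l w) * ennreal (V (X s w)) \<partial>M)
      \<le> (\<integral>\<^sup>+w. (\<zeta> (env w) * ?l w) * (ennreal (V (X 0 w)) + drift_sum (path_shift (int s) (env w))) \<partial>M)" .
  qed
  also have "\<dots> = (\<integral>\<^sup>+w. (\<zeta> (env w) * ?l w) * (ennreal (V (X 0 w)) + drift_sum (path_shift (int s) (env w)))
      + \<zeta> (env w) * ?k w \<partial>M)"
    by (rule nn_integral_add[symmetric]) measurable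
  also have "\<dots> \<le> (\<integral>\<^sup>+w. \<zeta> (env w) * (ennreal (V (X 0 w)) + drift_sum (path_shift (int (Suc s)) (env w))) \<partial>M)"
  proof (rule nn_integral_mono)
    fix w
    have "?l w * ennreal (V (X 0 w)) \<le> 1 * ennreal (V (X 0 w))"
      using drift_rate[of "lev (Y (int s) w)"] by (intro mult_right_mono) (auto simp: ennreal_le_1)
    then have "?l w * (ennreal (V (X 0 w)) + drift_sum (path_shift (int s) (env w))) + ?k w
        \<le> ennreal (V (X 0 w)) + (?l w * drift_sum (path_shift (int s) (env w)) + ?k w)"
      by (simp add: distrib_left add.assoc add_right_mono)
    also have "\<dots> = ennreal (V (X 0 w)) + drift_sum (path_shift (int (Suc s)) (env w))"
      using drift_sum_shift[of "path_shift (int s) (env w)"] by (simp add: add.commute)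
    finally show "(\<zeta> (env w) * ?l w) * (ennreal (V (X 0 w)) + drift_sum (path_shift (int s) (env w))) + \<zeta> (env w) * ?k w
        \<le> \<zeta> (env w) * (ennreal (V (X 0 w)) + drift_sum (path_shift (int (Suc s)) (env w)))"
      by (metis (no_types, lifting) distrib_left mult.assoc mult_left_mono zero_le)
  qed
  finally show ?case .
qed

lemma V0_moment_finite: "(\<integral>\<^sup>+w. ennreal (V (X 0 w)) \<partial>M) < \<top>"
  using V0_integrable V_nonneg by (simp add: nn_integral_eq_integral)

lemma V_moment_bounded:
  "(\<integral>\<^sup>+w. ennreal (V (X s w)) \<partial>M) \<le> (\<integral>\<^sup>+w. ennreal (V (X 0 w)) \<partial>M) + (\<integral>\<^sup>+y. drift_sum y \<partial>D)"
proof -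
  have "(\<integral>\<^sup>+w. ennreal (V (X s w)) \<partial>M)
      \<le> (\<integral>\<^sup>+w. ennreal (V (X 0 w)) + drift_sum (path_shift (int s) (env w)) \<partial>M)"
    using V_moment[of "\<lambda>_. 1" s] by simp
  also have "\<dots> = (\<integral>\<^sup>+w. ennreal (V (X 0 w)) \<partial>M) + (\<integral>\<^sup>+w. drift_sum (path_shift (int s) (env w)) \<partial>M)"
    by (rule nn_integral_add) measurable
  finally show ?thesis by (simp add: nn_integral_env)
qed

end

section \<open>Merging in mean of two chains in one environment\<close>

context environment_chain
begin

text \<open>Off the bad set \<open>B\<close> the contraction applies, on it the additive bound. The
  contribution of \<open>V x\<close> on \<open>B\<close> stands apart because \<open>x\<close> will
  be \<open>X s\<close>, to which \<open>V_moment\<close> is applied with the indicator of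
  \<open>B\<close> as weight.\<close>

lemma env_exp_merge_split:
  fixes T N L s :: nat and f :: "'x \<Rightarrow> real" and \<eta> :: real
  assumes f: "weighted_test V f" and N: "1 \<le> N"
    and \<eta>: "4 * real N * merge_rate m ^ (L - 1) \<le> \<eta>" and fin: "drift_sum y < \<top>"
  defines "B \<equiv> {y. of_nat N < drift_sum (path_shift (int T) y) \<or> visits m T y < L}"
  shows "ennreal \<bar>env_exp Q T y f x - env_exp Q T y f x'\<bar>
    \<le> ennreal \<eta> * (1 + ennreal (V x') + ennreal (V x))
      + indicator B y * (4 * drift_sum (path_shift (int T) y) + ennreal (V x'))
      + indicator B y * ennreal (V x)"
proof -
  let ?d = "drift_sum (path_shift (int T) y)"
  define w where "w = enn2real ?d"
  have dw: "?d = ennreal w" "0 \<le> w" using drift_sum_shift_finite[OF fin, of T] by (auto simp: w_def)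
  note e = env_exp_merge[OF f fin, of T x x', folded w_def]
  show ?thesis
  proof (cases "y \<in> B")
    case True
    have "ennreal \<bar>env_exp Q T y f x - env_exp Q T y f x'\<bar> \<le> ennreal (4 * w + V x' + V x)"
      using e(2) by (intro ennreal_leI) simp
    also have "\<dots> = 4 * ?d + ennreal (V x') + ennreal (V x)"
      using dw V_nonneg by (simp add: ennreal_plus ennreal_mult flip: ennreal_numeral)
    finally show ?thesis using True by (simp add: add.assoc add_increasing)
  next
    case False
    then have "ennreal w \<le> ennreal (real N)" and v: "L \<le> visits m T y"
      using dw by (auto simp: B_def ennreal_of_nat_eq_real_of_nat not_less)
    then have "w \<le> real N" by (simp add: ennreal_le_iff)
    have "merge_rate m ^ (visits m T y - 1) \<le> merge_rate m ^ (L - 1)"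
      using v merge_rate_bounds[of m] by (intro power_decreasing) auto
    then have "4 * w * merge_rate m ^ (visits m T y - 1) \<le> 4 * real N * merge_rate m ^ (L - 1)"
      using \<open>w \<le> real N\<close> dw merge_rate_bounds[of m] by (intro mult_mono) auto
    also note \<eta>
    finally have le: "4 * w * merge_rate m ^ (visits m T y - 1) \<le> \<eta>" .
    have "0 \<le> 4 * w * merge_rate m ^ (visits m T y - 1)"
      using dw merge_rate_bounds[of m] by simp
    then have \<eta>0: "0 \<le> \<eta>" using le by linarith
    have "\<bar>env_exp Q T y f x - env_exp Q T y f x'\<bar>
        \<le> 4 * w * merge_rate m ^ (visits m T y - 1) * (1 + V x + V x')"
      by (rule e(1))
    also have "\<dots> \<le> \<eta> * (1 + V x + V x')"
      using V_nonneg[of x] V_nonneg[of x'] by (intro mult_right_mono le) simp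
    also have "\<dots> = \<eta> * (1 + V x' + V x)" by simp
    finally have "\<bar>env_exp Q T y f x - env_exp Q T y f x'\<bar> \<le> \<eta> * (1 + V x' + V x)" .
    then have "ennreal \<bar>env_exp Q T y f x - env_exp Q T y f x'\<bar> \<le> ennreal (\<eta> * (1 + V x' + V x))"
      by (rule ennreal_leI)
    also have "\<dots> = ennreal \<eta> * (1 + ennreal (V x') + ennreal (V x))"
      using \<eta>0 V_nonneg by (simp add: ennreal_plus ennreal_mult flip: ennreal_1)
    finally show ?thesis using False by simp
  qed
qed

text \<open>Every unbounded quantity is replaced by N plus its own tail, so no event for one
  variable multiplies another variable. In the application \<open>d\<close> and \<open>d'\<close>
  are the drift series at the end and the start of the window, \<open>v\<close> is
  \<open>V (X 0)\<close>, \<open>c\<close> is \<open>V x0\<close>, and \<open>P\<close> means too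
  few visits. The 6 counts copies of N: four from \<open>d\<close>, one each from \<open>v\<close>
  and \<open>d'\<close>; the 10 leaves room.\<close>

lemma tail_split:
  fixes N :: nat and c d d' v :: ennreal
  assumes N: "1 \<le> N"
  defines "\<tau> \<equiv> \<lambda>u::ennreal. u * indicator {u. of_nat N < u} u"
  shows "(if of_nat N < d \<or> P then 4 * d + c + (v + d') else 0)
    \<le> (6 * of_nat N + c) * (if P then 1 else 0) + (10 + c) * \<tau> d + \<tau> d' + \<tau> v"
proof -
  have u: "u \<le> of_nat N + \<tau> u" for u
    by (cases "of_nat N < u") (auto simp: \<tau>_def not_less)
  have six: "(6::ennreal) = 4 + 1 + 1" by simp
  show ?thesis
  proof (cases P)
    case True
    have "4 * d + c + (v + d') \<le> 4 * (of_nat N + \<tau> d) + c + ((of_nat N + \<tau> v) + (of_nat N + \<tau> d'))"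
      by (intro add_mono mult_left_mono u order_refl) auto
    also have "\<dots> = (6 * of_nat N + c) + 4 * \<tau> d + \<tau> d' + \<tau> v"
      unfolding six distrib_left distrib_right mult_1 by (simp only: ac_simps)
    also have "\<dots> \<le> (6 * of_nat N + c) + (10 + c) * \<tau> d + \<tau> d' + \<tau> v"
      by (intro add_mono mult_right_mono order_refl) (auto intro: add_increasing2)
    finally show ?thesis using True by simp
  next
    case False
    show ?thesis
    proof (cases "of_nat N < d")
      case True
      then have td: "\<tau> d = d" by (simp add: \<tau>_def)
      have Nd: "of_nat N \<le> d" using True by simp
      have "1 \<le> d" using N Nd by (metis of_nat_1 of_nat_le_iff order_trans)
      then have cd: "c \<le> c * d" using mult_left_mono[of 1 d c] by simp
      have "4 * d + c + (v + d') \<le> 4 * d + c * d + ((d + \<tau> v) + (d + \<tau> d'))"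
        using u[of v] u[of d'] Nd cd by (intro add_mono order_refl) (auto intro: order_trans[OF _ add_right_mono])
      also have "\<dots> = (4 * d + (d + d) + c * d) + \<tau> d' + \<tau> v" by (simp add: ac_simps)
      also have "4 * d + (d + d) = 6 * d"
        unfolding six distrib_right mult_1 by (simp only: add.assoc)
      also have "6 * d + c * d + \<tau> d' + \<tau> v \<le> (10 + c) * d + \<tau> d' + \<tau> v"
        unfolding distrib_right by (intro add_mono mult_right_mono order_refl) auto
      finally show ?thesis using True False td by simp
    qed (use False in simp)
  qed
qed

text \<open>The order of choices matters: N makes the tails small, L visits beat the factor 4N, and
  T makes fewer than L visits unlikely. None of them involves \<open>s\<close>, since the drift
  series has the same law at all times and the other tail concerns time 0.\<close>

lemma merging:
  fixes \<epsilon> :: real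
  assumes \<epsilon>: "0 < \<epsilon>"
  shows "\<exists>T. \<forall>s f. weighted_test V f \<longrightarrow>
    (\<integral>\<^sup>+w. ennreal \<bar>env_exp Q T (path_shift (int s) (env w)) f (X s w)
        - env_exp Q T (path_shift (int s) (env w)) f x0\<bar> \<partial>M) \<le> ennreal \<epsilon>"
proof -
  obtain m where m: "0 < measure D (good m)" using ex_good_positive[OF drift_sum_finite] by blast
  interpret D: prob_space D by (rule prob_space_D)
  define \<tau> where "\<tau> n u = u * indicator {u. of_nat n < u} u" for n :: nat and u :: ennreal
  have \<tau>_m[measurable]: "\<tau> n \<in> borel_measurable borel" for n unfolding \<tau>_def by measurable
  define EV where "EV = (\<integral>\<^sup>+w. ennreal (V (X 0 w)) \<partial>M)"
  define EW where "EW = (\<integral>\<^sup>+y. drift_sum y \<partial>D)"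
  define c where "c = ennreal (V x0)"
  define E1 where "E1 n = (\<integral>\<^sup>+y. \<tau> n (drift_sum y) \<partial>D)" for n
  define E0 where "E0 n = (\<integral>\<^sup>+w. \<tau> n (ennreal (V (X 0 w))) \<partial>M)" for n
  have "(\<lambda>n. (11 + c) * E1 n + E0 n) \<longlonglongrightarrow> (11 + c) * 0 + 0"
    unfolding E1_def E0_def \<tau>_def
    by (intro tendsto_add ennreal_tendsto_cmult nn_integral_tail_tendsto_0)
      (use drift_sum_finite V0_moment_finite in \<open>auto simp: c_def\<close>)
  then have "eventually (\<lambda>n. (11 + c) * E1 n + E0 n < ennreal (\<epsilon>/4)) sequentially"
    using \<epsilon> by (intro order_tendstoD(2)) auto
  then have "eventually (\<lambda>n. (11 + c) * E1 n + E0 n < ennreal (\<epsilon>/4) \<and> 1 \<le> n) sequentially"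
    using eventually_ge_at_top[of 1] by (rule eventually_conj)
  then obtain N where N: "(11 + c) * E1 N + E0 N < ennreal (\<epsilon>/4)" "1 \<le> N"
    by (auto dest: eventually_happens)
  \<comment> \<open>\<open>C\<close> bounds the mean of \<open>1 + V x0 + V (X s)\<close> for all
    \<open>s\<close>; \<eta> is scaled so that the contracting part costs
    \<open>\<epsilon>/4\<close>. Few visits and tails cost at most as much each.\<close>
  define C where "C = 1 + V x0 + (enn2real EV + enn2real EW)"
  have C1: "1 \<le> C" unfolding C_def using V_nonneg[of x0] by simp
  have C_eq: "ennreal C = 1 + c + (EV + EW)"
    using V0_moment_finite drift_sum_finite V_nonneg[of x0]
    by (simp add: C_def EV_def EW_def c_def ennreal_plus flip: ennreal_1)
  define \<eta> where "\<eta> = \<epsilon> / (4 * C)"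
  have \<eta>: "0 < \<eta>" using \<epsilon> C1 by (simp add: \<eta>_def)
  have "(\<lambda>k. 4 * real N * merge_rate m ^ k) \<longlonglongrightarrow> 4 * real N * 0"
    by (intro tendsto_mult_left LIMSEQ_realpow_zero) (use merge_rate_bounds[of m] in auto)
  then have "eventually (\<lambda>k. 4 * real N * merge_rate m ^ k < \<eta>) sequentially"
    using \<eta> by (intro order_tendstoD(2)) auto
  then obtain k where k: "4 * real N * merge_rate m ^ k < \<eta>" by (auto dest: eventually_happens)
  define L where "L = Suc k"
  have L: "4 * real N * merge_rate m ^ (L - 1) \<le> \<eta>" using k by (simp add: L_def)
  have "(\<lambda>t. (6 * real N + V x0) * measure D {y. visits m t y < L}) \<longlonglongrightarrow> (6 * real N + V x0) * 0"
    by (intro tendsto_mult_left visits_few_tendsto_0 m)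
  then have "eventually (\<lambda>t. (6 * real N + V x0) * measure D {y. visits m t y < L} < \<epsilon> / 4) sequentially"
    using \<epsilon> by (intro order_tendstoD(2)) auto
  then obtain T where T: "(6 * real N + V x0) * measure D {y. visits m T y < L} < \<epsilon> / 4"
    by (auto dest: eventually_happens)
  define B where "B = {y. of_nat N < drift_sum (path_shift (int T) y) \<or> visits m T y < L}"
  have B_m[measurable]: "B \<in> sets path_space"
  proof -
    have "{y \<in> space path_space. of_nat N < drift_sum (path_shift (int T) y) \<or> visits m T y < L} \<in> sets path_space"
      by measurable
    then show ?thesis by (simp add: B_def)
  qed
  have vis_m[measurable]: "{y. visits m T y < L} \<in> sets path_space"
  proof -
    have "{y \<in> space path_space. visits m T y < L} \<in> sets path_space" by measurable
    then show ?thesis by simp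
  qed
  have main: "(\<integral>\<^sup>+w. ennreal \<bar>env_exp Q T (path_shift (int s) (env w)) f (X s w)
        - env_exp Q T (path_shift (int s) (env w)) f x0\<bar> \<partial>M) \<le> ennreal \<epsilon>"
    if f: "weighted_test V f" for s f
  proof -
    let ?y = "\<lambda>w. path_shift (int s) (env w)"
    let ?d = "\<lambda>w. drift_sum (path_shift (int T) (?y w))"
    have ae: "AE w in M. drift_sum (?y w) < \<top>"
    proof -
      have "(\<integral>\<^sup>+w. drift_sum (?y w) \<partial>M) \<noteq> \<infinity>"
        using drift_sum_finite by (simp add: nn_integral_env)
      then have "AE w in M. drift_sum (?y w) \<noteq> \<infinity>" by (intro nn_integral_PInf_AE) auto
      then show ?thesis by eventually_elim (simp add: less_top)
    qed
    have "(\<integral>\<^sup>+w. ennreal \<bar>env_exp Q T (?y w) f (X s w) - env_exp Q T (?y w) f x0\<bar> \<partial>M)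
      \<le> (\<integral>\<^sup>+w. ennreal \<eta> * (1 + c + ennreal (V (X s w)))
          + indicator B (?y w) * (4 * ?d w + c) + indicator B (?y w) * ennreal (V (X s w)) \<partial>M)"
    proof (rule nn_integral_mono_AE, use ae in eventually_elim)
      case (elim w)
      show ?case unfolding B_def c_def by (rule env_exp_merge_split[OF f N(2) L elim])
    qed
    also have "\<dots> = (\<integral>\<^sup>+w. ennreal \<eta> * (1 + c + ennreal (V (X s w))) \<partial>M)
        + (\<integral>\<^sup>+w. indicator B (?y w) * (4 * ?d w + c) \<partial>M) + (\<integral>\<^sup>+w. indicator B (?y w) * ennreal (V (X s w)) \<partial>M)"
      by (subst nn_integral_add, measurable, subst nn_integral_add, measurable)
    also have "\<dots> \<le> ennreal (\<epsilon>/4) + (\<integral>\<^sup>+w. indicator B (?y w) * (4 * ?d w + c) \<partial>M)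
        + (\<integral>\<^sup>+w. indicator B (?y w) * (ennreal (V (X 0 w)) + drift_sum (?y w)) \<partial>M)"
    proof (intro add_mono order_refl)
      have "(\<integral>\<^sup>+w. ennreal \<eta> * (1 + c + ennreal (V (X s w))) \<partial>M) = ennreal \<eta> * (\<integral>\<^sup>+w. (1 + c) + ennreal (V (X s w)) \<partial>M)"
        by (rule nn_integral_cmult) measurable
      also have "(\<integral>\<^sup>+w. (1 + c) + ennreal (V (X s w)) \<partial>M) = (1 + c) + (\<integral>\<^sup>+w. ennreal (V (X s w)) \<partial>M)"
        by (subst nn_integral_add) (auto simp: emeasure_space_1)
      also have "ennreal \<eta> * \<dots> \<le> ennreal \<eta> * ennreal C"
        unfolding C_eq using V_moment_bounded[of s] by (intro mult_left_mono add_left_mono) (auto simp: EV_def EW_def)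
      also have "\<dots> = ennreal (\<epsilon>/4)" using \<eta> C1 by (subst ennreal_mult[symmetric]) (auto simp: \<eta>_def)
      finally show "(\<integral>\<^sup>+w. ennreal \<eta> * (1 + c + ennreal (V (X s w))) \<partial>M) \<le> ennreal (\<epsilon>/4)" .
      show "(\<integral>\<^sup>+w. indicator B (?y w) * ennreal (V (X s w)) \<partial>M)
          \<le> (\<integral>\<^sup>+w. indicator B (?y w) * (ennreal (V (X 0 w)) + drift_sum (?y w)) \<partial>M)"
        by (rule V_moment[where \<zeta>="\<lambda>y. indicator B (path_shift (int s) y)"]) measurable
    qed
    also have "\<dots> = ennreal (\<epsilon>/4) + (\<integral>\<^sup>+w. indicator B (?y w) * (4 * ?d w + c)
        + indicator B (?y w) * (ennreal (V (X 0 w)) + drift_sum (?y w)) \<partial>M)"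
      by (subst nn_integral_add) (auto simp: add.assoc)
    finally have split: "(\<integral>\<^sup>+w. ennreal \<bar>env_exp Q T (?y w) f (X s w) - env_exp Q T (?y w) f x0\<bar> \<partial>M)
      \<le> ennreal (\<epsilon>/4) + (\<integral>\<^sup>+w. indicator B (?y w) * (4 * ?d w + c)
        + indicator B (?y w) * (ennreal (V (X 0 w)) + drift_sum (?y w)) \<partial>M)" .
    have "(\<integral>\<^sup>+w. indicator B (?y w) * (4 * ?d w + c)
        + indicator B (?y w) * (ennreal (V (X 0 w)) + drift_sum (?y w)) \<partial>M)
      \<le> (\<integral>\<^sup>+w. (6 * of_nat N + c) * indicator {y. visits m T y < L} (?y w) + (10 + c) * \<tau> N (?d w)
          + \<tau> N (drift_sum (?y w)) + \<tau> N (ennreal (V (X 0 w))) \<partial>M)"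
    proof (rule nn_integral_mono)
      fix w
      show "indicator B (?y w) * (4 * ?d w + c) + indicator B (?y w) * (ennreal (V (X 0 w)) + drift_sum (?y w))
        \<le> (6 * of_nat N + c) * indicator {y. visits m T y < L} (?y w) + (10 + c) * \<tau> N (?d w)
          + \<tau> N (drift_sum (?y w)) + \<tau> N (ennreal (V (X 0 w)))"
        using tail_split[OF N(2), of "?d w" "visits m T (?y w) < L" c "ennreal (V (X 0 w))" "drift_sum (?y w)"]
        unfolding \<tau>_def B_def by (auto simp: indicator_def split: if_splits)
    qed
    also have "\<dots> = (6 * of_nat N + c) * (\<integral>\<^sup>+w. indicator {y. visits m T y < L} (?y w) \<partial>M)
        + (10 + c) * (\<integral>\<^sup>+w. \<tau> N (?d w) \<partial>M) + (\<integral>\<^sup>+w. \<tau> N (drift_sum (?y w)) \<partial>M) + E0 N"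
      unfolding E0_def by (simp add: nn_integral_add nn_integral_cmult)
    also have "(\<integral>\<^sup>+w. indicator {y. visits m T y < L} (?y w) \<partial>M) = ennreal (measure D {y. visits m T y < L})"
      by (subst nn_integral_env) (auto simp: D.emeasure_eq_measure)
    also have "(\<integral>\<^sup>+w. \<tau> N (?d w) \<partial>M) = E1 N"
      unfolding E1_def path_shift_shift by (subst nn_integral_env) auto
    also have "(\<integral>\<^sup>+w. \<tau> N (drift_sum (?y w)) \<partial>M) = E1 N"
      unfolding E1_def by (subst nn_integral_env) auto
    also have "(6 * of_nat N + c) * ennreal (measure D {y. visits m T y < L}) + (10 + c) * E1 N + E1 N + E0 N
        = ennreal ((6 * real N + V x0) * measure D {y. visits m T y < L}) + ((11 + c) * E1 N + E0 N)"
    proof -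
      have "(6 * of_nat N + c) * ennreal (measure D {y. visits m T y < L})
          = ennreal ((6 * real N + V x0) * measure D {y. visits m T y < L})"
        using V_nonneg[of x0]
        by (simp add: c_def ennreal_mult ennreal_plus ennreal_of_nat_eq_real_of_nat flip: ennreal_numeral)
      moreover have "(10 + c) * E1 N + E1 N = (11 + c) * E1 N"
      proof -
        have "(10 + c) * E1 N + E1 N = ((10 + c) + 1) * E1 N" by (simp add: distrib_right)
        also have "(10 + c) + 1 = 11 + c" by (simp add: add.commute add.assoc[symmetric])
        finally show ?thesis .
      qed
      ultimately show ?thesis by (simp add: add.assoc)
    qed
    also have "\<dots> \<le> ennreal (\<epsilon>/4) + ennreal (\<epsilon>/4)"
      using T N(1) by (intro add_mono ennreal_leI) auto
    finally have "ennreal (\<epsilon>/4) + (\<integral>\<^sup>+w. indicator B (?y w) * (4 * ?d w + c)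
        + indicator B (?y w) * (ennreal (V (X 0 w)) + drift_sum (?y w)) \<partial>M)
      \<le> ennreal (\<epsilon>/4) + (ennreal (\<epsilon>/4) + ennreal (\<epsilon>/4))" by (rule add_left_mono)
    also have "\<dots> \<le> ennreal \<epsilon>" using \<epsilon> by (simp flip: ennreal_plus)
    finally show ?thesis by (rule order_trans[OF split])
  qed
  show ?thesis using main by blast
qed

end

section \<open>Convergence in law and the law of large numbers\<close>

lemma ennreal_tendsto_0I:
  fixes f :: "nat \<Rightarrow> ennreal"
  assumes "\<And>e::real. 0 < e \<Longrightarrow> \<exists>T. \<forall>n\<ge>T. f n \<le> ennreal e"
  shows "f \<longlonglongrightarrow> 0"
proof (rule order_tendstoI)
  fix a :: ennreal assume "0 < a"
  then obtain b where b: "0 < b" "b < a" using dense by blast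
  then obtain e where "b = ennreal e" "0 \<le> e" by (cases b) auto
  then have e: "0 < e" "ennreal e < a" using b by (auto simp: ennreal_less_zero_iff)
  then obtain T where "\<forall>n\<ge>T. f n \<le> ennreal e" using assms by blast
  then show "eventually (\<lambda>n. f n < a) sequentially"
    using e unfolding eventually_sequentially by (meson le_less_trans)
qed simp

section \<open>Existence of the limit law\<close>

context environment_chain
begin

text \<open>For the second part, the Markov property at time \<open>n - T\<close> expresses the mean
  of \<open>f (X n)\<close> through \<open>env_exp\<close> from \<open>X (n - T)\<close>. Replacing
  this state by \<open>x0\<close> leaves a functional of the environment whose mean does not depend
  on \<open>n\<close>. All late means are thus close to one number, which gives the Cauchy
  property.\<close>

lemma merging_real:
  fixes \<epsilon> :: real
  assumes \<epsilon>: "0 < \<epsilon>"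
  shows "\<exists>T. (\<forall>s f. weighted_test V f \<longrightarrow> (\<integral>w. \<bar>env_exp Q T (path_shift (int s) (env w)) f (X s w)
        - env_exp Q T (path_shift (int s) (env w)) f x0\<bar> \<partial>M) \<le> \<epsilon>) \<and>
    (\<forall>n\<ge>T. \<forall>f. weighted_test V f \<longrightarrow> \<bar>(\<integral>w. f (X n w) \<partial>M) - (\<integral>y. env_exp Q T y f x0 \<partial>D)\<bar> \<le> \<epsilon>)"
proof -
  obtain T where T: "\<And>s f. weighted_test V f \<Longrightarrow>
    (\<integral>\<^sup>+w. ennreal \<bar>env_exp Q T (path_shift (int s) (env w)) f (X s w)
        - env_exp Q T (path_shift (int s) (env w)) f x0\<bar> \<partial>M) \<le> ennreal \<epsilon>"
    using merging[OF \<epsilon>] by blast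
  have 1: "(\<integral>w. \<bar>env_exp Q T (path_shift (int s) (env w)) f (X s w)
        - env_exp Q T (path_shift (int s) (env w)) f x0\<bar> \<partial>M) \<le> \<epsilon>" if f: "weighted_test V f" for s f
  proof (rule integral_le_of_nn_integral(2)[OF _ _ _ T[OF f]])
    have [measurable]: "f \<in> borel_measurable borel" using f by (simp add: weighted_test_def)
    show "(\<lambda>w. \<bar>env_exp Q T (path_shift (int s) (env w)) f (X s w)
        - env_exp Q T (path_shift (int s) (env w)) f x0\<bar>) \<in> borel_measurable M" by measurable
  qed (use \<epsilon> in auto)
  have 2: "\<bar>(\<integral>w. f (X n w) \<partial>M) - (\<integral>y. env_exp Q T y f x0 \<partial>D)\<bar> \<le> \<epsilon>"
    if n: "T \<le> n" and f: "weighted_test V f" for n f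
  proof -
    obtain B where fm[measurable]: "f \<in> borel_measurable borel" and fB: "\<And>x. \<bar>f x\<bar> \<le> B"
      using f by (auto simp: weighted_test_def)
    let ?s = "n - T"
    let ?y = "\<lambda>w. path_shift (int ?s) (env w)"
    have eB: "\<bar>env_exp Q T y f x\<bar> \<le> B" for y x by (rule env_exp_bounded[OF fm fB])
    have "(\<integral>w. f (X n w) \<partial>M) = (\<integral>w. env_exp Q T (?y w) f (X ?s w) \<partial>M)"
      using markov[OF fm fB, of "\<lambda>_. 1" ?s 1 T] n by simp
    moreover have "(\<integral>y. env_exp Q T y f x0 \<partial>D) = (\<integral>w. env_exp Q T (?y w) f x0 \<partial>M)"
      by (rule integral_env[symmetric]) measurable
    ultimately have "(\<integral>w. f (X n w) \<partial>M) - (\<integral>y. env_exp Q T y f x0 \<partial>D)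
        = (\<integral>w. env_exp Q T (?y w) f (X ?s w) - env_exp Q T (?y w) f x0 \<partial>M)"
      by (subst Bochner_Integration.integral_diff) (auto intro!: integrable_const_bound[of _ B] eB)
    also have "\<bar>\<dots>\<bar> \<le> (\<integral>w. \<bar>env_exp Q T (?y w) f (X ?s w) - env_exp Q T (?y w) f x0\<bar> \<partial>M)"
      by (rule integral_abs_bound)
    also have "\<dots> \<le> \<epsilon>" by (rule 1[OF f])
    finally show ?thesis .
  qed
  show ?thesis using 1 2 by blast
qed

lemma integral_law:
  fixes f :: "'x \<Rightarrow> real"
  shows "f \<in> borel_measurable borel \<Longrightarrow> (\<integral>x. f x \<partial>distr M borel (X n)) = (\<integral>w. f (X n w) \<partial>M)"
  by (rule integral_distr) auto

lemma ex_limit_law: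
  "\<exists>\<mu>. prob_space \<mu> \<and> sets \<mu> = sets borel \<and>
     (\<forall>e>0. \<exists>T. \<forall>n\<ge>T. \<forall>f. weighted_test V f \<longrightarrow> \<bar>(\<integral>w. f (X n w) \<partial>M) - (\<integral>x. f x \<partial>\<mu>)\<bar> \<le> e)"
proof -
  have "\<exists>T. \<forall>m\<ge>T. \<forall>n\<ge>T. \<forall>f. weighted_test V f \<longrightarrow>
      \<bar>(\<integral>x. f x \<partial>distr M borel (X m)) - (\<integral>x. f x \<partial>distr M borel (X n))\<bar> \<le> e" if "0 < e" for e
  proof -
    from that have "0 < e / 2" by simp
    \<comment> \<open>Any fixed reference state will do.\<close>
    from merging_real[OF this, of undefined] obtain T where
      T: "\<And>n f. T \<le> n \<Longrightarrow> weighted_test V f \<Longrightarrow> \<bar>(\<integral>w. f (X n w) \<partial>M) - (\<integral>y. env_exp Q T y f undefined \<partial>D)\<bar> \<le> e/2"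
      by blast
    have "\<bar>(\<integral>x. f x \<partial>distr M borel (X m)) - (\<integral>x. f x \<partial>distr M borel (X n))\<bar> \<le> e"
      if "T \<le> m" "T \<le> n" "weighted_test V f" for m n f
    proof -
      have fm: "f \<in> borel_measurable borel" using that by (simp add: weighted_test_def)
      show ?thesis unfolding integral_law[OF fm] using T[OF that(1,3)] T[OF that(2,3)] by linarith
    qed
    then show ?thesis by blast
  qed
  from weighted_tv_limit[of "\<lambda>n. distr M borel (X n)", OF _ _ V_nonneg this]
  obtain \<mu> where \<mu>: "prob_space \<mu>" "sets \<mu> = sets borel"
    and lim: "\<And>e. 0 < e \<Longrightarrow> \<exists>T. \<forall>n\<ge>T. \<forall>f. weighted_test V f \<longrightarrow>
        \<bar>(\<integral>x. f x \<partial>distr M borel (X n)) - (\<integral>x. f x \<partial>\<mu>)\<bar> \<le> e"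
    by (auto simp: prob_space_distr)
  have "\<exists>T. \<forall>n\<ge>T. \<forall>f. weighted_test V f \<longrightarrow> \<bar>(\<integral>w. f (X n w) \<partial>M) - (\<integral>x. f x \<partial>\<mu>)\<bar> \<le> e" if "0 < e" for e
    using lim[OF that] integral_law unfolding weighted_test_def by metis
  then show ?thesis using \<mu> by blast
qed

definition limit_law :: "'x measure"
  where "limit_law = (SOME \<mu>. prob_space \<mu> \<and> sets \<mu> = sets borel \<and>
     (\<forall>e>0. \<exists>T. \<forall>n\<ge>T. \<forall>f. weighted_test V f \<longrightarrow> \<bar>(\<integral>w. f (X n w) \<partial>M) - (\<integral>x. f x \<partial>\<mu>)\<bar> \<le> e))"

lemma limit_law:
  shows prob_space_limit_law: "prob_space limit_law"
    and sets_limit_law [simp, measurable_cong]: "sets limit_law = sets borel"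
    and limit_law_test: "0 < e \<Longrightarrow> \<exists>T. \<forall>n\<ge>T. \<forall>f. weighted_test V f \<longrightarrow>
          \<bar>(\<integral>w. f (X n w) \<partial>M) - (\<integral>x. f x \<partial>limit_law)\<bar> \<le> e"
  using someI_ex[OF ex_limit_law] unfolding limit_law_def[symmetric] by blast+

lemma limit_law_tendsto:
  assumes "weighted_test V f"
  shows "(\<lambda>n. \<integral>w. f (X n w) \<partial>M) \<longlonglongrightarrow> (\<integral>x. f x \<partial>limit_law)"
proof (rule LIMSEQ_I)
  fix r :: real assume "0 < r"
  then obtain T where "\<forall>n\<ge>T. \<bar>(\<integral>w. f (X n w) \<partial>M) - (\<integral>x. f x \<partial>limit_law)\<bar> \<le> r / 2"
    using limit_law_test[of "r/2"] assms by auto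
  then show "\<exists>no. \<forall>n\<ge>no. norm ((\<integral>w. f (X n w) \<partial>M) - (\<integral>x. f x \<partial>limit_law)) < r"
    using \<open>0 < r\<close> by (intro exI[of _ T]) (fastforce intro: le_less_trans[of _ "r/2"])
qed

lemma rho1_law_tendsto: "(\<lambda>n. rho1 V (distr M borel (X n)) limit_law) \<longlonglongrightarrow> 0"
proof (rule ennreal_tendsto_0I)
  fix e :: real assume "0 < e"
  then obtain T where T: "\<And>n f. n \<ge> T \<Longrightarrow> weighted_test V f \<Longrightarrow> \<bar>(\<integral>w. f (X n w) \<partial>M) - (\<integral>x. f x \<partial>limit_law)\<bar> \<le> e"
    using limit_law_test[of e] by blast
  have "rho1 V (distr M borel (X n)) limit_law \<le> ennreal e" if "n \<ge> T" for n
  proof (rule rho1_le[OF prob_space_distr prob_space_limit_law _ _ V_measurable V_nonneg])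
    fix \<psi> :: "'x \<Rightarrow> real" and N
    assume \<psi>: "\<psi> \<in> borel_measurable borel" "\<And>x. \<bar>\<psi> x\<bar> \<le> 1 + V x" "\<And>x. \<bar>\<psi> x\<bar> \<le> N"
    then have "weighted_test V \<psi>" by (auto simp: weighted_test_def)
    from T[OF that this] show "(\<integral>x. \<psi> x \<partial>distr M borel (X n)) - (\<integral>x. \<psi> x \<partial>limit_law) \<le> e"
      using \<psi>(1) by (simp add: integral_law abs_le_iff)
  qed auto
  then show "\<exists>T. \<forall>n\<ge>T. rho1 V (distr M borel (X n)) limit_law \<le> ennreal e" by blast
qed

definition V_bound :: real
  where "V_bound = enn2real ((\<integral>\<^sup>+w. ennreal (V (X 0 w)) \<partial>M) + (\<integral>\<^sup>+y. drift_sum y \<partial>D))"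

lemma V_bound_nonneg: "0 \<le> V_bound"
  by (simp add: V_bound_def)

lemma V_X_nn_integral: "(\<integral>\<^sup>+w. ennreal (V (X s w)) \<partial>M) \<le> ennreal V_bound"
  using V_moment_bounded[of s] V0_moment_finite drift_sum_finite by (simp add: V_bound_def)

lemma V_X_integrable: "integrable M (\<lambda>w. V (X s w))"
  and V_X_integral_le: "(\<integral>w. V (X s w) \<partial>M) \<le> V_bound"
  by (rule integral_le_of_nn_integral[OF _ _ V_bound_nonneg V_X_nn_integral]; simp add: V_nonneg)+

text \<open>Truncations of \<open>V\<close> are test functions, so the moment bound along the chain
  passes to the limit; monotone convergence removes the truncation.\<close>

lemma limit_law_V_nn_integral: "(\<integral>\<^sup>+x. ennreal (V x) \<partial>limit_law) \<le> ennreal V_bound"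
proof -
  interpret L: prob_space limit_law by (rule prob_space_limit_law)
  have trunc: "(\<integral>\<^sup>+x. ennreal (min (V x) (real k)) \<partial>limit_law) \<le> ennreal V_bound" for k
  proof -
    let ?f = "\<lambda>x. min (V x) (real k)"
    have f0: "0 \<le> ?f x" for x using V_nonneg[of x] by simp
    have t: "weighted_test V ?f" unfolding weighted_test_def
      using V_nonneg by (auto intro!: exI[of _ "real k"] simp: min_def)
    have "(\<integral>x. ?f x \<partial>limit_law) \<le> V_bound"
    proof (rule LIMSEQ_le_const2[OF limit_law_tendsto[OF t]])
      have "(\<integral>w. ?f (X n w) \<partial>M) \<le> V_bound" for n
      proof -
        have "(\<integral>w. ?f (X n w) \<partial>M) \<le> (\<integral>w. V (X n w) \<partial>M)"
          using V_nonneg by (intro integral_mono V_X_integrable integrable_const_bound[of _ "real k"]) (auto simp: min_def)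
        also note V_X_integral_le
        finally show ?thesis .
      qed
      then show "\<exists>N. \<forall>n\<ge>N. (\<integral>w. ?f (X n w) \<partial>M) \<le> V_bound" by blast
    qed
    moreover have "integrable limit_law ?f"
      using V_nonneg by (intro L.integrable_const_bound[of _ "real k"]) (auto simp: min_def)
    ultimately show ?thesis using f0 by (simp add: nn_integral_eq_integral ennreal_leI)
  qed
  have "(\<integral>\<^sup>+x. ennreal (V x) \<partial>limit_law) = (\<integral>\<^sup>+x. (SUP k. ennreal (min (V x) (real k))) \<partial>limit_law)"
  proof (intro nn_integral_cong antisym)
    fix x
    obtain k where "V x < real k" using reals_Archimedean2 by blast
    then show "ennreal (V x) \<le> (SUP k. ennreal (min (V x) (real k)))"
      by (intro SUP_upper2[of k]) (auto simp: min_def)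
    show "(SUP k. ennreal (min (V x) (real k))) \<le> ennreal (V x)"
      by (intro SUP_least ennreal_leI) auto
  qed
  also have "\<dots> = (SUP k. \<integral>\<^sup>+x. ennreal (min (V x) (real k)) \<partial>limit_law)"
    by (intro nn_integral_monotone_convergence_SUP)
      (auto simp: incseq_def le_fun_def intro!: ennreal_leI min.mono)
  also have "\<dots> \<le> ennreal V_bound" by (intro SUP_least trunc)
  finally show ?thesis .
qed

lemma V_limit_integrable: "integrable limit_law V"
  and V_limit_integral_le: "(\<integral>x. V x \<partial>limit_law) \<le> V_bound"
  by (rule integral_le_of_nn_integral[OF _ _ V_bound_nonneg limit_law_V_nn_integral]; simp add: V_nonneg)+

text \<open>A second-moment argument in which covariances at lag \<open>T\<close> or more are merely
  at most 2\<epsilon>, with no decay: the mean square of the average of the \<open>Z i\<close> is at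
  most 2\<epsilon> + 8T/t. What remains is an average of a function of the environment.\<close>

lemma lln_bounded_1:
  assumes f[measurable]: "f \<in> borel_measurable borel" and f1: "\<And>x. \<bar>f x\<bar> \<le> 1"
  shows "(\<lambda>t. \<integral>w. \<bar>(\<Sum>i=1..t. f (X i w)) / real t - (\<integral>x. f x \<partial>limit_law)\<bar> \<partial>M) \<longlonglongrightarrow> 0"
proof (rule LIMSEQ_I)
  fix r :: real assume r: "0 < r"
  interpret D: prob_space D by (rule prob_space_D)
  have ft: "weighted_test V f"
    unfolding weighted_test_def
  proof (intro conjI allI exI[of _ 1])
    show "\<bar>f x\<bar> \<le> 1 + V x" for x using f1[of x] V_nonneg[of x] by linarith
  qed (use f1 in auto)
  define a where "a = r / 4"
  \<comment> \<open>The centred sums, the environment averages and the centring constant each cost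
    at most \<open>a\<close>, a quarter of \<open>r\<close>. That 4\<epsilon> is at most the square
    of \<open>a\<close> turns the mean square bound into that square.\<close>
  define \<epsilon> where "\<epsilon> = min a (a\<^sup>2 / 4)"
  have a: "0 < a" using r by (simp add: a_def)
  have \<epsilon>: "0 < \<epsilon>" "\<epsilon> \<le> a" "4 * \<epsilon> \<le> a\<^sup>2" using a by (auto simp: \<epsilon>_def min_def)
  define x0 :: 'x where "x0 = undefined"
  obtain T where T: "\<And>s f. weighted_test V f \<Longrightarrow> (\<integral>w. \<bar>env_exp Q T (path_shift (int s) (env w)) f (X s w)
        - env_exp Q T (path_shift (int s) (env w)) f x0\<bar> \<partial>M) \<le> \<epsilon>"
    "\<And>n f. T \<le> n \<Longrightarrow> weighted_test V f \<Longrightarrow> \<bar>(\<integral>w. f (X n w) \<partial>M) - (\<integral>y. env_exp Q T y f x0 \<partial>D)\<bar> \<le> \<epsilon>"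
    using merging_real[OF \<epsilon>(1), of x0] by blast
  note T1 = T(1)[OF ft] and T2 = T(2)[OF _ ft]
  define h where "h y = env_exp Q T (path_shift (- int T) y) f x0" for y
  have h_m[measurable]: "h \<in> borel_measurable path_space" unfolding h_def by measurable
  have h1: "\<bar>h y\<bar> \<le> 1" for y unfolding h_def by (rule env_exp_bounded[OF f f1])
  define I where "I = (\<integral>y. h y \<partial>D)"
  define S where "S = (\<integral>x. f x \<partial>limit_law)"
  have I_eq: "I = (\<integral>y. env_exp Q T y f x0 \<partial>D)"
    unfolding I_def h_def
    by (subst (2) distr_D_path_shift[of "- int T", symmetric], subst integral_distr) auto
  have SI: "\<bar>S - I\<bar> \<le> \<epsilon>" unfolding S_def I_eq
  proof (rule LIMSEQ_le_const2)
    show "(\<lambda>n. \<bar>(\<integral>w. f (X n w) \<partial>M) - (\<integral>y. env_exp Q T y f x0 \<partial>D)\<bar>)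
        \<longlonglongrightarrow> \<bar>(\<integral>x. f x \<partial>limit_law) - (\<integral>y. env_exp Q T y f x0 \<partial>D)\<bar>"
      by (intro tendsto_intros limit_law_tendsto ft)
    show "\<exists>N. \<forall>n\<ge>N. \<bar>(\<integral>w. f (X n w) \<partial>M) - (\<integral>y. env_exp Q T y f x0 \<partial>D)\<bar> \<le> \<epsilon>" using T2 by blast
  qed
  define g where "g i w = h (path_shift (int i) (env w))" for i :: nat and w
  \<comment> \<open>\<open>g i\<close> is the mean at time \<open>i\<close>, given the environment, of a chain started in \<open>x0\<close> at time \<open>i - T\<close>;
    it approximates the conditional mean of \<open>f (X i)\<close> given the past up to time \<open>i - T\<close>, so
    \<open>Z i\<close> and \<open>Z j\<close> are almost orthogonal for \<open>j \<ge> i + T\<close>.\<close>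
  define Z where "Z i w = f (X i w) - g i w" for i w
  have g_m: "g i \<in> borel_measurable (H s)" for i s unfolding g_def by measurable
  have [measurable]: "g i \<in> borel_measurable M" for i by (rule measurable_H_M[OF g_m])
  have Z_H: "Z i \<in> borel_measurable (H s)" if "i \<le> s" for i s
  proof -
    note [measurable] = g_m X_measurable_H[OF that]
    show ?thesis unfolding Z_def by measurable
  qed
  have [measurable]: "Z i \<in> borel_measurable M" for i unfolding Z_def by measurable
  have Z2: "\<bar>Z i w\<bar> \<le> 2" for i w
    using f1[of "X i w"] h1[of "path_shift (int i) (env w)"] unfolding Z_def g_def by linarith
  have ZZ4: "\<bar>Z i w * Z j w\<bar> \<le> 4" for i j w
    using mult_mono[OF Z2[of i w] Z2[of j w]] by (simp add: abs_mult)
  have ZZ_int: "integrable M (\<lambda>w. Z i w * Z j w)" for i j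
    by (rule integrable_const_bound[of _ 4]) (use ZZ4 in auto)
  \<comment> \<open>\<open>Z i\<close> belongs to the history at \<open>j - T\<close>, so the Markov
    property replaces \<open>f (X j)\<close> by \<open>env_exp\<close> from
    \<open>X (j - T)\<close>, while \<open>g j\<close> is the same expression from
    \<open>x0\<close>. These merge in mean, and 2 is the bound of \<open>Z i\<close>.\<close>
  have far: "(\<integral>w. Z i w * Z j w \<partial>M) \<le> 2 * \<epsilon>" if ij: "i + T \<le> j" for i j
  proof -
    define s where "s = j - T"
    have s: "j = s + T" "i \<le> s" using ij by (auto simp: s_def)
    let ?y = "\<lambda>w. path_shift (int s) (env w)"
    let ?u = "\<lambda>w. env_exp Q T (?y w) f (X s w)" and ?v = "\<lambda>w. env_exp Q T (?y w) f x0"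
    have g_j: "g j w = ?v w" for w by (simp add: g_def h_def s(1))
    have u1: "\<bar>env_exp Q T y f x\<bar> \<le> 1" for y x by (rule env_exp_bounded[OF f f1])
    have Zb: "\<bar>Z i w * k\<bar> \<le> 2" if "\<bar>k\<bar> \<le> 1" for k w
      using mult_mono[OF Z2[of i w] that] by (simp add: abs_mult)
    have int: "integrable M (\<lambda>w. Z i w * ?u w)" "integrable M (\<lambda>w. Z i w * ?v w)"
      "integrable M (\<lambda>w. Z i w * f (X j w))"
      by (rule integrable_const_bound[of _ 2]; use Zb u1 f1 in auto)+
    have "(\<integral>w. Z i w * Z j w \<partial>M) = (\<integral>w. Z i w * f (X j w) - Z i w * ?v w \<partial>M)"
      by (simp add: Z_def[of j] g_j right_diff_distrib)
    also have "\<dots> = (\<integral>w. Z i w * f (X (s + T) w) \<partial>M) - (\<integral>w. Z i w * ?v w \<partial>M)"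
      using int unfolding s(1) by (intro Bochner_Integration.integral_diff)
    also have "\<dots> = (\<integral>w. Z i w * ?u w \<partial>M) - (\<integral>w. Z i w * ?v w \<partial>M)"
      by (subst markov[OF f f1 Z_H[OF s(2)] Z2]) simp
    also have "\<dots> = (\<integral>w. Z i w * (?u w - ?v w) \<partial>M)"
      using int by (simp add: right_diff_distrib)
    also have "\<dots> \<le> (\<integral>w. 2 * \<bar>?u w - ?v w\<bar> \<partial>M)"
    proof (rule integral_mono)
      show "integrable M (\<lambda>w. Z i w * (?u w - ?v w))" using int by (simp add: right_diff_distrib)
      have "integrable M (\<lambda>w. ?u w - ?v w)"
        by (intro Bochner_Integration.integrable_diff integrable_const_bound[of _ 1]) (use u1 in auto)
      then show "integrable M (\<lambda>w. 2 * \<bar>?u w - ?v w\<bar>)" by simp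
      show "Z i w * (?u w - ?v w) \<le> 2 * \<bar>?u w - ?v w\<bar>" for w
      proof -
        have "Z i w * (?u w - ?v w) \<le> \<bar>Z i w\<bar> * \<bar>?u w - ?v w\<bar>"
          unfolding abs_mult[symmetric] by (rule abs_ge_self)
        also have "\<dots> \<le> 2 * \<bar>?u w - ?v w\<bar>" by (intro mult_right_mono Z2) simp
        finally show ?thesis .
      qed
    qed
    also have "\<dots> \<le> 2 * \<epsilon>" using T1[of s] by simp
    finally show ?thesis .
  qed
  have pair: "(\<integral>w. Z i w * Z j w \<partial>M) \<le> 2 * \<epsilon> + (if i < j + T \<and> j < i + T then 4 else 0)" for i j
  proof -
    have "(\<integral>w. Z i w * Z j w \<partial>M) \<le> (\<integral>w. 4 \<partial>M)"
      using ZZ4 ZZ_int by (intro integral_mono) (auto simp: abs_le_iff)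
    then have "(\<integral>w. Z i w * Z j w \<partial>M) \<le> 4" by (simp add: prob_space)
    then show ?thesis
      using far[of i j] far[of j i] \<epsilon>(1) by (auto simp: mult.commute)
  qed
  have var: "(\<integral>w. (\<Sum>i=1..t. Z i w)\<^sup>2 \<partial>M) \<le> real t * (real t * (2 * \<epsilon>) + 8 * real T)" for t
  proof -
    have "(\<integral>w. (\<Sum>i=1..t. Z i w)\<^sup>2 \<partial>M) = (\<Sum>i=1..t. \<Sum>j=1..t. \<integral>w. Z i w * Z j w \<partial>M)"
      unfolding power2_eq_square sum_product using ZZ_int by simp
    also have "\<dots> \<le> (\<Sum>i=1..t. real t * (2 * \<epsilon>) + 8 * real T)"
    proof (rule sum_mono)
      fix i
      have "(\<Sum>j=1..t. \<integral>w. Z i w * Z j w \<partial>M)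
          \<le> (\<Sum>j=1..t. 2 * \<epsilon> + (if i < j + T \<and> j < i + T then 4 else 0))"
        by (intro sum_mono pair)
      also have "\<dots> = real t * (2 * \<epsilon>) + (\<Sum>j=1..t. if i < j + T \<and> j < i + T then 4 else 0)"
        by (simp add: sum.distrib)
      \<comment> \<open>At most 2T indices lie within lag \<open>T\<close> of \<open>i\<close>, each
        with weight 4.\<close>
      also have "(\<Sum>j=1..t. if i < j + T \<and> j < i + T then 4 else (0::real))
          = (\<Sum>j\<in>{j\<in>{1..t}. i < j + T \<and> j < i + T}. 4)"
        by (rule sum.inter_filter[symmetric]) simp
      also have "\<dots> \<le> (\<Sum>j\<in>{i - T..<i + T}. 4::real)"
        by (intro sum_mono2) auto
      also have "\<dots> \<le> 8 * real T" by simp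
      finally show "(\<Sum>j=1..t. \<integral>w. Z i w * Z j w \<partial>M) \<le> real t * (2 * \<epsilon>) + 8 * real T" by simp
    qed
    also have "\<dots> = real t * (real t * (2 * \<epsilon>) + 8 * real T)" by simp
    finally show ?thesis .
  qed
  have birk: "(\<lambda>t. \<integral>w. \<bar>(\<Sum>i=1..t. g i w) / real t - I\<bar> \<partial>M) \<longlonglongrightarrow> 0"
  proof -
    \<comment> \<open>One extra shift, because Birkhoff sums begin at index 0 and the averages here
      at 1.\<close>
    let ?k = "\<lambda>y. h (path_shift 1 y)"
    have "(\<lambda>t. \<integral>y. \<bar>(\<Sum>i<t. ?k ((path_shift 1 ^^ i) y)) / real t - (\<integral>y. ?k y \<partial>D)\<bar> \<partial>D) \<longlonglongrightarrow> 0"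
    proof (rule D.birkhoff_bounded[where B=1])
      show "path_shift 1 \<in> D \<rightarrow>\<^sub>M D"
        unfolding measurable_cong_sets[OF sets_D sets_D] by (rule path_shift_measurable)
      show "?k \<in> borel_measurable D" by measurable
      show "distr D D (path_shift 1) = D"
        using distr_D_path_shift[of 1] distr_cong[OF refl sets_D, of D "path_shift 1" "path_shift 1"] by simp
      show "B \<in> D.events \<Longrightarrow> path_shift 1 -` B = B \<Longrightarrow> D.prob B \<in> {0, 1}" for B by (rule ergodic_D)
    qed (use h1 in auto)
    moreover have "(\<integral>y. ?k y \<partial>D) = I"
      unfolding I_def by (subst (2) distr_D_path_shift[of 1, symmetric], subst integral_distr) auto
    moreover have "(\<integral>y. \<bar>(\<Sum>i<t. ?k ((path_shift 1 ^^ i) y)) / real t - I\<bar> \<partial>D)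
        = (\<integral>w. \<bar>(\<Sum>i=1..t. g i w) / real t - I\<bar> \<partial>M)" for t
    proof -
      have eq: "(\<Sum>i<t. ?k ((path_shift 1 ^^ i) y)) = (\<Sum>i=1..t. h (path_shift (int i) y))" for y
        by (simp only: path_shift_funpow path_shift_shift)
          (rule sum.reindex_bij_witness[of _ "\<lambda>i. i - 1" Suc], auto)
      have "(\<integral>y. \<bar>(\<Sum>i=1..t. h (path_shift (int i) y)) / real t - I\<bar> \<partial>D)
          = (\<integral>w. \<bar>(\<Sum>i=1..t. h (path_shift (int i) (path_shift 0 (env w)))) / real t - I\<bar> \<partial>M)"
        by (rule integral_env[symmetric]) measurable
      then show ?thesis unfolding eq g_def by (simp only: path_shift_0)
    qed
    ultimately show ?thesis by simp
  qed
  then obtain t1 where t1: "\<And>t. t \<ge> t1 \<Longrightarrow> (\<integral>w. \<bar>(\<Sum>i=1..t. g i w) / real t - I\<bar> \<partial>M) < a"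
    using a unfolding lim_sequentially dist_real_def by (auto simp: abs_less_iff)
  \<comment> \<open>Beyond \<open>t2\<close> the near-diagonal part 8T is no larger than
    2\<epsilon>t, so the bound merely doubles to 4\<epsilon>.\<close>
  obtain t2 :: nat where t2: "8 * real T / (2 * \<epsilon>) < real t2" using reals_Archimedean2 by blast
  have "\<bar>(\<integral>w. \<bar>(\<Sum>i=1..t. f (X i w)) / real t - S\<bar> \<partial>M)\<bar> < r" if t: "t \<ge> max 1 (max t1 t2)" for t
  proof -
    have tp: "0 < real t" "t \<ge> t1" "t \<ge> t2" using t by auto
    have "8 * real T \<le> real t * (2 * \<epsilon>)"
    proof -
      have e2: "0 < 2 * \<epsilon>" using \<epsilon>(1) by simp
      have "8 * real T < real t2 * (2 * \<epsilon>)" using t2 unfolding pos_divide_less_eq[OF e2] .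
      also have "\<dots> \<le> real t * (2 * \<epsilon>)" using tp(3) \<epsilon>(1) by (intro mult_right_mono) auto
      finally show ?thesis by simp
    qed
    then have "real t * (real t * (2 * \<epsilon>) + 8 * real T) \<le> real t * (real t * (2 * \<epsilon>) + real t * (2 * \<epsilon>))"
      by (intro mult_left_mono add_left_mono) auto
    also have "\<dots> = (real t)\<^sup>2 * (4 * \<epsilon>)" by (simp add: power2_eq_square algebra_simps)
    also have "\<dots> \<le> (real t)\<^sup>2 * a\<^sup>2" using \<epsilon>(3) by (intro mult_left_mono) auto
    finally have var_t: "(\<integral>w. (\<Sum>i=1..t. Z i w)\<^sup>2 \<partial>M) \<le> (real t)\<^sup>2 * a\<^sup>2" using var[of t] by linarith
    define R where "R w = (\<Sum>i=1..t. Z i w) / real t" for w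
    have [measurable]: "R \<in> borel_measurable M" unfolding R_def by measurable
    have R2: "\<bar>R w\<bar> \<le> 2" for w
    proof -
      have "\<bar>\<Sum>i=1..t. Z i w\<bar> \<le> (\<Sum>i=1..t. 2)" by (rule order_trans[OF sum_abs]) (intro sum_mono Z2)
      then show ?thesis using tp by (simp add: R_def abs_divide pos_divide_le_eq mult.commute)
    qed
    have iR: "integrable M R" by (rule integrable_const_bound[of _ 2]) (use R2 in auto)
    have iR2: "integrable M (\<lambda>w. (R w)\<^sup>2)"
      by (rule integrable_const_bound[of _ "2\<^sup>2"]) (use power_mono[OF R2 abs_ge_zero, where n=2] in auto)
    have "(\<integral>w. (R w)\<^sup>2 \<partial>M) = (\<integral>w. (\<Sum>i=1..t. Z i w)\<^sup>2 \<partial>M) / (real t)\<^sup>2"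
      by (simp add: R_def power_divide)
    also have "\<dots> \<le> a\<^sup>2" using var_t tp by (simp add: pos_divide_le_eq mult.commute)
    finally have R_var: "(\<integral>w. (R w)\<^sup>2 \<partial>M) \<le> a\<^sup>2" .
    \<comment> \<open>Young's inequality, in place of Cauchy-Schwarz, with the scale
      \<open>a\<close> of the expected size of \<open>R\<close>.\<close>
    have "(\<integral>w. \<bar>R w\<bar> \<partial>M) \<le> (\<integral>w. a / 2 + (R w)\<^sup>2 / (2 * a) \<partial>M)"
    proof (rule integral_mono)
      fix w
      have "0 \<le> (\<bar>R w\<bar> - a)\<^sup>2" by simp
      then have "2 * a * \<bar>R w\<bar> \<le> a\<^sup>2 + (R w)\<^sup>2" by (simp add: power2_diff algebra_simps)
      then have "\<bar>R w\<bar> \<le> (a\<^sup>2 + (R w)\<^sup>2) / (2 * a)" using a by (simp add: pos_le_divide_eq mult.commute)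
      also have "\<dots> = a / 2 + (R w)\<^sup>2 / (2 * a)" using a by (simp add: add_divide_distrib power2_eq_square)
      finally show "\<bar>R w\<bar> \<le> a / 2 + (R w)\<^sup>2 / (2 * a)" .
    qed (use iR iR2 in auto)
    also have "\<dots> = a / 2 + (\<integral>w. (R w)\<^sup>2 \<partial>M) / (2 * a)" using iR2 by (simp add: prob_space)
    also have "\<dots> \<le> a / 2 + a\<^sup>2 / (2 * a)" using R_var a by (intro add_left_mono divide_right_mono) auto
    also have "\<dots> = a" using a by (simp add: power2_eq_square)
    finally have ER: "(\<integral>w. \<bar>R w\<bar> \<partial>M) \<le> a" .
    let ?G = "\<lambda>w. (\<Sum>i=1..t. g i w) / real t - I"
    have iG: "integrable M ?G"
      by (intro Bochner_Integration.integrable_diff integrable_divide Bochner_Integration.integrable_sum)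
        (auto intro!: integrable_const_bound[of _ 1] simp: g_def h1)
    have "(\<integral>w. \<bar>(\<Sum>i=1..t. f (X i w)) / real t - S\<bar> \<partial>M) \<le> (\<integral>w. \<bar>R w\<bar> + \<bar>?G w\<bar> + \<epsilon> \<partial>M)"
    proof (rule integral_mono)
      have eq: "(\<Sum>i=1..t. f (X i w)) / real t - S = R w + ?G w - (S - I)" for w
        by (simp add: R_def Z_def sum_subtractf diff_divide_distrib)
      show "integrable M (\<lambda>w. \<bar>(\<Sum>i=1..t. f (X i w)) / real t - S\<bar>)" unfolding eq
        by (rule integrable_abs[OF Bochner_Integration.integrable_diff[OF Bochner_Integration.integrable_add[OF iR iG]]]) simp
      show "integrable M (\<lambda>w. \<bar>R w\<bar> + \<bar>?G w\<bar> + \<epsilon>)"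
        by (rule Bochner_Integration.integrable_add[OF Bochner_Integration.integrable_add[OF
              integrable_abs[OF iR] integrable_abs[OF iG]]]) simp
      show "\<bar>(\<Sum>i=1..t. f (X i w)) / real t - S\<bar> \<le> \<bar>R w\<bar> + \<bar>?G w\<bar> + \<epsilon>" for w
        unfolding eq using SI by linarith
    qed
    also have "\<dots> = (\<integral>w. \<bar>R w\<bar> \<partial>M) + (\<integral>w. \<bar>?G w\<bar> \<partial>M) + \<epsilon>"
    proof -
      note i = integrable_abs[OF iR] integrable_abs[OF iG]
      have "(\<integral>w. \<bar>R w\<bar> + \<bar>?G w\<bar> + \<epsilon> \<partial>M) = (\<integral>w. \<bar>R w\<bar> + \<bar>?G w\<bar> \<partial>M) + (\<integral>w. \<epsilon> \<partial>M)"
        by (rule Bochner_Integration.integral_add[OF Bochner_Integration.integrable_add[OF i]]) simp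
      also have "(\<integral>w. \<bar>R w\<bar> + \<bar>?G w\<bar> \<partial>M) = (\<integral>w. \<bar>R w\<bar> \<partial>M) + (\<integral>w. \<bar>?G w\<bar> \<partial>M)"
        by (rule Bochner_Integration.integral_add[OF i])
      finally show ?thesis by (simp add: prob_space)
    qed
    also have "\<dots> < a + a + a" using ER t1[OF tp(2)] \<epsilon>(2) by linarith
    also have "\<dots> \<le> r" using a by (simp add: a_def)
    finally show ?thesis by simp
  qed
  then show "\<exists>no. \<forall>t\<ge>no. norm ((\<integral>w. \<bar>(\<Sum>i=1..t. f (X i w)) / real t - (\<integral>x. f x \<partial>limit_law)\<bar> \<partial>M) - 0) < r"
    unfolding S_def by (intro exI[of _ "max 1 (max t1 t2)"]) simp
qed

lemma lln_bounded:
  assumes f[measurable]: "f \<in> borel_measurable borel" and fB: "\<And>x. \<bar>f x\<bar> \<le> B" and B: "0 < B"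
  shows "(\<lambda>t. \<integral>w. \<bar>(\<Sum>i=1..t. f (X i w)) / real t - (\<integral>x. f x \<partial>limit_law)\<bar> \<partial>M) \<longlonglongrightarrow> 0"
proof -
  have "(\<lambda>t. \<integral>w. \<bar>(\<Sum>i=1..t. f (X i w) / B) / real t - (\<integral>x. f x / B \<partial>limit_law)\<bar> \<partial>M) \<longlonglongrightarrow> 0"
    by (rule lln_bounded_1) (use fB B in \<open>auto simp: abs_divide\<close>)
  then have "(\<lambda>t. B * (\<integral>w. \<bar>(\<Sum>i=1..t. f (X i w) / B) / real t - (\<integral>x. f x / B \<partial>limit_law)\<bar> \<partial>M)) \<longlonglongrightarrow> B * 0"
    by (rule tendsto_mult_left)
  moreover have "B * (\<integral>w. \<bar>(\<Sum>i=1..t. f (X i w) / B) / real t - (\<integral>x. f x / B \<partial>limit_law)\<bar> \<partial>M)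
      = (\<integral>w. \<bar>(\<Sum>i=1..t. f (X i w)) / real t - (\<integral>x. f x \<partial>limit_law)\<bar> \<partial>M)" for t
  proof -
    have "B * \<bar>(\<Sum>i=1..t. f (X i w) / B) / real t - (\<integral>x. f x / B \<partial>limit_law)\<bar>
        = \<bar>(\<Sum>i=1..t. f (X i w)) / real t - (\<integral>x. f x \<partial>limit_law)\<bar>" for w
    proof -
      have "(\<Sum>i=1..t. f (X i w) / B) / real t - (\<integral>x. f x / B \<partial>limit_law)
          = ((\<Sum>i=1..t. f (X i w)) / real t - (\<integral>x. f x \<partial>limit_law)) / B"
        by (simp add: diff_divide_distrib sum_divide_distrib[symmetric] mult.commute)
      then show ?thesis using B by (simp add: abs_divide)
    qed
    then show ?thesis by (subst integral_mult_right_zero[symmetric]) simp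
  qed
  ultimately show ?thesis by simp
qed

end

section \<open>From bounded functions to functions of growth V^\<delta> and convergence in
  L^p\<close>

lemma powr_growth:
  fixes v \<delta> :: real
  assumes "0 \<le> v" "0 < \<delta>"
  shows "(1 + v powr \<delta>) powr (1 / \<delta>) \<le> 2 powr (1 / \<delta>) * (1 + v)"
proof (cases "v \<le> 1")
  case True
  have "v powr \<delta> \<le> 1 powr \<delta>" using assms True by (intro powr_mono2) auto
  then have "(1 + v powr \<delta>) powr (1 / \<delta>) \<le> 2 powr (1 / \<delta>)" using assms by (intro powr_mono2) auto
  also have "\<dots> \<le> 2 powr (1 / \<delta>) * (1 + v)" using assms by simp
  finally show ?thesis .
next
  case False
  have "1 \<le> v powr \<delta>" using False assms by (intro ge_one_powr_ge_zero) auto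
  then have "(1 + v powr \<delta>) powr (1 / \<delta>) \<le> (2 * v powr \<delta>) powr (1 / \<delta>)"
    using assms by (intro powr_mono2) auto
  also have "\<dots> = 2 powr (1 / \<delta>) * v" using assms by (simp add: powr_mult powr_powr)
  also have "\<dots> \<le> 2 powr (1 / \<delta>) * (1 + v)" by simp
  finally show ?thesis .
qed

text \<open>Below the cut \<open>a\<close> the first moment controls the power, above it the moment
  of order \<open>q\<close> does, with the factor \<open>a powr (p - q)\<close>, which for p < q is
  small when \<open>a\<close> is large.\<close>

lemma powr_interpolation:
  fixes z a p q :: real
  assumes "0 \<le> z" "0 < a" "1 \<le> p" "p \<le> q"
  shows "z powr p \<le> a powr (p - 1) * z + a powr (p - q) * z powr q"
proof (cases "z = 0")
  case False
  then have z: "0 < z" using assms by simp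
  show ?thesis
  proof (cases "z \<le> a")
    case True
    have "z powr p = z powr (p - 1) * z" using z by (simp flip: powr_mult_base add: powr_diff)
    also have "\<dots> \<le> a powr (p - 1) * z" using True z assms by (intro mult_right_mono powr_mono2) auto
    finally show ?thesis by (simp add: add_increasing2)
  next
    case False
    have "z powr p = z powr (p - q) * z powr q" using z by (simp flip: powr_add)
    also have "\<dots> \<le> a powr (p - q) * z powr q"
      using False z assms by (intro mult_right_mono powr_mono2') auto
    finally show ?thesis using assms by (simp add: add_increasing)
  qed
qed (use assms in simp)

lemma powr_mean_le:
  fixes u :: "nat \<Rightarrow> real"
  assumes t: "1 \<le> t" and q: "1 \<le> q" and u: "\<And>i. 0 < u i"
  shows "((\<Sum>i=1..t. u i) / real t) powr q \<le> (\<Sum>i=1..t. u i powr q) / real t"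
proof -
  have "(\<Sum>i\<in>{1..t}. (1 / real t) *\<^sub>R u i) powr q \<le> (\<Sum>i\<in>{1..t}. (1 / real t) * (u i powr q))"
    by (rule convex_on_sum[where f="\<lambda>x. x powr q", OF _ _ powr_convex[OF q]]) (use t u in auto)
  then show ?thesis by (simp add: sum_divide_distrib)
qed

context environment_chain
begin

text \<open>The first moment of \<open>V\<close>, bounded uniformly in time and under the limit law,
  controls second moments of \<open>f\<close>; the elementary bound of 2|f| by 1 + f^2 supplies the
  first ones.\<close>

lemma quadratic_integrable:
  fixes f :: "'x \<Rightarrow> real"
  assumes f[measurable]: "f \<in> borel_measurable borel" and C: "\<And>x. (f x)\<^sup>2 \<le> C * (1 + V x)"
  shows "integrable M (\<lambda>w. f (X i w))" "integrable M (\<lambda>w. (f (X i w))\<^sup>2)"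
    "(\<integral>w. (f (X i w))\<^sup>2 \<partial>M) \<le> C * (1 + V_bound)"
    "integrable limit_law f" "integrable limit_law (\<lambda>x. (f x)\<^sup>2)"
    "(\<integral>x. (f x)\<^sup>2 \<partial>limit_law) \<le> C * (1 + V_bound)"
proof -
  interpret L: prob_space limit_law by (rule prob_space_limit_law)
  have C0: "0 \<le> C"
  proof -
    have "0 \<le> C * (1 + V undefined)" by (rule order_trans[OF zero_le_power2 C])
    then show ?thesis using V_nonneg[of undefined] by (simp add: zero_le_mult_iff)
  qed
  have abs: "\<bar>f x\<bar> \<le> 1 + C * (1 + V x)" for x
  proof -
    have "0 \<le> (\<bar>f x\<bar> - 1)\<^sup>2" by simp
    then have "2 * \<bar>f x\<bar> \<le> 1 + (f x)\<^sup>2" by (simp add: power2_diff)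
    moreover have "0 \<le> \<bar>f x\<bar>" by simp
    ultimately show ?thesis using C[of x] by linarith
  qed
  have abs': "\<bar>f x\<bar> \<le> \<bar>1 + C * (1 + V x)\<bar>" for x using abs[of x] by linarith
  have C1: "0 \<le> C * (1 + V x)" for x using C0 V_nonneg[of x] by simp
  have iM: "integrable M (\<lambda>w. C * (1 + V (X i w)))" using V_X_integrable by simp
  have iL: "integrable limit_law (\<lambda>x. C * (1 + V x))" using V_limit_integrable by simp
  show "integrable M (\<lambda>w. f (X i w))"
    by (rule Bochner_Integration.integrable_bound[where f="\<lambda>w. 1 + C * (1 + V (X i w))"])
      (use iM in \<open>simp_all only: real_norm_def abs' AE_I2 Bochner_Integration.integrable_add integrable_const, measurable\<close>)
  show i2: "integrable M (\<lambda>w. (f (X i w))\<^sup>2)"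
    by (rule Bochner_Integration.integrable_bound[OF iM]) (use C C1 in auto)
  have "(\<integral>w. (f (X i w))\<^sup>2 \<partial>M) \<le> (\<integral>w. C * (1 + V (X i w)) \<partial>M)"
    by (intro integral_mono i2 iM C)
  also have "\<dots> = C * (1 + (\<integral>w. V (X i w) \<partial>M))" using V_X_integrable by (simp add: prob_space)
  also have "\<dots> \<le> C * (1 + V_bound)" using V_X_integral_le C0 by (intro mult_left_mono) auto
  finally show "(\<integral>w. (f (X i w))\<^sup>2 \<partial>M) \<le> C * (1 + V_bound)" .
  show "integrable limit_law f"
    by (rule Bochner_Integration.integrable_bound[where f="\<lambda>x. 1 + C * (1 + V x)"])
      (use iL in \<open>simp_all only: real_norm_def abs' AE_I2 Bochner_Integration.integrable_add L.integrable_const, measurable\<close>)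
  show j2: "integrable limit_law (\<lambda>x. (f x)\<^sup>2)"
    by (rule Bochner_Integration.integrable_bound[OF iL]) (use C C1 in auto)
  have "(\<integral>x. (f x)\<^sup>2 \<partial>limit_law) \<le> (\<integral>x. C * (1 + V x) \<partial>limit_law)"
    by (intro integral_mono j2 iL C)
  also have "\<dots> = C * (1 + (\<integral>x. V x \<partial>limit_law))" using V_limit_integrable by (simp add: L.prob_space)
  also have "\<dots> \<le> C * (1 + V_bound)" using V_limit_integral_le C0 by (intro mult_left_mono) auto
  finally show "(\<integral>x. (f x)\<^sup>2 \<partial>limit_law) \<le> C * (1 + V_bound)" .
qed

text \<open>Truncation at height B costs at most f^2/B pointwise, hence G/B in mean, uniformly in
  time and under the limit law. The bounded case handles the truncated function.\<close>

lemma lln_L1: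
  assumes f[measurable]: "f \<in> borel_measurable borel" and C: "\<And>x. (f x)\<^sup>2 \<le> C * (1 + V x)"
  shows "(\<lambda>t. \<integral>w. \<bar>(\<Sum>i=1..t. f (X i w)) / real t - (\<integral>x. f x \<partial>limit_law)\<bar> \<partial>M) \<longlonglongrightarrow> 0"
proof (rule LIMSEQ_I)
  fix r :: real assume r: "0 < r"
  interpret L: prob_space limit_law by (rule prob_space_limit_law)
  note q = quadratic_integrable[OF f C]
  define G where "G = C * (1 + V_bound)"
  have "0 \<le> (\<integral>x. (f x)\<^sup>2 \<partial>limit_law)" by (intro integral_nonneg_AE) simp
  then have G0: "0 \<le> G" unfolding G_def using q(6) by (rule order_trans)
  \<comment> \<open>Solves G/B <= r/4; the added 1 keeps \<open>B\<close> positive even for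
    \<open>G = 0\<close>.\<close>
  define B where "B = 4 * G / r + 1"
  have B: "0 < B" using G0 r by (simp add: B_def add_nonneg_pos)
  have GB: "G / B \<le> r / 4"
  proof -
    have "r / 4 * B = r / 4 * (4 * G / r) + r / 4 * 1" unfolding B_def by (rule distrib_left)
    also have "\<dots> = G + r / 4" using r by simp
    finally show ?thesis unfolding pos_divide_le_eq[OF B] using r by linarith
  qed
  define h where "h x = max (- B) (min B (f x))" for x
  have [measurable]: "h \<in> borel_measurable borel" unfolding h_def by measurable
  have hB: "\<bar>h x\<bar> \<le> B" for x using B by (auto simp: h_def)
  have fh: "\<bar>f x - h x\<bar> \<le> (f x)\<^sup>2 / B" for x
  proof (cases "\<bar>f x\<bar> \<le> B")
    case True
    then have "h x = f x" by (auto simp: h_def)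
    then show ?thesis using B by simp
  next
    case False
    then have "\<bar>f x - h x\<bar> \<le> \<bar>f x\<bar>" using B by (auto simp: h_def min_def max_def abs_if)
    also have "\<dots> \<le> \<bar>f x\<bar> * \<bar>f x\<bar> / B" 
      unfolding pos_le_divide_eq[OF B] using False by (intro mult_left_mono) auto
    also have "\<dots> = (f x)\<^sup>2 / B" by (simp add: power2_eq_square)
    finally show ?thesis .
  qed
  let ?Sf = "\<integral>x. f x \<partial>limit_law" and ?Sh = "\<integral>x. h x \<partial>limit_law"
  have ihL: "integrable limit_law h" by (rule L.integrable_const_bound[of _ B]) (use hB in auto)
  have ihM: "integrable M (\<lambda>w. h (X i w))" for i by (rule integrable_const_bound[of _ B]) (use hB in auto)
  have SS: "\<bar>?Sf - ?Sh\<bar> \<le> r / 4"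
  proof -
    have "\<bar>?Sf - ?Sh\<bar> = \<bar>\<integral>x. f x - h x \<partial>limit_law\<bar>" using q(4) ihL by simp
    also have "\<dots> \<le> (\<integral>x. \<bar>f x - h x\<bar> \<partial>limit_law)" by (rule integral_abs_bound)
    also have "\<dots> \<le> (\<integral>x. (f x)\<^sup>2 / B \<partial>limit_law)"
      using q(4,5) ihL by (intro integral_mono fh integrable_abs Bochner_Integration.integrable_diff integrable_divide)
    also have "\<dots> \<le> G / B" using q(6) B by (simp add: G_def divide_right_mono)
    finally show ?thesis using GB by (rule order_trans)
  qed
  have "(\<lambda>t. \<integral>w. \<bar>(\<Sum>i=1..t. h (X i w)) / real t - ?Sh\<bar> \<partial>M) \<longlonglongrightarrow> 0"
    by (rule lln_bounded[OF _ hB B]) measurable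
  then have "eventually (\<lambda>t. (\<integral>w. \<bar>(\<Sum>i=1..t. h (X i w)) / real t - ?Sh\<bar> \<partial>M) < r / 4) sequentially"
    using r by (intro order_tendstoD(2)) auto
  then obtain t0 where
    t0: "\<And>t. t \<ge> t0 \<Longrightarrow> (\<integral>w. \<bar>(\<Sum>i=1..t. h (X i w)) / real t - ?Sh\<bar> \<partial>M) < r / 4"
    unfolding eventually_sequentially by blast
  have "\<bar>\<integral>w. \<bar>(\<Sum>i=1..t. f (X i w)) / real t - ?Sf\<bar> \<partial>M\<bar> < r" if t: "t \<ge> max 1 t0" for t
  proof -
    have tp: "0 < real t" using t by simp
    let ?F = "\<lambda>w. (\<Sum>i=1..t. f (X i w)) / real t" and ?H = "\<lambda>w. (\<Sum>i=1..t. h (X i w)) / real t"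
    let ?E = "\<lambda>w. (\<Sum>i=1..t. (f (X i w))\<^sup>2 / B) / real t"
    have iF: "integrable M (\<lambda>w. \<bar>?F w - ?Sf\<bar>)"
      by (intro integrable_abs Bochner_Integration.integrable_diff integrable_divide Bochner_Integration.integrable_sum q(1)) simp
    have iH: "integrable M (\<lambda>w. \<bar>?H w - ?Sh\<bar>)"
      by (intro integrable_abs Bochner_Integration.integrable_diff integrable_divide Bochner_Integration.integrable_sum ihM) simp
    have iE: "integrable M ?E"
      by (intro integrable_divide Bochner_Integration.integrable_sum q(2))
    have pt: "\<bar>?F w - ?Sf\<bar> \<le> ?E w + \<bar>?H w - ?Sh\<bar> + r / 4" for w
    proof -
      have "?F w - ?H w = (\<Sum>i=1..t. f (X i w) - h (X i w)) / real t"
        by (simp add: sum_subtractf diff_divide_distrib)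
      moreover have "\<bar>\<Sum>i=1..t. f (X i w) - h (X i w)\<bar> \<le> (\<Sum>i=1..t. (f (X i w))\<^sup>2 / B)"
        by (rule order_trans[OF sum_abs]) (intro sum_mono fh)
      ultimately have "\<bar>?F w - ?H w\<bar> \<le> ?E w" using tp by (simp add: abs_divide divide_right_mono)
      then show ?thesis using SS by linarith
    qed
    have "(\<integral>w. \<bar>?F w - ?Sf\<bar> \<partial>M) \<le> (\<integral>w. ?E w + \<bar>?H w - ?Sh\<bar> + r / 4 \<partial>M)"
      by (intro integral_mono iF Bochner_Integration.integrable_add iE iH pt) simp
    also have "\<dots> = (\<integral>w. ?E w \<partial>M) + (\<integral>w. \<bar>?H w - ?Sh\<bar> \<partial>M) + r / 4"
    proof -
      have "(\<integral>w. ?E w + \<bar>?H w - ?Sh\<bar> + r / 4 \<partial>M) = (\<integral>w. ?E w + \<bar>?H w - ?Sh\<bar> \<partial>M) + (\<integral>w. r / 4 \<partial>M)"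
        by (rule Bochner_Integration.integral_add[OF Bochner_Integration.integrable_add[OF iE iH]]) simp
      also have "(\<integral>w. ?E w + \<bar>?H w - ?Sh\<bar> \<partial>M) = (\<integral>w. ?E w \<partial>M) + (\<integral>w. \<bar>?H w - ?Sh\<bar> \<partial>M)"
        by (rule Bochner_Integration.integral_add[OF iE iH])
      finally show ?thesis by (simp add: prob_space)
    qed
    also have "(\<integral>w. ?E w \<partial>M) \<le> G / B"
    proof -
      have "(\<integral>w. ?E w \<partial>M) = (\<Sum>i=1..t. (\<integral>w. (f (X i w))\<^sup>2 \<partial>M) / B) / real t"
        using q(2) by simp
      also have "\<dots> \<le> (\<Sum>i=1..t. G / B) / real t"
        using q(3) B tp by (intro divide_right_mono sum_mono) (auto simp: G_def)
      also have "\<dots> = G / B" using tp by simp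
      finally show ?thesis .
    qed
    finally have "(\<integral>w. \<bar>?F w - ?Sf\<bar> \<partial>M) \<le> G / B + (\<integral>w. \<bar>?H w - ?Sh\<bar> \<partial>M) + r / 4" by simp
    moreover have "(\<integral>w. \<bar>?H w - ?Sh\<bar> \<partial>M) < r / 4" using t by (intro t0) simp
    ultimately have "(\<integral>w. \<bar>?F w - ?Sf\<bar> \<partial>M) < r" using GB r by linarith
    then show ?thesis by simp
  qed
  then show "\<exists>no. \<forall>t\<ge>no. norm ((\<integral>w. \<bar>(\<Sum>i=1..t. f (X i w)) / real t - ?Sf\<bar> \<partial>M) - 0) < r"
    by (intro exI[of _ "max 1 t0"]) simp
qed

text \<open>Here \<delta> <= 1/2 enters: the base 1 + V^\<delta> is at least 1, so its square is
  below its power of order 1/\<delta>, which grows no faster than \<open>V\<close>.\<close>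

lemma growth_quadratic:
  fixes f :: "'x \<Rightarrow> real"
  assumes \<delta>: "0 < \<delta>" "\<delta> \<le> 1/2" and fc: "\<And>x. \<bar>f x\<bar> \<le> c * (1 + V x powr \<delta>)"
  shows "(f x)\<^sup>2 \<le> c\<^sup>2 * 2 powr (1 / \<delta>) * (1 + V x)"
proof -
  let ?u = "1 + V x powr \<delta>"
  have "(f x)\<^sup>2 \<le> (c * ?u)\<^sup>2" using power_mono[OF fc abs_ge_zero, of x 2] by simp
  also have "\<dots> = c\<^sup>2 * ?u powr 2" by (simp add: power_mult_distrib add_nonneg_pos)
  also have "\<dots> \<le> c\<^sup>2 * ?u powr (1 / \<delta>)"
  proof -
    have "2 \<le> 1 / \<delta>" using \<delta> by (simp add: field_simps)
    then show ?thesis by (intro mult_left_mono powr_mono) auto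
  qed
  also have "\<dots> \<le> c\<^sup>2 * (2 powr (1 / \<delta>) * (1 + V x))"
    by (intro mult_left_mono powr_growth V_nonneg \<delta>) simp
  finally show ?thesis by (simp add: mult.assoc)
qed

text \<open>Convexity bounds the moment of order \<open>q = 1 / \<delta>\<close> of the averages by
  first moments of \<open>V\<close>, uniformly in time. Interpolation with convergence in mean then
  reaches every \<open>p\<close> below \<open>q\<close>.\<close>

lemma lln_Lp:
  fixes f :: "'x \<Rightarrow> real"
  assumes f[measurable]: "f \<in> borel_measurable borel"
    and \<delta>: "0 < \<delta>" "\<delta> \<le> 1/2" and fc: "\<And>x. \<bar>f x\<bar> \<le> c * (1 + V x powr \<delta>)"
    and p: "1 \<le> p" "p < 1 / \<delta>"
  shows "tendsto_Lp M p (\<lambda>t w. (\<Sum>i=1..t. f (X i w)) / real t) (\<integral>x. f x \<partial>limit_law)"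
  unfolding tendsto_Lp_def
proof (rule ennreal_tendsto_0I)
  fix e :: real assume e: "0 < e"
  note quad = growth_quadratic[OF \<delta> fc]
  let ?S = "\<integral>x. f x \<partial>limit_law"
  define Z where "Z t w = (\<Sum>i=1..t. f (X i w)) / real t - ?S" for t w
  define q where "q = 1 / \<delta>"
  have q: "1 \<le> q" "p < q" using p by (auto simp: q_def)
  have c0: "0 \<le> c"
  proof -
    have "0 \<le> c * (1 + V undefined powr \<delta>)" by (rule order_trans[OF abs_ge_zero fc])
    moreover have "0 < 1 + V undefined powr \<delta>" by (simp add: add_pos_nonneg)
    ultimately show ?thesis by (auto simp: zero_le_mult_iff)
  qed
  \<comment> \<open>The added 1 makes the majorants \<open>u i\<close> strictly positive, as the
    convexity inequality requires.\<close>
  define c' where "c' = c + \<bar>?S\<bar> + 1"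
  have c': "0 < c'" using c0 by (simp add: c'_def)
  define u where "u i w = c' * (1 + V (X i w) powr \<delta>)" for i :: nat and w
  have u0: "0 < u i w" for i w using c' by (simp add: u_def add_pos_nonneg)
  have fu: "\<bar>f (X i w) - ?S\<bar> \<le> u i w" for i w
  proof -
    have "\<bar>f (X i w) - ?S\<bar> \<le> c * (1 + V (X i w) powr \<delta>) + \<bar>?S\<bar>" using fc[of "X i w"] by linarith
    also have "\<dots> \<le> c * (1 + V (X i w) powr \<delta>) + (\<bar>?S\<bar> + 1) * (1 + V (X i w) powr \<delta>)"
    proof -
      have "\<bar>?S\<bar> * 1 \<le> (\<bar>?S\<bar> + 1) * (1 + V (X i w) powr \<delta>)" by (intro mult_mono) auto
      then show ?thesis by simp
    qed
    also have "\<dots> = u i w" by (simp add: u_def c'_def distrib_right)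
    finally show ?thesis .
  qed
  define k where "k = (c' powr q) * 2 powr q"
  have k0: "0 \<le> k" by (simp add: k_def)
  have uq: "u i w powr q \<le> k * (1 + V (X i w))" for i w
  proof -
    have "u i w powr q = c' powr q * (1 + V (X i w) powr \<delta>) powr q"
      using c' by (simp add: u_def powr_mult)
    also have "\<dots> \<le> c' powr q * (2 powr q * (1 + V (X i w)))"
      unfolding q_def by (intro mult_left_mono powr_growth V_nonneg \<delta>) simp
    finally show ?thesis by (simp add: k_def mult.assoc)
  qed
  define G where "G = k * (1 + V_bound)"
  have G0: "0 \<le> G" using k0 V_bound_nonneg by (simp add: G_def)
  \<comment> \<open>\<open>G\<close> bounds the q-th moments. The cut \<open>a\<close> solves
    \<open>a powr (p - q) = 1 / x\<close>, and \<open>x\<close> is large enough for G/x <=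
    e/2.\<close>
  define x where "x = 2 * G / e + 1"
  have x: "0 < x" using G0 e by (simp add: x_def add_nonneg_pos)
  define a where "a = x powr (1 / (q - p))"
  have a: "0 < a" using x by (simp add: a_def)
  have "a powr (p - q) = 1 / x"
  proof -
    have "1 / (q - p) * (p - q) = - 1" using q by (simp add: field_simps)
    then show ?thesis using x by (simp add: a_def powr_powr powr_minus_divide)
  qed
  moreover have "1 / x * G \<le> e / 2"
  proof -
    have "e / 2 * x = e / 2 * (2 * G / e) + e / 2 * 1" unfolding x_def by (rule distrib_left)
    also have "\<dots> = G + e / 2" using e by simp
    finally have "G / x \<le> e / 2" unfolding pos_divide_le_eq[OF x] using e by linarith
    then show ?thesis by simp
  qed
  ultimately have aG: "a powr (p - q) * G \<le> e / 2" by simp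
  have "(\<lambda>t. a powr (p - 1) * (\<integral>w. \<bar>Z t w\<bar> \<partial>M)) \<longlonglongrightarrow> a powr (p - 1) * 0"
    unfolding Z_def by (intro tendsto_mult_left lln_L1[OF f quad])
  then have "eventually (\<lambda>t. a powr (p - 1) * (\<integral>w. \<bar>Z t w\<bar> \<partial>M) < e / 2) sequentially"
    using e by (intro order_tendstoD(2)) auto
  then obtain t0 where t0: "\<And>t. t \<ge> t0 \<Longrightarrow> a powr (p - 1) * (\<integral>w. \<bar>Z t w\<bar> \<partial>M) < e / 2"
    by (auto simp: eventually_sequentially)
  have "(\<integral>\<^sup>+w. ennreal (\<bar>Z t w\<bar> powr p) \<partial>M) \<le> ennreal e" if t: "t \<ge> max 1 t0" for t
  proof -
    have tp: "0 < real t" "1 \<le> t" using t by auto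
    let ?K = "\<lambda>w. (\<Sum>i=1..t. k * (1 + V (X i w))) / real t"
    let ?R = "\<lambda>w. a powr (p - 1) * \<bar>Z t w\<bar> + a powr (p - q) * ?K w"
    have iZ: "integrable M (\<lambda>w. \<bar>Z t w\<bar>)"
      unfolding Z_def
      by (intro integrable_abs Bochner_Integration.integrable_diff integrable_divide
          Bochner_Integration.integrable_sum quadratic_integrable(1)[OF f quad]) simp
    have iK: "integrable M ?K"
      using V_X_integrable
      by (intro integrable_divide Bochner_Integration.integrable_sum integrable_mult_right Bochner_Integration.integrable_add) auto
    have iR: "integrable M ?R"
      by (intro Bochner_Integration.integrable_add integrable_mult_right iZ iK)
    have pt: "\<bar>Z t w\<bar> powr p \<le> ?R w" for w
    proof -
      have "Z t w = (\<Sum>i=1..t. f (X i w) - ?S) / real t"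
        using tp by (simp add: Z_def sum_subtractf diff_divide_distrib)
      moreover have "\<bar>\<Sum>i=1..t. f (X i w) - ?S\<bar> \<le> (\<Sum>i=1..t. u i w)"
        by (rule order_trans[OF sum_abs]) (intro sum_mono fu)
      ultimately have "\<bar>Z t w\<bar> \<le> (\<Sum>i=1..t. u i w) / real t"
        using tp by (simp add: abs_divide divide_right_mono)
      then have "\<bar>Z t w\<bar> powr q \<le> ((\<Sum>i=1..t. u i w) / real t) powr q"
        using q by (intro powr_mono2) auto
      also have "\<dots> \<le> (\<Sum>i=1..t. u i w powr q) / real t"
        by (rule powr_mean_le[OF tp(2) q(1) u0])
      also have "\<dots> \<le> ?K w" using tp by (intro divide_right_mono sum_mono uq) auto
      finally have "a powr (p - q) * \<bar>Z t w\<bar> powr q \<le> a powr (p - q) * ?K w"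
        by (intro mult_left_mono) auto
      then show ?thesis using powr_interpolation[of "\<bar>Z t w\<bar>" a p q] a p q by simp
    qed
    have "(\<integral>\<^sup>+w. ennreal (\<bar>Z t w\<bar> powr p) \<partial>M) \<le> (\<integral>\<^sup>+w. ennreal (?R w) \<partial>M)"
      by (intro nn_integral_mono ennreal_leI pt)
    also have "\<dots> = ennreal (\<integral>w. ?R w \<partial>M)"
      using order_trans[OF powr_ge_zero pt] by (intro nn_integral_eq_integral iR) auto
    also have "(\<integral>w. ?R w \<partial>M) = a powr (p - 1) * (\<integral>w. \<bar>Z t w\<bar> \<partial>M) + a powr (p - q) * (\<integral>w. ?K w \<partial>M)"
      by (simp only: Bochner_Integration.integral_add[OF integrable_mult_right[OF iZ] integrable_mult_right[OF iK]]
          integral_mult_right_zero)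
    also have "\<dots> \<le> e"
    proof -
      have "(\<integral>w. ?K w \<partial>M) = (\<Sum>i=1..t. k * (1 + (\<integral>w. V (X i w) \<partial>M))) / real t"
        using V_X_integrable by (simp add: prob_space)
      also have "\<dots> \<le> (\<Sum>i=1..t. G) / real t"
        unfolding G_def using k0 tp
        by (intro divide_right_mono sum_mono mult_left_mono add_left_mono V_X_integral_le) auto
      also have "\<dots> = G" using tp by simp
      finally have "a powr (p - q) * (\<integral>w. ?K w \<partial>M) \<le> a powr (p - q) * G" by (intro mult_left_mono) auto
      then show ?thesis using aG t0[of t] t by simp
    qed
    finally show ?thesis by (simp add: ennreal_leI)
  qed
  then show "\<exists>T. \<forall>t\<ge>T. (\<integral>\<^sup>+w. ennreal (\<bar>(\<Sum>i=1..t. f (X i w)) / real t - ?S\<bar> powr p) \<partial>M) \<le> ennreal e"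
    unfolding Z_def by blast
qed

end

theorem theorem2p14:
  fixes M :: "'w measure"
    and Y :: "int \<Rightarrow> 'w \<Rightarrow> 'y::polish_space"
    and Q :: "'y \<Rightarrow> 'x::polish_space \<Rightarrow> 'x measure"
    and X :: "nat \<Rightarrow> 'w \<Rightarrow> 'x"
    and V :: "'x \<Rightarrow> real"
    and A :: "nat \<Rightarrow> 'y set"
    and lam K alpha l :: "nat \<Rightarrow> real"
    and \<nu> :: "nat \<Rightarrow> 'x measure"
    and g :: "nat \<Rightarrow> nat"
    and \<delta> c :: real
    and \<phi> :: "'x \<Rightarrow> real"
  assumes "prob_space M"
    and "strongly_stationary M Y" and "ergodic_process M Y"
    and "kernel_family Q" and "process_in_environment M Y Q X"
    (* (i) *)
    and "V \<in> borel_measurable borel" and "\<And>x. 0 \<le> V x"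
    and "\<And>n. A n \<in> sets borel" and "mono A" and "A 0 \<noteq> {}" and "(\<Union>n. A n) = UNIV"
    and "antimono lam" and "\<And>n. 0 < lam n \<and> lam n \<le> 1/3"
    and "mono K" and "\<And>n. 1 \<le> K n"
    and "\<And>x y. (\<integral>\<^sup>+ z. ennreal (V z) \<partial>Q y x)
                 \<le> ennreal ((1 - lam (level A y)) * V x + K (level A y))"
    (* (ii) *)
    and "antimono alpha" and "\<And>n. 0 < alpha n \<and> alpha n \<le> 1/3"
    and "\<And>n. prob_space (\<nu> n)" and "\<And>n. sets (\<nu> n) = sets borel"
    and "\<And>y x B. V x \<le> 8 * K (level A y) / lam (level A y) \<Longrightarrow> B \<in> sets borel \<Longrightarrow>
           measure (Q y x) B \<ge> alpha (level A y) * measure (\<nu> (level A y)) B"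
    (* (iii) *)
    and "mono g" and "antimono l" and "\<And>t. 0 \<le> l t \<and> l t \<le> 1"
    and "\<And>t. t \<ge> 1 \<Longrightarrow>
           measure M {w \<in> space M. Max ((\<lambda>i. level A (Y (int i) w)) ` {1..t}) \<ge> g t} \<le> l t"
    (* (iv) *)
    and "integrable M (\<lambda>w. (V (X 0 w))\<^sup>2 + (V (X 1 w))\<^sup>2)"
    (* (v) *)
    and "summable (\<lambda>k. K (g k) / alpha (g k) * exp (- real k * alpha (g k) * lam (g k) / 2))"
    and "summable (\<lambda>k. K (g (k + 1)) / ((alpha (g (k + 1)))\<^sup>2 * lam (g (k + 1))) * sqrt (l k))"
    (* (vi) *)
    and "0 < \<delta>" and "\<delta> \<le> 1/2"
    and "(\<lambda>t. (K (g t) / lam (g t)) powr (2 * \<delta>)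
               * (\<bar>ln (lam (g t))\<bar> / (alpha (g t) * lam (g t))) / real t) \<longlonglongrightarrow> 0"
    and "\<phi> \<in> borel_measurable borel" and "\<And>z. \<bar>\<phi> z\<bar> \<le> c * (1 + V z powr \<delta>)"
  shows "\<exists>\<mu>. prob_space \<mu> \<and> sets \<mu> = sets borel \<and>
           (\<lambda>t. rho1 V (distr M borel (X t)) \<mu>) \<longlonglongrightarrow> 0 \<and>
           integrable \<mu> \<phi> \<and>
           (\<forall>p. 1 \<le> p \<and> p < 1 / \<delta> \<longrightarrow>
              tendsto_Lp M p (\<lambda>t w. (\<Sum>i=1..t. \<phi> (X i w)) / real t) (\<integral>z. \<phi> z \<partial>\<mu>))"
proof -
  interpret drift_minorization Q V A lam K alpha \<nu>
    by (rule drift_minorization.intro[OF assms(4,6,7,8,11,12,13,14,15,16,18,19,20,21)])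
  interpret prob_space M by (rule assms(1))
  interpret random_environment Q V A lam K alpha \<nu> M Y
    by (intro random_environment.intro random_environment_axioms.intro drift_minorization_axioms assms(1-3))
  \<comment> \<open>Square integrability at time 0 yields integrability through the bound of 2|v| by
    1 + v^2.\<close>
  have V0: "integrable M (\<lambda>w. V (X 0 w))"
  proof (rule Bochner_Integration.integrable_bound)
    show "integrable M (\<lambda>w. 1 + ((V (X 0 w))\<^sup>2 + (V (X 1 w))\<^sup>2))"
      using assms(26) by simp
    have "X 0 \<in> borel_measurable M"
      using assms(5) by (simp add: process_in_environment_def)
    from measurable_compose[OF this assms(6)] show "(\<lambda>w. V (X 0 w)) \<in> borel_measurable M" .
    have "\<bar>v\<bar> \<le> \<bar>1 + (v\<^sup>2 + v'\<^sup>2)\<bar>" for v v' :: real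
    proof -
      have "0 \<le> (\<bar>v\<bar> - 1)\<^sup>2" by simp
      then have "2 * \<bar>v\<bar> \<le> 1 + v\<^sup>2" by (simp add: power2_diff)
      moreover have "0 \<le> v'\<^sup>2" "0 \<le> \<bar>v\<bar>" by simp_all
      ultimately show ?thesis by linarith
    qed
    then show "AE w in M. norm (V (X 0 w)) \<le> norm (1 + ((V (X 0 w))\<^sup>2 + (V (X 1 w))\<^sup>2))" by simp
  qed
  \<comment> \<open>Here the bound on the maximal process and the two summable series enter.\<close>
  have fin: "(\<integral>\<^sup>+y. drift_sum y \<partial>path_law M Y) < \<top>"
    by (rule drift_sum_integral_finite[OF assms(22,24,25,27,28)])
  interpret environment_chain Q V A lam K alpha \<nu> M Y X
    by (intro environment_chain.intro environment_chain_axioms.intro random_environment_axioms assms(5) V0 fin)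
  have "integrable limit_law \<phi>"
    by (rule quadratic_integrable(4)[OF assms(32) growth_quadratic[OF assms(29,30,33)]])
  then show ?thesis
    by (intro exI[of _ limit_law] conjI allI impI prob_space_limit_law sets_limit_law
        rho1_law_tendsto lln_Lp[OF assms(32,29,30,33)]) auto
qed

end
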